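(* Let $F:\mathbb{R}^3\to[0,\infty)$ be a strictly convex integrand that is even in each component. Assume moreover that, for any coordinate plane $P\subset\mathbb{R}^3$, denoting by $\pi_P$ the orthogonal projection onto $P$, the unit vector $$\frac{\pi_P(\nabla F(\nu))}{|\pi_P(\nabla F(\nu))|}$$ depends only on $\frac{\pi_P(\nu)}{|\pi_P(\nu)|}$, for all $\nu\in\mathbb{S}^2\setminus\pi_P^{-1}(0)$ (note that $\pi_P(\nabla F(\nu))\ne0$ for such $\nu$). Then there is a constant $C(F)>0$ such that, for every rectifiable $2$-varifold $V$ in $\mathbb{R}^3$ with $|V|(\mathbb{R}^3)<\infty$ and $|\delta^FV|(\mathbb{R}^3)<\infty$, letting $\theta(x):=\Theta^2_*(|V|,x)$, we have $$|V|(\mathbb{R}^3)\le C(F)\,\mathcal{H}^2(\{\theta>0\})^{1/2}\cdot|\delta^F V|(\mathbb{R}^3).$$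
   Context: A $2$-varifold $V$ in $\mathbb{R}^3$ is a nonnegative Radon measure on $\mathbb{R}^3\times\mathrm{Gr}_2(\mathbb{R}^3)$; its weight $|V|$ is the pushforward of $V$ to $\mathbb{R}^3$. $V$ is rectifiable if there are a countably $2$-rectifiable Borel set $\Sigma$ and a Borel, locally $\mathcal{H}^2$-integrable $m:\Sigma\to(0,\infty)$ with $\int\varphi\,dV=\int_\Sigma\varphi(x,T_x\Sigma)\,m(x)\,d\mathcal{H}^2(x)$ for all $\varphi\in C_c$. The lower density is $\Theta^2_*(|V|,x)=\liminf_{r\to0}\frac{|V|(B_r(x))}{\pi r^2}$. A plane is identified with its unit normal $\pm\nu$. An integrand is an even $C^1$ function $F:\mathbb{S}^2\to(0,\infty)$, identified with its $1$-homogeneous extension $F:\mathbb{R}^3\to[0,\infty)$ ($F(\lambda\nu)=\lambda F(\nu)$ for $\lambda\ge0$). Strictly convex means that the extension is convex, and strictly convex along all lines not passing through $0$. The first variation along $X\in C^1_c(\mathbb{R}^3,\mathbb{R}^3)$ is the derivative at $t=0$ of the energy $\int F\,dV$ (over $\operatorname{spt}X$) of the varifold pushforward of $V$ under the flow of $X$; explicitly $\langle\delta^FV,X\rangle=\int\langle B_F(\nu),dX(x)\rangle\,dV(x,\nu)$ with $B_F(\nu)_{ij}=F(\nu)\delta_{ij}-\nu^i\partial_jF(\nu)$, $dX_{ij}=\partial_jX^i$, and the Hilbert–Schmidt product. $|\delta^FV|$ is its total variation measure, and $|\delta^FV|(\mathbb{R}^3)=\sup\{\langle\delta^FV,X\rangle: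 X\in C^1_c,\ |X|\le1\}$. *)

theory Defs
  imports "HOL-Analysis.Analysis"
begin

section \<open>Two-dimensional Hausdorff measure\<close>

text \<open>
  The normalisation is that of Lebesgue measure on planes. Boundedness is demanded separately
  because \<^const>\<open>diameter\<close> is a meaningless real number on unbounded sets.
\<close>

definition hausdorff2_pre :: "real \<Rightarrow> 'a::metric_space set \<Rightarrow> ennreal" where
  "hausdorff2_pre \<delta> A =
     (INF C \<in> {C :: nat \<Rightarrow> 'a set. A \<subseteq> (\<Union>i. C i) \<and> (\<forall>i. bounded (C i) \<and> diameter (C i) \<le> \<delta>)}.
        \<Sum>i. ennreal (pi * (diameter (C i) / 2)\<^sup>2))"

definition hausdorff2 :: "'a::metric_space set \<Rightarrow> ennreal" where
  "hausdorff2 A = (SUP \<delta>\<in>{0<..}. hausdorff2_pre \<delta> A)"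

text \<open>
  The restriction of the outer measure to Borel sets, for use in integrals.
  \<^const>\<open>measure_of\<close> would silently return the zero measure if \<^const>\<open>hausdorff2\<close> were not
  countably additive there; that it is, is Caratheodory's criterion, proved below.
\<close>

definition hausdorff2_measure :: "'a::metric_space measure" where
  "hausdorff2_measure = measure_of UNIV (sets borel) hausdorff2"

lemma hausdorff2_pre_leI:
  assumes "A \<subseteq> (\<Union>i. C i)" "\<And>i. bounded (C i)" "\<And>i. diameter (C i) \<le> \<delta>"
  shows "hausdorff2_pre \<delta> A \<le> (\<Sum>i. ennreal (pi * (diameter (C i) / 2)\<^sup>2))"
  unfolding hausdorff2_pre_def using assms by (intro INF_lower) auto

lemma hausdorff2_pre_mono: "A \<subseteq> B \<Longrightarrow> hausdorff2_pre \<delta> A \<le> hausdorff2_pre \<delta> B"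
  unfolding hausdorff2_pre_def by (intro INF_superset_mono) auto

lemma hausdorff2_pre_antimono: "\<delta> \<le> \<delta>' \<Longrightarrow> hausdorff2_pre \<delta>' A \<le> hausdorff2_pre \<delta> A"
  unfolding hausdorff2_pre_def by (intro INF_superset_mono) (auto intro: order_trans)

lemma hausdorff2_pre_le: "0 < \<delta> \<Longrightarrow> hausdorff2_pre \<delta> A \<le> hausdorff2 A"
  unfolding hausdorff2_def by (intro SUP_upper) auto

lemma hausdorff2_mono: "A \<subseteq> B \<Longrightarrow> hausdorff2 A \<le> hausdorff2 B"
  unfolding hausdorff2_def by (intro SUP_mono' hausdorff2_pre_mono)

lemma hausdorff2_empty: "hausdorff2 {} = 0"
proof -
  have "hausdorff2_pre \<delta> ({} :: 'a set) \<le> 0" if "0 < \<delta>" for \<delta>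
    using hausdorff2_pre_leI[of "{}" "\<lambda>_. {}" \<delta>] that by simp
  then show ?thesis
    unfolding hausdorff2_def by (auto intro!: antisym SUP_least)
qed

lemma hausdorff2_pre_UN_le:
  assumes \<delta>: "0 < \<delta>"
  shows "hausdorff2_pre \<delta> (\<Union>i. A i) \<le> (\<Sum>i::nat. hausdorff2_pre \<delta> (A i))"
proof (rule ennreal_le_epsilon)
  fix e :: real assume e: "0 < e" and fin: "(\<Sum>i. hausdorff2_pre \<delta> (A i)) < top"
  have *: "\<exists>C. A n \<subseteq> (\<Union>i. C i) \<and> (\<forall>i. bounded (C i) \<and> diameter (C i) \<le> \<delta>) \<and>
      (\<Sum>i. ennreal (pi * (diameter (C i) / 2)\<^sup>2)) \<le> hausdorff2_pre \<delta> (A n) + e * (1/2) ^ Suc n" for n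
  proof -
    have "hausdorff2_pre \<delta> (A n) \<noteq> top"
      using fin by (metis ennreal_suminf_lessD less_top)
    moreover have "0 < ennreal (e * (1/2) ^ Suc n)" using e by simp
    ultimately have "hausdorff2_pre \<delta> (A n) < hausdorff2_pre \<delta> (A n) + ennreal (e * (1/2) ^ Suc n)"
      using ennreal_add_left_cancel_less[of "hausdorff2_pre \<delta> (A n)" 0] by simp
    then show ?thesis
      by (subst (asm) hausdorff2_pre_def) (auto simp: INF_less_iff less_imp_le intro!: less_imp_le)
  qed
  then obtain C where C: "\<And>n. A n \<subseteq> (\<Union>i. C n i)" "\<And>n i. bounded (C n i)"
      "\<And>n i. diameter (C n i) \<le> \<delta>"
      "\<And>n. (\<Sum>i. ennreal (pi * (diameter (C n i) / 2)\<^sup>2)) \<le> hausdorff2_pre \<delta> (A n) + e * (1/2) ^ Suc n"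
    by metis
  define D where "D = (\<lambda>(m, n). C m n) \<circ> prod_decode"
  have "x \<in> (\<Union>i. D i)" if "x \<in> (\<Union>i. A i)" for x
  proof -
    from that C(1) obtain m n where "x \<in> C m n" by blast
    then have "x \<in> D (prod_encode (m, n))" by (simp add: D_def)
    then show ?thesis by blast
  qed
  then have "(\<Union>i. A i) \<subseteq> (\<Union>i. D i)" by blast
  then have "hausdorff2_pre \<delta> (\<Union>i. A i) \<le> (\<Sum>i. ennreal (pi * (diameter (D i) / 2)\<^sup>2))"
    by (rule hausdorff2_pre_leI) (use C(2,3) in \<open>auto simp: D_def split: prod.split\<close>)
  also have "\<dots> = (\<Sum>i. (\<lambda>p. ennreal (pi * (diameter (case p of (m, n) \<Rightarrow> C m n) / 2)\<^sup>2)) (prod_decode i))"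
    by (simp add: D_def)
  also have "\<dots> = (\<Sum>m. \<Sum>n. ennreal (pi * (diameter (C m n) / 2)\<^sup>2))"
    by (rule suminf_ennreal_2dimen) simp
  also have "\<dots> \<le> (\<Sum>m. hausdorff2_pre \<delta> (A m) + ennreal (e * (1/2) ^ Suc m))"
    using C(4) by (intro suminf_le) auto
  also have "\<dots> = (\<Sum>m. hausdorff2_pre \<delta> (A m)) + (\<Sum>m. ennreal (e * (1/2) ^ Suc m))"
    by (rule suminf_add[symmetric]) auto
  also have "(\<Sum>m. ennreal (e * (1/2) ^ Suc m)) = ennreal e"
    using e sums_mult[OF power_half_series, of e] by (intro suminf_ennreal_eq) auto
  finally show "hausdorff2_pre \<delta> (\<Union>i. A i) \<le> (\<Sum>i. hausdorff2_pre \<delta> (A i)) + ennreal e" .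
qed

lemma hausdorff2_UN_le: "hausdorff2 (\<Union>i. A i) \<le> (\<Sum>i::nat. hausdorff2 (A i))"
  unfolding hausdorff2_def[of "\<Union>i. A i"]
proof (rule SUP_least)
  fix \<delta> :: real assume "\<delta> \<in> {0<..}"
  then have "hausdorff2_pre \<delta> (\<Union>i. A i) \<le> (\<Sum>i. hausdorff2_pre \<delta> (A i))"
    by (intro hausdorff2_pre_UN_le) auto
  also have "\<dots> \<le> (\<Sum>i. hausdorff2 (A i))"
    using \<open>\<delta> \<in> {0<..}\<close> by (intro suminf_le hausdorff2_pre_le) auto
  finally show "hausdorff2_pre \<delta> (\<Union>i. A i) \<le> (\<Sum>i. hausdorff2 (A i))" .
qed

lemma hausdorff2_Un_le: "hausdorff2 (A \<union> B) \<le> hausdorff2 A + hausdorff2 B"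
proof -
  have "hausdorff2 (\<Union>i::nat. if i = 0 then A else if i = 1 then B else {}) \<le> 
     (\<Sum>i::nat. hausdorff2 (if i = 0 then A else if i = 1 then B else {}))"
    by (rule hausdorff2_UN_le)
  also have "(\<Union>i::nat. if i = 0 then A else if i = 1 then B else {}) = A \<union> B"
    by (auto split: if_splits)
  also have "(\<Sum>i::nat. hausdorff2 (if i = 0 then A else if i = 1 then B else {}))
     = (\<Sum>i\<in>{0,1::nat}. hausdorff2 (if i = 0 then A else if i = 1 then B else {}))"
    by (rule suminf_finite) (auto simp: hausdorff2_empty)
  finally show ?thesis by simp
qed

lemma outer_measure_space_hausdorff2: "outer_measure_space UNIV hausdorff2"
  by (auto simp: outer_measure_space_def positive_def increasing_def countably_subadditive_def
      hausdorff2_empty hausdorff2_UN_le intro!: hausdorff2_mono)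

lemma hausdorff2_pre_separated:
  assumes "0 < \<delta>" "\<delta> < d" and sep: "\<And>x y. x \<in> A \<Longrightarrow> y \<in> B \<Longrightarrow> d \<le> dist x y"
  shows "hausdorff2_pre \<delta> A + hausdorff2_pre \<delta> B \<le> hausdorff2_pre \<delta> (A \<union> B)"
  unfolding hausdorff2_pre_def[of \<delta> "A \<union> B"]
proof (rule INF_greatest)
  fix C :: "nat \<Rightarrow> 'a set"
  assume "C \<in> {C. A \<union> B \<subseteq> (\<Union>i. C i) \<and> (\<forall>i. bounded (C i) \<and> diameter (C i) \<le> \<delta>)}"
  then have C: "A \<union> B \<subseteq> (\<Union>i. C i)" "\<And>i. bounded (C i)" "\<And>i. diameter (C i) \<le> \<delta>" by auto
  let ?f = "\<lambda>C i. ennreal (pi * (diameter (C i) / 2)\<^sup>2)"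
  define CA where "CA i = (if C i \<inter> A = {} then {} else C i)" for i
  define CB where "CB i = (if C i \<inter> B = {} then {} else C i)" for i
  have "hausdorff2_pre \<delta> A \<le> suminf (?f CA)" 
    using C assms(1) by (intro hausdorff2_pre_leI) (auto simp: CA_def; fastforce)+
  moreover have "hausdorff2_pre \<delta> B \<le> suminf (?f CB)"
    using C assms(1) by (intro hausdorff2_pre_leI) (auto simp: CB_def; fastforce)+
  ultimately have "hausdorff2_pre \<delta> A + hausdorff2_pre \<delta> B \<le> suminf (?f CA) + suminf (?f CB)"
    by (rule add_mono)
  also have "\<dots> = (\<Sum>i. ?f CA i + ?f CB i)"
    by (rule suminf_add) auto
  also have "\<dots> \<le> suminf (?f C)"
  proof (intro suminf_le)
    fix i
    have "C i \<inter> A = {} \<or> C i \<inter> B = {}"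
    proof (rule ccontr)
      assume "\<not> ?thesis"
      then obtain x y where "x \<in> C i" "x \<in> A" "y \<in> C i" "y \<in> B" by auto
      then have "d \<le> diameter (C i)"
        using sep diameter_bounded_bound[OF C(2)] order_trans by blast
      with C(3)[of i] assms(2) show False by simp
    qed
    then show "?f CA i + ?f CB i \<le> ?f C i" by (auto simp: CA_def CB_def)
  qed auto
  finally show "hausdorff2_pre \<delta> A + hausdorff2_pre \<delta> B \<le> suminf (?f C)" .
qed

lemma hausdorff2_separated:
  assumes d: "0 < d" and sep: "\<And>x y. x \<in> A \<Longrightarrow> y \<in> B \<Longrightarrow> d \<le> dist x y"
  shows "hausdorff2 A + hausdorff2 B \<le> hausdorff2 (A \<union> B)"
proof -
  have le: "hausdorff2_pre \<delta> A + hausdorff2_pre \<epsilon> B \<le> hausdorff2 (A \<union> B)" if "0 < \<delta>" "0 < \<epsilon>" for \<delta> \<epsilon>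
  proof -
    define \<eta> where "\<eta> = min (d/2) (min \<delta> \<epsilon>)"
    have \<eta>: "0 < \<eta>" "\<eta> < d" "\<eta> \<le> \<delta>" "\<eta> \<le> \<epsilon>" using that d by (auto simp: \<eta>_def)
    have "hausdorff2_pre \<delta> A + hausdorff2_pre \<epsilon> B \<le> hausdorff2_pre \<eta> A + hausdorff2_pre \<eta> B"
      using \<eta> by (intro add_mono hausdorff2_pre_antimono)
    also have "\<dots> \<le> hausdorff2_pre \<eta> (A \<union> B)"
      using \<eta> sep by (intro hausdorff2_pre_separated)
    also have "\<dots> \<le> hausdorff2 (A \<union> B)"
      using \<eta> by (intro hausdorff2_pre_le)
    finally show ?thesis .
  qed
  have ne: "{0<..} \<noteq> ({} :: real set)" using greaterThan_non_empty by blast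
  have "hausdorff2 A + hausdorff2 B = (SUP \<epsilon>\<in>{0<..}. hausdorff2 A + hausdorff2_pre \<epsilon> B)"
    unfolding hausdorff2_def[of B] by (rule ennreal_SUP_add_right[OF ne])
  also have "\<dots> = (SUP \<epsilon>\<in>{0<..}. SUP \<delta>\<in>{0<..}. hausdorff2_pre \<delta> A + hausdorff2_pre \<epsilon> B)"
    unfolding hausdorff2_def[of A] by (intro SUP_cong refl ennreal_SUP_add_left[symmetric, OF ne])
  also have "\<dots> \<le> hausdorff2 (A \<union> B)"
    using le by (intro SUP_least) auto
  finally show ?thesis .
qed

lemma closed_lambda_hausdorff2:
  fixes S :: "'a::metric_space set"
  assumes S: "closed S" "S \<noteq> {}"
  shows "hausdorff2 (A \<inter> S) + hausdorff2 (A - S) \<le> hausdorff2 A"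
proof (cases "hausdorff2 A = top")
  case False
  define B where "B n = {x \<in> A. 1 / real (Suc n) \<le> infdist x S}" for n
  define R where "R n = B (Suc n) - B n" for n
  have sepS: "hausdorff2 (A \<inter> S) + hausdorff2 (B n) \<le> hausdorff2 A" for n
  proof -
    have "hausdorff2 (A \<inter> S) + hausdorff2 (B n) \<le> hausdorff2 (A \<inter> S \<union> B n)"
    proof (rule hausdorff2_separated)
      show "0 < 1 / real (Suc n)" by simp
      show "1 / real (Suc n) \<le> dist x y" if "x \<in> A \<inter> S" "y \<in> B n" for x y
        using that infdist_le[of x S y] by (auto simp: B_def dist_commute)
    qed
    also have "\<dots> \<le> hausdorff2 A" by (rule hausdorff2_mono) (auto simp: B_def)
    finally show ?thesis .
  qed
  have Binc: "B m \<subseteq> B n" if "m \<le> n" for m n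
  proof -
    have "1 / real (Suc n) \<le> 1 / real (Suc m)" using that by (simp add: frac_le)
    then show ?thesis unfolding B_def by auto
  qed
  have sepR: "hausdorff2 (B n) + hausdorff2 (R (Suc n)) \<le> hausdorff2 (B n \<union> R (Suc n))" for n
  proof (rule hausdorff2_separated)
    show "0 < 1 / real (Suc n) - 1 / real (Suc (Suc n))" by (simp add: divide_strict_left_mono)
    show "1 / real (Suc n) - 1 / real (Suc (Suc n)) \<le> dist x y" if "x \<in> B n" "y \<in> R (Suc n)" for x y
      using that infdist_triangle[of x S y] by (auto simp: B_def R_def simp del: of_nat_Suc)
  qed
  have half: "(\<Sum>k<n. hausdorff2 (R (Suc (2 * k + c)))) \<le> hausdorff2 (B (2 * n + c))" for n c
  proof (induction n)
    case (Suc n)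
    have "(\<Sum>k<Suc n. hausdorff2 (R (Suc (2 * k + c))))
        \<le> hausdorff2 (B (2 * n + c)) + hausdorff2 (R (Suc (2 * n + c)))"
      using Suc by (simp add: add_right_mono)
    also have "\<dots> \<le> hausdorff2 (B (2 * n + c) \<union> R (Suc (2 * n + c)))"
      by (rule sepR)
    also have "\<dots> \<le> hausdorff2 (B (2 * Suc n + c))"
      using Binc[of "2 * n + c" "2 * Suc n + c"] by (intro hausdorff2_mono) (auto simp: R_def)
    finally show ?case .
  qed simp
  define g where "g k = hausdorff2 (R (Suc k))" for k
  have BA: "hausdorff2 (B n) \<le> hausdorff2 A" for n
    by (rule hausdorff2_mono) (auto simp: B_def)
  have pair: "(\<Sum>k<2 * n. g k) = (\<Sum>k<n. g (2 * k)) + (\<Sum>k<n. g (2 * k + 1))" for n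
    by (induction n) (simp_all add: algebra_simps)
  have bound: "(\<Sum>k<n. g k) \<le> hausdorff2 A + hausdorff2 A" for n
  proof -
    have "(\<Sum>k<n. g k) \<le> (\<Sum>k<2 * n. g k)"
      by (intro sum_mono2) auto
    also have "\<dots> \<le> hausdorff2 A + hausdorff2 A"
      unfolding pair using order_trans[OF half[where c=0 and n=n] BA] order_trans[OF half[where c=1 and n=n] BA]
      by (intro add_mono) (simp_all add: g_def)
    finally show ?thesis .
  qed
  have "suminf g \<le> hausdorff2 A + hausdorff2 A"
    unfolding suminf_eq_SUP using bound by (intro SUP_least)
  then have fin: "suminf g \<noteq> top"
    using False by (metis ennreal_add_eq_top top_unique)
  define r where "r k = enn2real (g k)" for k
  have gfin: "g k \<noteq> top" for k
    using fin by (metis ennreal_suminf_lessD less_top)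
  have gr: "g k = ennreal (r k)" for k
    using gfin[of k] by (simp add: r_def less_top)
  have sr: "summable r"
    using fin unfolding gr by (intro summable_suminf_not_top) (auto simp: r_def)
  show ?thesis
  proof (rule ennreal_le_epsilon)
    fix e :: real assume "0 < e"
    from suminf_exist_split[OF this sr] obtain N where N: "norm (\<Sum>i. r (i + N)) < e" by blast
    have "(\<Sum>i. g (i + N)) = ennreal (\<Sum>i. r (i + N))"
      unfolding gr
      by (rule suminf_ennreal_eq[OF _ summable_sums[OF summable_ignore_initial_segment[OF sr, of N]]])
        (simp add: r_def)
    with N have tail: "(\<Sum>i. g (i + N)) \<le> ennreal e"
      by (simp add: ennreal_leI)
    have cover: "A - S \<subseteq> B (Suc N) \<union> (\<Union>i. R (Suc (i + N)))"
    proof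
      fix x assume x: "x \<in> A - S"
      then have "0 < infdist x S"
        using S by (metis DiffD2 infdist_pos_not_in_closed)
      then obtain m where "1 / real (Suc m) < infdist x S"
        using nat_approx_posE by blast
      with x have ex: "x \<in> B m" by (auto simp: B_def)
      define n where "n = (LEAST n. x \<in> B n)"
      have n: "x \<in> B n" "\<And>k. k < n \<Longrightarrow> x \<notin> B k"
        using LeastI[of "\<lambda>n. x \<in> B n", OF ex] not_less_Least by (auto simp: n_def)
      show "x \<in> B (Suc N) \<union> (\<Union>i. R (Suc (i + N)))"
      proof (cases "n \<le> Suc N")
        case True
        then show ?thesis using n(1) Binc by blast
      next
        case F: False
        define i where "i = n - Suc (Suc N)"
        have "n = Suc (Suc (i + N))" using F by (simp add: i_def)
        then have "x \<in> R (Suc (i + N))" using n by (simp add: R_def)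
        then show ?thesis by blast
      qed
    qed
    have "hausdorff2 (A - S) \<le> hausdorff2 (B (Suc N)) + hausdorff2 (\<Union>i. R (Suc (i + N)))"
      using hausdorff2_mono[OF cover] hausdorff2_Un_le order_trans by blast
    also have "hausdorff2 (\<Union>i. R (Suc (i + N))) \<le> ennreal e"
      using hausdorff2_UN_le[of "\<lambda>i. R (Suc (i + N))"] tail by (simp add: g_def)
    finally have "hausdorff2 (A - S) \<le> hausdorff2 (B (Suc N)) + ennreal e"
      by (simp add: add_left_mono)
    then have "hausdorff2 (A \<inter> S) + hausdorff2 (A - S)
        \<le> hausdorff2 (A \<inter> S) + hausdorff2 (B (Suc N)) + ennreal e"
      by (simp add: add.assoc add_left_mono)
    also have "\<dots> \<le> hausdorff2 A + ennreal e"
      by (intro add_right_mono sepS)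
    finally show "hausdorff2 (A \<inter> S) + hausdorff2 (A - S) \<le> hausdorff2 A + ennreal e" .
  qed
qed simp

lemma measure_space_hausdorff2:
  "measure_space UNIV (sets borel) (hausdorff2 :: 'a::metric_space set \<Rightarrow> ennreal)"
proof -
  define L where "L = lambda_system UNIV UNIV (hausdorff2 :: 'a set \<Rightarrow> ennreal)"
  interpret P: sigma_algebra "UNIV :: 'a set" "UNIV :: 'a set set"
    using sigma_algebra_Pow[of "UNIV :: 'a set"] by simp
  have ms: "measure_space UNIV L hausdorff2"
    unfolding L_def by (rule P.caratheodory_lemma[OF outer_measure_space_hausdorff2])
  have "S \<in> L" if "closed S" for S :: "'a set"
  proof -
    have "hausdorff2 (S \<inter> A) + hausdorff2 ((UNIV - S) \<inter> A) = hausdorff2 A" for A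
    proof (cases "S = {}")
      case False
      have "(UNIV - S) \<inter> A = A - S" by auto
      moreover have "A = A \<inter> S \<union> (A - S)" by auto
      ultimately show ?thesis
        using closed_lambda_hausdorff2[OF that False, of A] hausdorff2_Un_le[of "A \<inter> S" "A - S"]
        by (simp add: Int_commute antisym)
    qed (simp add: hausdorff2_empty)
    then show ?thesis by (simp add: L_def lambda_system_def)
  qed
  moreover have sL: "sigma_algebra UNIV L" using ms by (simp add: measure_space_def)
  ultimately have "sets borel \<subseteq> L"
    unfolding borel_eq_closed using sigma_algebra.sigma_sets_subset[OF sL, of "{S. closed S}"] by auto
  then show ?thesis
    using ms sets.sigma_algebra_axioms[of "borel :: 'a measure"]
    by (auto simp: measure_space_def positive_def countably_additive_def)
qed

lemma sets_hausdorff2_measure: "sets hausdorff2_measure = sets borel"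
  unfolding hausdorff2_measure_def by (metis sets.sets_measure_of_eq space_borel)

lemma emeasure_hausdorff2_measure:
  "A \<in> sets borel \<Longrightarrow> emeasure hausdorff2_measure A = hausdorff2 A"
  using measure_space_hausdorff2
  by (intro emeasure_measure_of[OF hausdorff2_measure_def])
    (auto simp: measure_space_def sets_hausdorff2_measure)

section \<open>The Grassmannian of planes\<close>

typedef plane = "{P :: (real^3) set. subspace P \<and> dim P = 2}"
proof -
  have "dim {x :: real^3. axis 1 1 \<bullet> x = 0} = 2"
    by (simp add: dim_hyperplane)
  then show ?thesis
    by (intro exI[of _ "{x :: real^3. axis 1 1 \<bullet> x = 0}"]) (simp add: subspace_hyperplane)
qed

definition plane_perp :: "real^3 \<Rightarrow> plane" where
  "plane_perp \<nu> = Abs_plane {x. \<nu> \<bullet> x = 0}"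

definition plane_normal :: "plane \<Rightarrow> real^3" where
  "plane_normal P = (SOME \<nu>. norm \<nu> = 1 \<and> Rep_plane P = {x. \<nu> \<bullet> x = 0})"

lemma Rep_plane_perp: "\<nu> \<noteq> 0 \<Longrightarrow> Rep_plane (plane_perp \<nu>) = {x. \<nu> \<bullet> x = 0}"
  unfolding plane_perp_def by (intro Abs_plane_inverse) (simp add: subspace_hyperplane dim_hyperplane)

lemma plane_normal:
  shows norm_plane_normal: "norm (plane_normal P) = 1"
    and Rep_plane_eq: "Rep_plane P = {x. plane_normal P \<bullet> x = 0}"
proof -
  have P: "subspace (Rep_plane P)" "dim (Rep_plane P) = 2" using Rep_plane[of P] by auto
  then obtain a where a: "a \<noteq> 0" "span (Rep_plane P) \<subseteq> {x. a \<bullet> x = 0}"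
    using lowdim_subset_hyperplane[of "Rep_plane P"] by auto
  have "Rep_plane P = {x. a \<bullet> x = 0}"
    using P a by (intro subspace_dim_equal) (auto simp: subspace_hyperplane dim_hyperplane span_superset subset_eq span_base)
  then have "norm (sgn a) = 1 \<and> Rep_plane P = {x. sgn a \<bullet> x = 0}"
    using a by (simp add: norm_sgn sgn_div_norm)
  then have "norm (plane_normal P) = 1 \<and> Rep_plane P = {x. plane_normal P \<bullet> x = 0}"
    unfolding plane_normal_def by (rule someI)
  then show "norm (plane_normal P) = 1" "Rep_plane P = {x. plane_normal P \<bullet> x = 0}" by auto
qed

text \<open>Planes carry the quotient topology of the unit sphere modulo sign.\<close>

instantiation plane :: topological_space
begin

definition open_plane :: "plane set \<Rightarrow> bool" where
  "open_plane U \<longleftrightarrow> openin (top_of_set (sphere 0 1)) {\<nu> \<in> sphere 0 1. plane_perp \<nu> \<in> U}"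

instance
proof
  show "open (UNIV :: plane set)"
    using openin_topspace[of "top_of_set (sphere (0 :: real^3) 1)"]
    unfolding open_plane_def topspace_euclidean_subtopology by (simp only: UNIV_I simp_thms Collect_mem_eq)
  show "open (S \<inter> T)" if "open S" "open T" for S T :: "plane set"
    using openin_Int[OF that[unfolded open_plane_def]]
    unfolding open_plane_def by (rule back_subst[of "openin _"]) auto
  show "open (\<Union>K)" if "\<forall>S\<in>K. open S" for K :: "plane set set"
  proof -
    have "openin (top_of_set (sphere 0 1)) (\<Union>S\<in>K. {\<nu> \<in> sphere 0 1. plane_perp \<nu> \<in> S})"
      using that unfolding open_plane_def by (intro openin_Union) blast
    then show ?thesis
      unfolding open_plane_def by (rule back_subst[of "openin _"]) auto
  qed
qed

end

section \<open>Rectifiable varifolds\<close>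

definition compactly_supported :: "('a::topological_space \<Rightarrow> 'b::zero) \<Rightarrow> bool" where
  "compactly_supported f \<longleftrightarrow> compact (closure {x. f x \<noteq> 0})"

text \<open>
  On the locally compact, \<open>\<sigma>\<close>-compact metrisable space of pairs, a Radon measure is a Borel measure
  that is finite on compact sets.
\<close>

definition varifold :: "((real^3) \<times> plane) measure \<Rightarrow> bool" where
  "varifold V \<longleftrightarrow> sets V = sets borel \<and> (\<forall>K. compact K \<longrightarrow> emeasure V K < \<infinity>)"

definition weight :: "((real^3) \<times> plane) measure \<Rightarrow> (real^3) measure" where
  "weight V = distr V borel fst"

definition lower_density :: "((real^3) \<times> plane) measure \<Rightarrow> real^3 \<Rightarrow> ennreal" where
  "lower_density V x = Liminf (at_right 0) (\<lambda>r. emeasure (weight V) (ball x r) / ennreal (pi * r\<^sup>2))"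

definition countably_2_rectifiable :: "(real^3) set \<Rightarrow> bool" where
  "countably_2_rectifiable S \<longleftrightarrow>
     (\<exists>N (f :: nat \<Rightarrow> real^2 \<Rightarrow> real^3). hausdorff2 N = 0 \<and>
        (\<forall>i. \<exists>L. L-lipschitz_on UNIV (f i)) \<and> S \<subseteq> N \<union> (\<Union>i. range (f i)))"

text \<open>
  \<open>P\<close> is the approximate tangent plane at \<open>x\<close> if the rescalings of \<open>m \<H>\<^sup>2\<close> restricted to \<open>S\<close>
  around \<open>x\<close> converge weakly to \<open>m x \<H>\<^sup>2\<close> restricted to \<open>P\<close>. The weight \<open>m\<close> makes the integrals
  finite without assuming that \<open>S\<close> has locally finite area; up to null sets the
  tangent planes do not depend on it.
\<close>

definition approx_tangent_plane :: "(real^3) set \<Rightarrow> (real^3 \<Rightarrow> real) \<Rightarrow> real^3 \<Rightarrow> plane \<Rightarrow> bool" where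
  "approx_tangent_plane S m x P \<longleftrightarrow>
     (\<forall>f :: real^3 \<Rightarrow> real. continuous_on UNIV f \<and> compactly_supported f \<longrightarrow>
        ((\<lambda>r. (LINT y:S|hausdorff2_measure. f ((1 / r) *\<^sub>R (y - x)) * m y) / r\<^sup>2)
           \<longlongrightarrow> m x * (LINT y:Rep_plane P|hausdorff2_measure. f y)) (at_right 0))"

text \<open>
  The tangent plane field exists and is unique only almost everywhere; \<open>T\<close> is any Borel
  representative of it, so that \<open>T x\<close> stands for the tangent plane of \<open>S\<close> at \<open>x\<close>.
\<close>

definition rectifiable_varifold :: "((real^3) \<times> plane) measure \<Rightarrow> bool" where
  "rectifiable_varifold V \<longleftrightarrow> varifold V \<and>
     (\<exists>S m T. S \<in> sets borel \<and> countably_2_rectifiable S \<and>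
        set_borel_measurable borel S m \<and> (\<forall>x\<in>S. 0 < m x) \<and>
        (\<forall>K. compact K \<longrightarrow> set_integrable hausdorff2_measure (K \<inter> S) m) \<and>
        T \<in> borel \<rightarrow>\<^sub>M borel \<and>
        (AE x in hausdorff2_measure. x \<in> S \<longrightarrow> approx_tangent_plane S m x (T x)) \<and>
        (\<forall>\<phi>. continuous_on UNIV \<phi> \<and> compactly_supported \<phi> \<longrightarrow>
           (LINT z|V. \<phi> z) = (LINT x:S|hausdorff2_measure. \<phi> (x, T x) * m x)))"

section \<open>Integrands and the anisotropic first variation\<close>

definition gradient :: "(real^'n \<Rightarrow> real) \<Rightarrow> real^'n \<Rightarrow> real^'n" where
  "gradient F \<nu> = (\<chi> j. frechet_derivative F (at \<nu>) (axis j 1))"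

text \<open>
  An integrand is represented by its 1-homogeneous extension, which is
  \<open>C\<^sup>1\<close> away from the origin exactly when its restriction to the sphere is \<open>C\<^sup>1\<close>.
\<close>

definition integrand :: "(real^3 \<Rightarrow> real) \<Rightarrow> bool" where
  "integrand F \<longleftrightarrow>
     (\<forall>\<nu>\<in>sphere 0 1. 0 < F \<nu>) \<and> (\<forall>\<nu>. F (- \<nu>) = F \<nu>) \<and>
     (\<forall>\<nu>. \<forall>c\<ge>0. F (c *\<^sub>R \<nu>) = c * F \<nu>) \<and>
     (\<forall>\<nu>. \<nu> \<noteq> 0 \<longrightarrow> F differentiable (at \<nu>)) \<and> continuous_on (- {0}) (gradient F)"

definition strictly_convex_integrand :: "(real^3 \<Rightarrow> real) \<Rightarrow> bool" where
  "strictly_convex_integrand F \<longleftrightarrow> convex_on UNIV F \<and>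
     (\<forall>x y. x \<noteq> y \<and> 0 \<notin> affine hull {x, y} \<longrightarrow>
        (\<forall>t\<in>{0<..<1}. F ((1 - t) *\<^sub>R x + t *\<^sub>R y) < (1 - t) * F x + t * F y))"

text \<open>The orthogonal projection onto the coordinate plane \<open>{x. x $ k = 0}\<close>.\<close>

definition coord_proj :: "3 \<Rightarrow> real^3 \<Rightarrow> real^3" where
  "coord_proj k x = (\<chi> j. if j = k then 0 else x $ j)"

definition B_matrix :: "(real^3 \<Rightarrow> real) \<Rightarrow> real^3 \<Rightarrow> real^3^3" where
  "B_matrix F \<nu> = (\<chi> i j. (if i = j then F \<nu> else 0) - \<nu> $ i * gradient F \<nu> $ j)"

definition C1_compact_field :: "(real^3 \<Rightarrow> real^3) \<Rightarrow> bool" where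
  "C1_compact_field X \<longleftrightarrow> (\<forall>x. X differentiable (at x)) \<and>
     continuous_on UNIV (\<lambda>x. jacobian X (at x)) \<and> compactly_supported X"

text \<open>
  The integrand is independent of the sign of \<^const>\<open>plane_normal\<close> because \<open>F\<close> is even, and the
  inner product of \<^typ>\<open>real^3^3\<close> is the Hilbert-Schmidt product.
\<close>

definition first_variation ::
    "(real^3 \<Rightarrow> real) \<Rightarrow> ((real^3) \<times> plane) measure \<Rightarrow> (real^3 \<Rightarrow> real^3) \<Rightarrow> real" where
  "first_variation F V X = (LINT (x, P)|V. B_matrix F (plane_normal P) \<bullet> jacobian X (at x))"

text \<open>
  \<^const>\<open>ennreal\<close> truncates negative numbers to 0, which does not affect the supremum since
  \<open>X = 0\<close> is admissible.
\<close>

definition total_first_variation :: "(real^3 \<Rightarrow> real) \<Rightarrow> ((real^3) \<times> plane) measure \<Rightarrow> ennreal" where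
  "total_first_variation F V =
     (SUP X\<in>{X. C1_compact_field X \<and> (\<forall>x. norm (X x) \<le> 1)}. ennreal (first_variation F V X))"

definition ennreal_sqrt :: "ennreal \<Rightarrow> ennreal" where
  "ennreal_sqrt a = (if a = \<infinity> then \<infinity> else ennreal (sqrt (enn2real a)))"

end

(*
  Write M = B_F(nu) restricted to rows and columns i, j, and c = nu_k d_kF(nu) for the third index k.
  Evenness and convexity give M_ii, M_jj, c >= 0, and the hypothesis on projected gradients makes the
  mixed discriminant of two such matrices at least c c'. Projected to the coordinate plane, M V is a
  matrix-valued measure whose rows have divergences of mass at most T = |delta^F V|. For planar fields
  with nonnegative diagonal, integrating the flux M_jj over half lines {p > 0} gives a bounded test
  field for row i; the error term is a flux of row i through half lines in the other direction, which
  is bounded because the quadrant relates it to the flux M_ii. Hence int det M <= C T^2. With arctan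
  and the Cauchy kernel in place of jump and delta function this becomes
  int int a(p) a(q) c c' dV dV' <= C T^2 at all scales, so the projection of c V has a density in L^2
  of norm at most C T. Since the weight is carried by a subset E of {theta > 0} and projections do not
  increase area, Cauchy-Schwarz bounds the integral of c by C H^2(E)^{1/2} T. Summing over k gives
  the integral of F, by Euler's identity.
*)
theory Submission
  imports Defs
begin

section \<open>Integrands and mixed discriminants\<close>

text \<open>The area estimate is quadratic in \<open>V\<close>, and two points of \<open>V\<close>
  that are close after projection may carry quite different normals. Control of each determinant
  separately is therefore not enough: the inequality is used in its polarised form, for every pair
  of normals, and the direction hypothesis enters through the sign of a cross term. A measure has no
  square on the diagonal, hence a kernel of positive width in place of the delta function. The
  resulting estimate is scale invariant: dilating the projected points by 1/e multiplies the
  divergence bound by e, so correlations at scale e are O(e^2), the rate of a square integrable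
  density. The test functions depend on two coordinates only and so lack compact support; finiteness
  of \<open>V\<close> pays for the cut-off. The constants are explicit: pi/2 is the supremum of
  arctan, 3 pi^2 T^2 bounds the squared projected mass per unit area, and 11 > 32/pi is the price of
  covering by squares instead of measuring by diameters. Together they give 33 pi^2 T^2 h for each
  axis.\<close>

lemma integrand_has_derivative:
  assumes "integrand F" "\<nu> \<noteq> 0"
  shows "(F has_derivative (\<lambda>h. gradient F \<nu> \<bullet> h)) (at \<nu>)"
proof -
  have d: "(F has_derivative frechet_derivative F (at \<nu>)) (at \<nu>)"
    using assms unfolding integrand_def frechet_derivative_works by blast
  then have l: "linear (frechet_derivative F (at \<nu>))"
    by (rule has_derivative_linear)
  have "frechet_derivative F (at \<nu>) h = gradient F \<nu> \<bullet> h" for h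
  proof -
    have "frechet_derivative F (at \<nu>) h = frechet_derivative F (at \<nu>) (\<Sum>j\<in>UNIV. h $ j *\<^sub>R axis j 1)"
      by (subst basis_expansion[symmetric, of h]) (simp add: scalar_mult_eq_scaleR)
    also have "\<dots> = (\<Sum>j\<in>UNIV. h $ j * frechet_derivative F (at \<nu>) (axis j 1))"
      by (simp add: linear_sum[OF l] linear_scale[OF l])
    finally show ?thesis by (simp add: gradient_def inner_vec_def mult.commute)
  qed
  then have "frechet_derivative F (at \<nu>) = (\<lambda>h. gradient F \<nu> \<bullet> h)" by blast
  with d show ?thesis by simp
qed

lemma integrand_zero: "integrand F \<Longrightarrow> F 0 = 0"
  unfolding integrand_def by (metis mult_zero_left order_refl scaleR_zero_left)

lemma integrand_nonneg:
  assumes "integrand F" shows "0 \<le> F \<nu>"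
proof (cases "\<nu> = 0")
  case False
  then have "F (norm \<nu> *\<^sub>R sgn \<nu>) = norm \<nu> * F (sgn \<nu>)" "0 < F (sgn \<nu>)"
    using assms by (auto simp: integrand_def norm_sgn)
  with False show ?thesis by (simp add: sgn_div_norm)
qed (simp add: integrand_zero[OF assms])

lemma integrand_line:
  assumes "integrand F" "\<nu> \<noteq> 0"
  shows "((\<lambda>t. F (\<nu> + t *\<^sub>R h)) has_real_derivative gradient F \<nu> \<bullet> h) (at 0)"
proof -
  have "((\<lambda>t::real. \<nu> + t *\<^sub>R h) has_derivative (\<lambda>t. t *\<^sub>R h)) (at 0)"
    by (auto intro!: derivative_eq_intros)
  moreover have "(F has_derivative (\<lambda>h. gradient F \<nu> \<bullet> h)) (at (\<nu> + 0 *\<^sub>R h))"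
    using integrand_has_derivative[OF assms] by simp
  ultimately have "((\<lambda>t. F (\<nu> + t *\<^sub>R h)) has_derivative (\<lambda>t. gradient F \<nu> \<bullet> (t *\<^sub>R h))) (at 0)"
    by (rule has_derivative_compose)
  then show ?thesis
    by (simp add: has_field_derivative_def mult.commute[of _ "gradient F \<nu> \<bullet> h"])
qed

lemma integrand_euler:
  assumes "integrand F" "\<nu> \<noteq> 0"
  shows "gradient F \<nu> \<bullet> \<nu> = F \<nu>"
proof -
  have "((\<lambda>t. F (\<nu> + t *\<^sub>R \<nu>)) has_real_derivative F \<nu>) (at 0)"
  proof (rule has_field_derivative_transform_within_open[where S="{-1<..}"])
    show "((\<lambda>t. (1 + t) * F \<nu>) has_real_derivative F \<nu>) (at 0)"
      by (auto intro!: derivative_eq_intros)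
    fix t :: real assume "t \<in> {-1<..}"
    then have "F ((1 + t) *\<^sub>R \<nu>) = (1 + t) * F \<nu>"
      using assms unfolding integrand_def by auto
    then show "(1 + t) * F \<nu> = F (\<nu> + t *\<^sub>R \<nu>)" by (simp add: scaleR_left_distrib)
  qed auto
  with integrand_line[OF assms] show ?thesis by (rule DERIV_unique)
qed

text \<open>The tangent hyperplane at \<nu> lies below the graph by convexity, and by Euler's
  identity it passes through the origin, so the supporting affine function is linear.\<close>

lemma gradient_inner_le:
  assumes F: "integrand F" and cv: "convex_on UNIV F" and nz: "\<nu> \<noteq> 0"
  shows "gradient F \<nu> \<bullet> w \<le> F w"
proof -
  have "gradient F \<nu> \<bullet> (w - \<nu>) \<le> F w - F \<nu>"
  proof (rule tendsto_upperbound)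
    show "((\<lambda>t. (F (\<nu> + t *\<^sub>R (w - \<nu>)) - F \<nu>) / t) \<longlongrightarrow> gradient F \<nu> \<bullet> (w - \<nu>)) (at_right 0)"
      using integrand_line[OF F nz, of "w - \<nu>"]
      unfolding has_field_derivative_iff by (auto intro: tendsto_within_subset)
    show "\<forall>\<^sub>F t in at_right 0. (F (\<nu> + t *\<^sub>R (w - \<nu>)) - F \<nu>) / t \<le> F w - F \<nu>"
      using eventually_at_right_real[of "0::real" 1]
    proof (rule eventually_mono)
      fix t :: real assume "t \<in> {0<..<1}"
      then have t: "0 < t" "t < 1" by auto
      have "F ((1 - t) *\<^sub>R \<nu> + t *\<^sub>R w) \<le> (1 - t) * F \<nu> + t * F w"
        using convex_onD[OF cv] t by simp
      then have "F (\<nu> + t *\<^sub>R (w - \<nu>)) - F \<nu> \<le> t * (F w - F \<nu>)"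
        by (simp add: algebra_simps)
      then show "(F (\<nu> + t *\<^sub>R (w - \<nu>)) - F \<nu>) / t \<le> F w - F \<nu>"
        using t by (simp add: divide_le_eq mult.commute)
    qed simp
  qed simp
  then show ?thesis using integrand_euler[OF F nz] by (simp add: inner_diff_right)
qed

lemma abs_gradient_inner_le:
  assumes "integrand F" "convex_on UNIV F" "\<nu> \<noteq> 0"
  shows "\<bar>gradient F \<nu> \<bullet> w\<bar> \<le> F w"
proof -
  have "F (- w) = F w" using assms(1) by (simp add: integrand_def)
  then show ?thesis
    using gradient_inner_le[OF assms, of w] gradient_inner_le[OF assms, of "- w"] by (simp add: abs_le_iff)
qed

lemma gradient_minus:
  assumes "integrand F" "\<nu> \<noteq> 0"
  shows "gradient F (- \<nu>) = - gradient F \<nu>"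
proof -
  have "gradient F (- \<nu>) \<bullet> h = (- gradient F \<nu>) \<bullet> h" for h
  proof -
    have eq: "F (- \<nu> + t *\<^sub>R h) = F (\<nu> + t *\<^sub>R (- h))" for t
    proof -
      have "F (- (\<nu> + t *\<^sub>R (- h))) = F (\<nu> + t *\<^sub>R (- h))"
        using assms(1) unfolding integrand_def by blast
      then show ?thesis by simp
    qed
    have "gradient F (- \<nu>) \<bullet> h = gradient F \<nu> \<bullet> (- h)"
      using integrand_line[OF assms(1), of "- \<nu>" h] integrand_line[OF assms, of "- h"] assms(2)
      unfolding eq by (intro DERIV_unique) auto
    then show ?thesis by simp
  qed
  then show ?thesis by (subst vector_eq_rdot[symmetric]) blast
qed

text \<open>Reflection of coordinate i leaves F unchanged, so at the reflected point the supporting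
  linear function is at most F \<nu>, which is its value at \<nu>. The two values differ by twice
  the product in question.\<close>

lemma component_gradient_nonneg:
  assumes F: "integrand F" and cv: "convex_on UNIV F" and nz: "\<nu> \<noteq> 0"
    and even: "F (\<chi> j. if j = i then - \<nu> $ j else \<nu> $ j) = F \<nu>"
  shows "0 \<le> \<nu> $ i * gradient F \<nu> $ i"
proof -
  have "(\<chi> j. if j = i then - \<nu> $ j else \<nu> $ j) = \<nu> - (2 * \<nu> $ i) *\<^sub>R axis i 1"
    by (simp add: vec_eq_iff axis_def)
  then have "gradient F \<nu> \<bullet> (\<nu> - (2 * \<nu> $ i) *\<^sub>R axis i 1) \<le> F \<nu>"
    using gradient_inner_le[OF F cv nz] even by metis
  then show ?thesis
    using integrand_euler[OF F nz] by (simp add: inner_diff_right inner_axis)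
qed

lemma sum_UNIV_3_distinct:
  fixes f :: "3 \<Rightarrow> 'a::comm_monoid_add"
  assumes "i \<noteq> j" "k \<noteq> i" "k \<noteq> j"
  shows "sum f UNIV = f i + f j + f k"
proof -
  have "card {i, j, k} = CARD(3)" using assms by simp
  then have "UNIV = {i, j, k}" by (intro card_subset_eq[symmetric]) auto
  then have "sum f UNIV = sum f {i, j, k}" by (rule arg_cong)
  then show ?thesis using assms by (simp add: add.assoc)
qed

text \<open>The factors are planar cross products of the projected normals and of the projected
  gradients. For vectors u, u' in the coordinate plane with gradients d, d', the Binet-Cauchy
  identity gives (d.u)(d'.u') - (d.u')(d'.u); Euler's identity evaluates the first product as F(u)
  F(u'), and the supporting inequality bounds the second by the same number. The hypothesis
  \<open>g\<close> carries this over to normals off the plane.\<close>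

lemma gradient_cross_nonneg:
  assumes F: "integrand F" and cv: "convex_on UNIV F"
    and g: "\<And>\<nu>. \<nu> \<in> sphere 0 1 \<Longrightarrow> coord_proj k \<nu> \<noteq> 0 \<Longrightarrow>
      coord_proj k (gradient F \<nu>) /\<^sub>R norm (coord_proj k (gradient F \<nu>)) =
      g (coord_proj k \<nu> /\<^sub>R norm (coord_proj k \<nu>))"
    and ijk: "i \<noteq> j" "k \<noteq> i" "k \<noteq> j"
    and sph: "\<nu> \<in> sphere 0 1" "\<nu>' \<in> sphere 0 1"
  shows "0 \<le> (\<nu> $ j * \<nu>' $ i - \<nu> $ i * \<nu>' $ j) *
    (gradient F \<nu> $ j * gradient F \<nu>' $ i - gradient F \<nu> $ i * gradient F \<nu>' $ j)"
proof (cases "coord_proj k \<nu> = 0 \<or> coord_proj k \<nu>' = 0")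
  case True
  moreover have "x $ i = 0 \<and> x $ j = 0" if "coord_proj k x = 0" for x
  proof -
    have "coord_proj k x $ n = 0" for n using that by simp
    from this[of i] this[of j] show ?thesis using ijk by (simp add: coord_proj_def)
  qed
  ultimately have "(\<nu> $ i = 0 \<and> \<nu> $ j = 0) \<or> (\<nu>' $ i = 0 \<and> \<nu>' $ j = 0)"
    by blast
  then show ?thesis by auto
next
  case False
  \<comment> \<open>A normal x and the unit vector u along its projection have the same projected
    direction, so the hypothesis makes their projected gradients parallel, with a nonnegative
    factor.\<close>
  have key: "\<exists>u l m. u \<noteq> 0 \<and> u $ k = 0 \<and> 0 \<le> l \<and> 0 \<le> m \<and> 
      (\<forall>n\<in>{i,j}. x $ n = l * u $ n \<and> gradient F x $ n = m * gradient F u $ n)"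
    if x: "x \<in> sphere 0 1" "coord_proj k x \<noteq> 0" for x
  proof -
    define a where "a = coord_proj k x"
    define u where "u = a /\<^sub>R norm a"
    have a0: "a \<noteq> 0" using x by (simp add: a_def)
    have u1: "norm u = 1" using a0 by (simp add: u_def)
    have uk: "coord_proj k u = u" by (simp add: u_def a_def coord_proj_def vec_eq_iff)
    have u0: "u \<noteq> 0" using u1 by auto
    define b where "b = coord_proj k (gradient F x)"
    define b0 where "b0 = coord_proj k (gradient F u)"
    have "b0 /\<^sub>R norm b0 = g u" using g[of u] u1 u0 uk by (simp add: b0_def)
    moreover have "b /\<^sub>R norm b = g u" using g[OF x] by (simp add: b_def u_def a_def)
    ultimately have eq: "b /\<^sub>R norm b = b0 /\<^sub>R norm b0" by simp
    have "b0 \<bullet> u = gradient F u \<bullet> u"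
    proof -
      have "u $ k = 0" by (simp add: u_def a_def coord_proj_def)
      then show ?thesis
        unfolding b0_def inner_vec_def coord_proj_def by (intro sum.cong) auto
    qed
    \<comment> \<open>Pairing with u gives F u > 0, so the direction of \<open>b0\<close> is not the
      default value of a division by zero.\<close>
    then have "b0 \<noteq> 0" 
      using integrand_euler[OF F u0] F u1 unfolding integrand_def by force
    have "b = (norm b / norm b0) *\<^sub>R b0"
    proof (cases "b = 0")
      case False
      then have "b = norm b *\<^sub>R (b /\<^sub>R norm b)" by simp
      then show ?thesis unfolding eq by (simp add: divide_inverse)
    qed simp
    then have "b $ n = (norm b / norm b0) * b0 $ n" for n
      by (metis vector_scaleR_component real_scaleR_def)
    moreover have "b $ n = gradient F x $ n" "b0 $ n = gradient F u $ n" if "n \<noteq> k" for n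
      using that by (simp_all add: b_def b0_def coord_proj_def)
    ultimately have "gradient F x $ n = norm b / norm b0 * gradient F u $ n" if "n \<noteq> k" for n
      using that by metis
    moreover have "x $ n = norm a * u $ n" if "n \<noteq> k" for n
    proof -
      have "a = norm a *\<^sub>R u" using a0 by (simp add: u_def)
      then have "a $ n = norm a * u $ n" by (metis vector_scaleR_component real_scaleR_def)
      then show ?thesis using that by (simp add: a_def coord_proj_def)
    qed
    moreover have "u $ k = 0" by (simp add: u_def a_def coord_proj_def)
    ultimately show ?thesis using u0 ijk by (intro exI[of _ u] exI[of _ "norm a"] exI[of _ "norm b / norm b0"]) auto
  qed
  from key[OF sph(1)] False obtain u l m where u: "u \<noteq> 0" "u $ k = 0" "0 \<le> l" "0 \<le> m"
    "\<And>n. n \<in> {i,j} \<Longrightarrow> \<nu> $ n = l * u $ n \<and> gradient F \<nu> $ n = m * gradient F u $ n" by blast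
  from key[OF sph(2)] False obtain u' l' m' where u': "u' \<noteq> 0" "u' $ k = 0" "0 \<le> l'" "0 \<le> m'"
    "\<And>n. n \<in> {i,j} \<Longrightarrow> \<nu>' $ n = l' * u' $ n \<and> gradient F \<nu>' $ n = m' * gradient F u' $ n" by blast
  let ?d = "gradient F u" and ?d' = "gradient F u'"
  have in2: "x \<bullet> y = x $ i * y $ i + x $ j * y $ j" if "y $ k = 0" for x y :: "real^3"
    using that sum_UNIV_3_distinct[OF ijk, of "\<lambda>n. x $ n * y $ n"] by (simp add: inner_vec_def)
  have "(u $ j * u' $ i - u $ i * u' $ j) * (?d $ j * ?d' $ i - ?d $ i * ?d' $ j)
      = (?d \<bullet> u) * (?d' \<bullet> u') - (?d \<bullet> u') * (?d' \<bullet> u)"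
    using u u' by (simp add: in2 algebra_simps)
  moreover have "(?d \<bullet> u') * (?d' \<bullet> u) \<le> \<bar>?d \<bullet> u'\<bar> * \<bar>?d' \<bullet> u\<bar>"
    by (metis abs_ge_self abs_mult)
  moreover have "\<dots> \<le> F u' * F u"
    by (intro mult_mono abs_gradient_inner_le F cv u u') (use integrand_nonneg[OF F] in auto)
  moreover have "(?d \<bullet> u) * (?d' \<bullet> u') = F u * F u'"
    using integrand_euler[OF F] u u' by simp
  ultimately have "0 \<le> (u $ j * u' $ i - u $ i * u' $ j) * (?d $ j * ?d' $ i - ?d $ i * ?d' $ j)"
    by (simp add: mult.commute)
  then have "0 \<le> (l * l' * m * m') * ((u $ j * u' $ i - u $ i * u' $ j) * (?d $ j * ?d' $ i - ?d $ i * ?d' $ j))"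
    using u u' by simp
  also have "\<dots> = (\<nu> $ j * \<nu>' $ i - \<nu> $ i * \<nu>' $ j) *
    (gradient F \<nu> $ j * gradient F \<nu>' $ i - gradient F \<nu> $ i * gradient F \<nu>' $ j)"
    using u(5) u'(5) by (simp add: algebra_simps)
  finally show ?thesis .
qed

text \<open>Here a1, a2 are the entries i, j of a normal, b1, b2 those of its gradient, and c is the
  third term of Euler's sum. The diagonal entry F - a1 b1 is then a2 b2 + c, and the left side is
  the polar form of the 2 x 2 determinant.\<close>

lemma mixed_discriminant_identity:
  fixes a1 a2 b1 b2 c a1' a2' b1' b2' c' :: real
  shows "(a2 * b2 + c) * (a1' * b1' + c') + (a1 * b1 + c) * (a2' * b2' + c')
      - a1 * b2 * (a2' * b1') - a2 * b1 * (a1' * b2') =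
    2 * (c * c') + c * (a1' * b1' + a2' * b2') + c' * (a1 * b1 + a2 * b2)
      + (a2 * a1' - a1 * a2') * (b2 * b1' - b1 * b2')"
  by algebra

text \<open>In \<open>mixed_discriminant_identity\<close> the summands with a single c are
  nonnegative by reflection symmetry and the cross products by the projection hypothesis; what is
  left is the product of the two c.\<close>

lemma B_matrix_mixed_discriminant:
  assumes F: "integrand F" and cv: "convex_on UNIV F"
    and even: "\<And>i \<nu>. F (\<chi> j. if j = i then - \<nu> $ j else \<nu> $ j) = F \<nu>"
    and g: "\<And>\<nu>. \<nu> \<in> sphere 0 1 \<Longrightarrow> coord_proj k \<nu> \<noteq> 0 \<Longrightarrow>
      coord_proj k (gradient F \<nu>) /\<^sub>R norm (coord_proj k (gradient F \<nu>)) =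
      g (coord_proj k \<nu> /\<^sub>R norm (coord_proj k \<nu>))"
    and ijk: "i \<noteq> j" "k \<noteq> i" "k \<noteq> j"
    and sph: "\<nu> \<in> sphere 0 1" "\<nu>' \<in> sphere 0 1"
  defines "M \<equiv> B_matrix F \<nu>" and "M' \<equiv> B_matrix F \<nu>'"
  shows "2 * ((\<nu> $ k * gradient F \<nu> $ k) * (\<nu>' $ k * gradient F \<nu>' $ k))
    \<le> M $ i $ i * M' $ j $ j + M $ j $ j * M' $ i $ i - M $ i $ j * M' $ j $ i - M $ j $ i * M' $ i $ j"
proof -
  let ?c = "\<lambda>n x. x $ n * gradient F x $ n"
  have nz: "\<nu> \<noteq> 0" "\<nu>' \<noteq> 0" using sph by auto
  have nn: "0 \<le> ?c n \<nu>" "0 \<le> ?c n \<nu>'" for n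
    using component_gradient_nonneg[OF F cv] nz even by auto
  have Fe: "F x = ?c i x + ?c j x + ?c k x" if "x \<noteq> 0" for x
    using integrand_euler[OF F that]
      sum_UNIV_3_distinct[OF ijk, of "\<lambda>n. gradient F x $ n * x $ n"] by (simp add: inner_vec_def mult.commute)
  have "M $ i $ i * M' $ j $ j + M $ j $ j * M' $ i $ i - M $ i $ j * M' $ j $ i - M $ j $ i * M' $ i $ j
    = 2 * (?c k \<nu> * ?c k \<nu>') + ?c k \<nu> * (?c i \<nu>' + ?c j \<nu>') + ?c k \<nu>' * (?c i \<nu> + ?c j \<nu>)
      + (\<nu> $ j * \<nu>' $ i - \<nu> $ i * \<nu>' $ j) *
       (gradient F \<nu> $ j * gradient F \<nu>' $ i - gradient F \<nu> $ i * gradient F \<nu>' $ j)"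
    using ijk unfolding M_def M'_def B_matrix_def Fe[OF nz(1)] Fe[OF nz(2)]
    by simp (rule mixed_discriminant_identity)
  moreover have "0 \<le> ?c k \<nu> * (?c i \<nu>' + ?c j \<nu>')" "0 \<le> ?c k \<nu>' * (?c i \<nu> + ?c j \<nu>)"
    using nn by auto
  ultimately show ?thesis using gradient_cross_nonneg[OF F cv g ijk sph] by simp
qed

section \<open>Matrix fields on the plane\<close>

text \<open>The partial derivatives are arguments, so that convolution can act on them separately. A
  bound on u itself is left to \<open>divergence_bound\<close>, where it enters
  quantitatively.\<close>

definition test_potential :: "(real \<times> real \<Rightarrow> real) \<Rightarrow> (real \<times> real \<Rightarrow> real) \<Rightarrow> (real \<times> real \<Rightarrow> real) \<Rightarrow> bool" where
  "test_potential u u1 u2 \<longleftrightarrow>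
     (\<forall>r. (u has_derivative (\<lambda>h. u1 r * fst h + u2 r * snd h)) (at r)) \<and>
     continuous_on UNIV u1 \<and> continuous_on UNIV u2 \<and> bounded (range u1) \<and> bounded (range u2)"

section \<open>Convolution of Lipschitz kernels with weighted image measures\<close>

lemma Taylor_remainder_le:
  fixes k k1 k2 :: "real \<times> real \<Rightarrow> real"
  assumes k: "\<And>r. (k has_derivative (\<lambda>h. k1 r * fst h + k2 r * snd h)) (at r)"
    and L: "L-lipschitz_on UNIV k1" "L-lipschitz_on UNIV k2"
  shows "\<bar>k (r + h) - k r - (k1 r * fst h + k2 r * snd h)\<bar> \<le> 2 * L * (norm h)\<^sup>2"
proof -
  have "((\<lambda>t. k (r + t *\<^sub>R h)) has_real_derivative k1 (r + t *\<^sub>R h) * fst h + k2 (r + t *\<^sub>R h) * snd h) (at t)" for t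
  proof -
    have "((\<lambda>t. r + t *\<^sub>R h) has_derivative (\<lambda>s. s *\<^sub>R h)) (at t)"
      by (auto intro!: derivative_eq_intros)
    from has_derivative_compose[OF this k]
    show ?thesis unfolding has_field_derivative_def
      by (rule has_derivative_eq_rhs) (auto simp: fun_eq_iff algebra_simps)
  qed
  then obtain z where z: "0 < z" "z < 1"
    "k (r + 1 *\<^sub>R h) - k (r + 0 *\<^sub>R h) = (1 - 0) * (k1 (r + z *\<^sub>R h) * fst h + k2 (r + z *\<^sub>R h) * snd h)"
    using MVT2[of 0 1 "\<lambda>t. k (r + t *\<^sub>R h)" "\<lambda>t. k1 (r + t *\<^sub>R h) * fst h + k2 (r + t *\<^sub>R h) * snd h"] by auto
  have L0: "0 \<le> L" using L(1) by (simp add: lipschitz_on_def)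
  have d: "\<bar>g (r + z *\<^sub>R h) - g r\<bar> \<le> L * norm h" if "L-lipschitz_on UNIV g" for g :: "real \<times> real \<Rightarrow> real"
  proof -
    have "\<bar>g (r + z *\<^sub>R h) - g r\<bar> \<le> L * dist (r + z *\<^sub>R h) r"
      using lipschitz_onD[OF that] by (simp add: dist_real_def)
    also have "\<dots> \<le> L * norm h" using z L0 by (intro mult_left_mono) (auto simp: dist_norm mult_left_le_one_le)
    finally show ?thesis .
  qed
  have fs: "\<bar>fst h\<bar> \<le> norm h" "\<bar>snd h\<bar> \<le> norm h"
    using norm_fst_le[of "fst h" "snd h"] norm_snd_le[of "snd h" "fst h"] by auto
  have "\<bar>k (r + h) - k r - (k1 r * fst h + k2 r * snd h)\<bar>
    = \<bar>(k1 (r + z *\<^sub>R h) - k1 r) * fst h + (k2 (r + z *\<^sub>R h) - k2 r) * snd h\<bar>"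
    using z(3) by (simp add: algebra_simps)
  also have "\<dots> \<le> \<bar>k1 (r + z *\<^sub>R h) - k1 r\<bar> * \<bar>fst h\<bar> + \<bar>k2 (r + z *\<^sub>R h) - k2 r\<bar> * \<bar>snd h\<bar>"
    by (metis abs_mult abs_triangle_ineq)
  also have "\<dots> \<le> (L * norm h) * norm h + (L * norm h) * norm h"
    using d L fs L0 by (intro add_mono mult_mono) auto
  finally show ?thesis by (simp add: power2_eq_square algebra_simps)
qed

lemma boundedI_range_real:
  fixes f :: "'a \<Rightarrow> real"
  shows "(\<And>r. \<bar>f r\<bar> \<le> K) \<Longrightarrow> bounded (range f)"
  by (auto simp: bounded_iff)

lemma bounded_range_real:
  fixes f :: "'a \<Rightarrow> real"
  shows "bounded (range f) \<Longrightarrow> \<exists>K. \<forall>r. \<bar>f r\<bar> \<le> K"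
  by (simp add: bounded_iff)

text \<open>The convolution of k with the image under Y of the measure w N. Since w may change sign,
  the integral is taken over N itself, which avoids signed image measures.\<close>

definition convol :: "(real \<times> real \<Rightarrow> real) \<Rightarrow> 'a measure \<Rightarrow> ('a \<Rightarrow> real \<times> real) \<Rightarrow> ('a \<Rightarrow> real) \<Rightarrow> real \<times> real \<Rightarrow> real" where
  "convol k N Y w x = (LINT \<omega>|N. k (x - Y \<omega>) * w \<omega>)"

context finite_measure
begin

lemma integrable_convol:
  fixes k :: "real \<times> real \<Rightarrow> real" and w :: "'a \<Rightarrow> real"
  assumes k: "continuous_on UNIV k" "bounded (range k)"
    and [measurable]: "Y \<in> borel_measurable M" "w \<in> borel_measurable M" and w: "\<And>\<omega>. \<bar>w \<omega>\<bar> \<le> B"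
  shows "integrable M (\<lambda>\<omega>. k (x - Y \<omega>) * w \<omega>)"
proof -
  obtain K where K: "\<And>r. \<bar>k r\<bar> \<le> K" using bounded_range_real[OF k(2)] by blast
  have [measurable]: "k \<in> borel_measurable borel" using k(1) by (rule borel_measurable_continuous_onI)
  show ?thesis
  proof (rule integrable_const_bound[where B="K * B"])
    have "0 \<le> K" using K[of 0] by linarith
    then show "AE \<omega> in M. norm (k (x - Y \<omega>) * w \<omega>) \<le> K * B"
      unfolding real_norm_def abs_mult using K w by (intro AE_I2 mult_mono) auto
  qed measurable
qed

lemma abs_integral_le_const:
  fixes f :: "'a \<Rightarrow> real"
  assumes "integrable M f" "\<And>x. \<bar>f x\<bar> \<le> B"
  shows "\<bar>integral\<^sup>L M f\<bar> \<le> B * measure M (space M)"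
proof -
  have "\<bar>integral\<^sup>L M f\<bar> \<le> (LINT x|M. \<bar>f x\<bar>)" by (rule integral_abs_bound)
  also have "\<dots> \<le> (LINT x|M. B)" using assms by (intro integral_mono) auto
  finally show ?thesis by (simp add: mult.commute)
qed

lemma convol_lipschitz_continuous:
  assumes k: "L-lipschitz_on UNIV k" "bounded (range k)"
    and Y: "Y \<in> borel_measurable M" "w \<in> borel_measurable M" and w: "\<And>\<omega>. \<bar>w \<omega>\<bar> \<le> B"
  shows "continuous_on UNIV (convol k M Y w)" "bounded (range (convol k M Y w))"
proof -
  note int = integrable_convol[OF lipschitz_on_continuous_on[OF k(1)] k(2) Y w]
  have B0: "0 \<le> B" using w[of undefined] by linarith
  have L0: "0 \<le> L" using k(1) by (simp add: lipschitz_on_def)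
  have "(L * B * measure M (space M))-lipschitz_on UNIV (convol k M Y w)"
  proof (rule lipschitz_onI)
    fix x y
    have "convol k M Y w x - convol k M Y w y = (LINT \<omega>|M. (k (x - Y \<omega>) - k (y - Y \<omega>)) * w \<omega>)"
      unfolding convol_def using int by (simp add: left_diff_distrib)
    also have "\<bar>\<dots>\<bar> \<le> (L * dist x y * B) * measure M (space M)"
    proof (rule abs_integral_le_const)
      show "integrable M (\<lambda>\<omega>. (k (x - Y \<omega>) - k (y - Y \<omega>)) * w \<omega>)" using int by (simp add: left_diff_distrib)
      show "\<bar>(k (x - Y \<omega>) - k (y - Y \<omega>)) * w \<omega>\<bar> \<le> L * dist x y * B" for \<omega>
        unfolding abs_mult using lipschitz_onD[OF k(1), of "x - Y \<omega>" "y - Y \<omega>"] w[of \<omega>] L0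
        by (intro mult_mono) (auto simp: dist_real_def dist_norm)
    qed
    finally show "dist (convol k M Y w x) (convol k M Y w y) \<le> L * B * measure M (space M) * dist x y"
      by (simp add: dist_real_def mult_ac)
  qed (use B0 L0 in auto)
  then show "continuous_on UNIV (convol k M Y w)" by (rule lipschitz_on_continuous_on)
  obtain K where K: "\<And>r. \<bar>k r\<bar> \<le> K" using bounded_range_real[OF k(2)] by blast
  have "\<bar>convol k M Y w x\<bar> \<le> K * B * measure M (space M)" for x
    unfolding convol_def
  proof (rule abs_integral_le_const[OF int])
    show "\<bar>k (x - Y \<omega>) * w \<omega>\<bar> \<le> K * B" for \<omega>
      unfolding abs_mult using K w order_trans[OF abs_ge_zero K[of 0]] by (intro mult_mono) auto
  qed
  then show "bounded (range (convol k M Y w))" by (rule boundedI_range_real)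
qed

lemma test_potential_convol:
  assumes k: "\<And>r. (k has_derivative (\<lambda>h. k1 r * fst h + k2 r * snd h)) (at r)" "bounded (range k)"
    and k1: "L-lipschitz_on UNIV k1" "bounded (range k1)"
    and k2: "L-lipschitz_on UNIV k2" "bounded (range k2)"
    and Y: "Y \<in> borel_measurable M" "w \<in> borel_measurable M" and w: "\<And>\<omega>. \<bar>w \<omega>\<bar> \<le> B"
  shows "test_potential (convol k M Y w) (convol k1 M Y w) (convol k2 M Y w)"
  unfolding test_potential_def
proof (intro conjI allI)
  show "continuous_on UNIV (convol k1 M Y w)" "bounded (range (convol k1 M Y w))"
    "continuous_on UNIV (convol k2 M Y w)" "bounded (range (convol k2 M Y w))"
    using convol_lipschitz_continuous[OF k1 Y w] convol_lipschitz_continuous[OF k2 Y w] by auto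
  fix r
  have kc: "continuous_on UNIV k"
    using k(1) has_derivative_continuous by (force simp: continuous_on_eq_continuous_at)
  note int = integrable_convol[OF kc k(2) Y w] 
    integrable_convol[OF lipschitz_on_continuous_on[OF k1(1)] k1(2) Y w]
    integrable_convol[OF lipschitz_on_continuous_on[OF k2(1)] k2(2) Y w]
  have B0: "0 \<le> B" using w[of undefined] by linarith
  have L0: "0 \<le> L" using k1(1) by (simp add: lipschitz_on_def)
  define D where "D = (\<lambda>h. convol k1 M Y w r * fst h + convol k2 M Y w r * snd h)"
  define C where "C = 2 * L * B * measure M (space M)"
  have C0: "0 \<le> C" using B0 L0 by (simp add: C_def)
  \<comment> \<open>Lipschitz partial derivatives make the Taylor remainder quadratic in h,
    uniformly over the points of integration; this replaces a limit argument for differentiating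
    under the integral.\<close>
  have est: "\<bar>convol k M Y w (r + h) - convol k M Y w r - D h\<bar> \<le> C * (norm h)\<^sup>2" for h
  proof -
    let ?f = "\<lambda>\<omega>. (k (r - Y \<omega> + h) - k (r - Y \<omega>) - (k1 (r - Y \<omega>) * fst h + k2 (r - Y \<omega>) * snd h)) * w \<omega>"
    have f: "?f = (\<lambda>\<omega>. k (r + h - Y \<omega>) * w \<omega> - k (r - Y \<omega>) * w \<omega> - 
       (k1 (r - Y \<omega>) * w \<omega> * fst h + k2 (r - Y \<omega>) * w \<omega> * snd h))"
      by (auto simp: algebra_simps)
    have "integrable M ?f" unfolding f using int by simp
    moreover have "convol k M Y w (r + h) - convol k M Y w r - D h = integral\<^sup>L M ?f"
      unfolding f convol_def D_def using int by simp
    moreover have "\<bar>?f \<omega>\<bar> \<le> 2 * L * (norm h)\<^sup>2 * B" for \<omega>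
      unfolding abs_mult[of _ "w \<omega>"] using L0 w[of \<omega>]
      by (intro mult_mono Taylor_remainder_le[OF k(1) k1(1) k2(1)]) auto
    ultimately show ?thesis using abs_integral_le_const[of ?f "2 * L * (norm h)\<^sup>2 * B"] 
      by (simp add: C_def mult_ac)
  qed
  have lin: "bounded_linear D" unfolding D_def
    by (intro bounded_linear_intros)
  have "((\<lambda>h. norm (convol k M Y w (r + h) - convol k M Y w r - D h) / norm h) \<longlongrightarrow> 0) (at 0)"
  proof (rule Lim_null_comparison)
    show "\<forall>\<^sub>F h in at 0. norm (norm (convol k M Y w (r + h) - convol k M Y w r - D h) / norm h) \<le> C * norm h"
      unfolding eventually_at_filter
    proof (intro always_eventually allI impI)
      fix h :: "real \<times> real" assume "h \<noteq> 0"
      then show "norm (norm (convol k M Y w (r + h) - convol k M Y w r - D h) / norm h) \<le> C * norm h"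
        using est[of h] by (simp add: divide_simps power2_eq_square mult_ac)
    qed
    show "((\<lambda>h. C * norm h) \<longlongrightarrow> 0) (at (0::real \<times> real))"
      by (auto intro!: tendsto_eq_intros)
  qed
  then have "(convol k M Y w has_derivative D) (at r)"
    unfolding has_derivative_at using lin by simp
  then show "(convol k M Y w has_derivative (\<lambda>h. convol k1 M Y w r * fst h + convol k2 M Y w r * snd h)) (at r)"
    by (simp add: D_def)
qed

text \<open>Fubini exchanges the two points, which reflects the argument of the kernel, and evenness
  undoes the reflection.\<close>

lemma integral_convol_commute:
  assumes k: "continuous_on UNIV k" "bounded (range k)" "\<And>r. k (- r) = k r"
    and [measurable]: "Y \<in> borel_measurable M" "v \<in> borel_measurable M" "w \<in> borel_measurable M"
    and v: "\<And>\<omega>. \<bar>v \<omega>\<bar> \<le> B" and w: "\<And>\<omega>. \<bar>w \<omega>\<bar> \<le> B"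
  shows "(LINT \<omega>|M. v \<omega> * convol k M Y w (Y \<omega>)) = (LINT \<omega>|M. w \<omega> * convol k M Y v (Y \<omega>))"
proof -
  interpret P: pair_sigma_finite M M by standard
  interpret Q: finite_measure "M \<Otimes>\<^sub>M M" by (rule finite_measure_pair_measure) unfold_locales
  obtain K where K: "\<And>r. \<bar>k r\<bar> \<le> K" using bounded_range_real[OF k(2)] by blast
  have [measurable]: "k \<in> borel_measurable borel" using k(1) by (rule borel_measurable_continuous_onI)
  have "integrable (M \<Otimes>\<^sub>M M) (\<lambda>(x, y). v x * (k (Y x - Y y) * w y))"
  proof (rule Q.integrable_const_bound[where B="B * (K * B)"])
    have "0 \<le> K" "0 \<le> B" using K[of 0] v[of undefined] by linarith+
    then have "norm (v x * (k (Y x - Y y) * w y)) \<le> B * (K * B)" for x y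
      unfolding real_norm_def abs_mult using K w v by (intro mult_mono) auto
    then show "AE z in M \<Otimes>\<^sub>M M. norm (case z of (x, y) \<Rightarrow> v x * (k (Y x - Y y) * w y)) \<le> B * (K * B)"
      by auto
  qed measurable
  from P.Fubini_integral[OF this]
  have "(LINT y|M. LINT x|M. v x * (k (Y x - Y y) * w y)) = (LINT x|M. v x * convol k M Y w (Y x))"
    by (simp add: convol_def)
  moreover have "(LINT x|M. v x * (k (Y x - Y y) * w y)) = w y * convol k M Y v (Y y)" for y
  proof -
    have "k (Y x - Y y) = k (Y y - Y x)" for x using k(3)[of "Y y - Y x"] by simp
    then show ?thesis by (simp add: convol_def mult_ac flip: integral_mult_right_zero)
  qed
  ultimately show ?thesis by simp
qed

end

section \<open>The Cauchy kernel, the arctangent and their tensor products\<close>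

definition cauchy_kernel :: "real \<Rightarrow> real" where
  "cauchy_kernel t = 1 / (1 + t\<^sup>2)"

definition cauchy_kernel' :: "real \<Rightarrow> real" where
  "cauchy_kernel' t = - 2 * t / (1 + t\<^sup>2)\<^sup>2"

lemma one_plus_square_pos: "0 < 1 + (t::real)\<^sup>2"
  by (simp add: add_pos_nonneg)

lemma arctan_deriv: "(arctan has_real_derivative cauchy_kernel t) (at t)"
  using DERIV_arctan[of t] by (simp add: cauchy_kernel_def inverse_eq_divide)

lemma cauchy_kernel_deriv: "(cauchy_kernel has_real_derivative cauchy_kernel' t) (at t)"
  unfolding cauchy_kernel_def[abs_def] cauchy_kernel'_def using one_plus_square_pos[of t]
  by (auto intro!: derivative_eq_intros simp: power2_eq_square)

lemma cauchy_kernel_bounds: "0 \<le> cauchy_kernel t" "cauchy_kernel t \<le> 1" "\<bar>cauchy_kernel t\<bar> \<le> 1"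
  using one_plus_square_pos[of t] by (auto simp: cauchy_kernel_def)

lemma abs_cauchy_kernel'_le: "\<bar>cauchy_kernel' t\<bar> \<le> 1"
proof -
  have "2 * \<bar>t\<bar> \<le> 1 + t\<^sup>2" using zero_le_power2[of "\<bar>t\<bar> - 1"] by (simp add: power2_eq_square algebra_simps)
  also have "\<dots> \<le> (1 + t\<^sup>2)\<^sup>2" by (rule self_le_power) auto
  finally show ?thesis
    using one_plus_square_pos[of t] by (simp add: cauchy_kernel'_def abs_mult)
qed

lemma real_lipschitz_deriv_bound:
  fixes f :: "real \<Rightarrow> real"
  assumes "\<And>t. (f has_real_derivative f' t) (at t)" "\<And>t. \<bar>f' t\<bar> \<le> B"
  shows "B-lipschitz_on UNIV f"
proof (rule lipschitz_onI)
  show "0 \<le> B" using assms(2)[of 0] by linarith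
  show "dist (f x) (f y) \<le> B * dist x y" for x y
    using field_differentiable_bound[of UNIV f f' B x y] assms by (simp add: dist_norm)
qed

lemma lipschitz_arctan: "1-lipschitz_on UNIV arctan"
  using real_lipschitz_deriv_bound[OF arctan_deriv] cauchy_kernel_bounds(3) by blast

lemma lipschitz_cauchy_kernel: "1-lipschitz_on UNIV cauchy_kernel"
  using real_lipschitz_deriv_bound[OF cauchy_kernel_deriv] abs_cauchy_kernel'_le by blast

lemma lipschitz_cauchy_kernel': "8-lipschitz_on UNIV cauchy_kernel'"
proof (rule real_lipschitz_deriv_bound)
  fix t :: real
  let ?f = "\<lambda>t::real. (6 * t\<^sup>2 - 2) / (1 + t\<^sup>2)^3"
  have nz: "1 + t\<^sup>2 \<noteq> 0" using one_plus_square_pos[of t] by simp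
  show "(cauchy_kernel' has_real_derivative ?f t) (at t)"
  proof -
    have "((\<lambda>t. - 2 * t) has_real_derivative - 2) (at t)"
      "((\<lambda>t. (1 + t\<^sup>2)\<^sup>2) has_real_derivative 2 * (1 + t\<^sup>2) * (2 * t)) (at t)"
      by (auto intro!: derivative_eq_intros)
    then have "(cauchy_kernel' has_real_derivative
        (- 2 * (1 + t\<^sup>2)\<^sup>2 - (- 2 * t) * (2 * (1 + t\<^sup>2) * (2 * t))) / ((1 + t\<^sup>2)\<^sup>2 * (1 + t\<^sup>2)\<^sup>2)) (at t)"
      unfolding cauchy_kernel'_def[abs_def] by (rule DERIV_divide) (use nz in simp)
    moreover have "- 2 * (1 + t\<^sup>2)\<^sup>2 - (- 2 * t) * (2 * (1 + t\<^sup>2) * (2 * t)) = (6 * t\<^sup>2 - 2) * (1 + t\<^sup>2)"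
      by algebra
    moreover have "(1 + t\<^sup>2)\<^sup>2 * (1 + t\<^sup>2)\<^sup>2 = (1 + t\<^sup>2) ^ 3 * (1 + t\<^sup>2)"
      by algebra
    ultimately show ?thesis using nz by simp
  qed
  have "\<bar>6 * t\<^sup>2 - 2\<bar> \<le> 8 * (1 + t\<^sup>2)" by (auto simp: abs_le_iff) 
  also have "\<dots> \<le> 8 * (1 + t\<^sup>2) ^ 3"
    using self_le_power[of "1 + t\<^sup>2" 3] by simp
  finally show "\<bar>?f t\<bar> \<le> 8"
    using one_plus_square_pos[of t] by (simp add: divide_le_eq)
qed

lemma lipschitz_tensor:
  fixes g h :: "real \<Rightarrow> real"
  assumes g: "L-lipschitz_on UNIV g" "\<And>t. \<bar>g t\<bar> \<le> B" and h: "L-lipschitz_on UNIV h" "\<And>t. \<bar>h t\<bar> \<le> B"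
  shows "(2 * B * L)-lipschitz_on UNIV (\<lambda>r. g (fst r) * h (snd r))"
    and "bounded (range (\<lambda>r. g (fst r) * h (snd r)))"
proof -
  have B0: "0 \<le> B" using g(2)[of 0] by linarith
  have L0: "0 \<le> L" using g(1) by (simp add: lipschitz_on_def)
  show "(2 * B * L)-lipschitz_on UNIV (\<lambda>r. g (fst r) * h (snd r))"
  proof (rule lipschitz_onI)
    fix x y :: "real \<times> real"
    have "\<bar>g (fst x) - g (fst y)\<bar> \<le> L * dist x y" "\<bar>h (snd x) - h (snd y)\<bar> \<le> L * dist x y"
      using lipschitz_onD[OF g(1), of "fst x" "fst y"] lipschitz_onD[OF h(1), of "snd x" "snd y"]
        mult_left_mono[OF dist_fst_le[of x y] L0] mult_left_mono[OF dist_snd_le[of x y] L0]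
      by (auto simp: dist_real_def)
    then have "\<bar>g (fst x) - g (fst y)\<bar> * \<bar>h (snd x)\<bar> + \<bar>g (fst y)\<bar> * \<bar>h (snd x) - h (snd y)\<bar>
       \<le> (L * dist x y) * B + B * (L * dist x y)"
      using g(2) h(2) B0 L0 by (intro add_mono mult_mono) auto
    moreover have "\<bar>g (fst x) * h (snd x) - g (fst y) * h (snd y)\<bar>
       \<le> \<bar>g (fst x) - g (fst y)\<bar> * \<bar>h (snd x)\<bar> + \<bar>g (fst y)\<bar> * \<bar>h (snd x) - h (snd y)\<bar>"
    proof -
      have "g (fst x) * h (snd x) - g (fst y) * h (snd y)
        = (g (fst x) - g (fst y)) * h (snd x) + g (fst y) * (h (snd x) - h (snd y))"
        by (simp add: algebra_simps)
      then show ?thesis by (metis abs_mult abs_triangle_ineq)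
    qed
    ultimately show "dist (g (fst x) * h (snd x)) (g (fst y) * h (snd y)) \<le> 2 * B * L * dist x y"
      by (simp add: dist_real_def mult_ac)
  qed (use B0 L0 in simp)
  have "\<bar>g (fst r) * h (snd r)\<bar> \<le> B * B" for r
    unfolding abs_mult using g(2) h(2) B0 by (intro mult_mono) auto
  then show "bounded (range (\<lambda>r. g (fst r) * h (snd r)))" by (rule boundedI_range_real)
qed

lemma has_derivative_tensor:
  assumes "\<And>t. (g has_real_derivative g' t) (at t)" "\<And>t. (h has_real_derivative h' t) (at t)"
  shows "((\<lambda>r. g (fst r) * h (snd r)) has_derivative
    (\<lambda>d. g' (fst r) * h (snd r) * fst d + g (fst r) * h' (snd r) * snd d)) (at r)"
proof -
  have "((\<lambda>r. g (fst r)) has_derivative (\<lambda>d. g' (fst r) * fst d)) (at r)"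
    using has_derivative_compose[OF has_derivative_fst[OF has_derivative_ident] assms(1)[unfolded has_field_derivative_def]] .
  moreover have "((\<lambda>r. h (snd r)) has_derivative (\<lambda>d. h' (snd r) * snd d)) (at r)"
    using has_derivative_compose[OF has_derivative_snd[OF has_derivative_ident] assms(2)[unfolded has_field_derivative_def]] .
  ultimately show ?thesis
    by (rule has_derivative_eq_rhs[OF has_derivative_mult]) (auto simp: algebra_simps)
qed

lemma test_potential_tensor:
  assumes "\<And>t. (g has_real_derivative g' t) (at t)" "\<And>t. (h has_real_derivative h' t) (at t)"
    and b: "\<And>t. \<bar>g t\<bar> \<le> B" "\<And>t. \<bar>g' t\<bar> \<le> B" "\<And>t. \<bar>h t\<bar> \<le> B" "\<And>t. \<bar>h' t\<bar> \<le> B"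
    and "continuous_on UNIV g'" "continuous_on UNIV h'"
  shows "test_potential (\<lambda>r. g (fst r) * h (snd r)) (\<lambda>r. g' (fst r) * h (snd r)) (\<lambda>r. g (fst r) * h' (snd r))"
  unfolding test_potential_def
proof (intro conjI allI has_derivative_tensor)
  have c: "continuous_on UNIV g" "continuous_on UNIV h"
    using assms(1,2) DERIV_continuous by (force simp: continuous_on_eq_continuous_at)+
  show "continuous_on UNIV (\<lambda>r. g' (fst r) * h (snd r))" "continuous_on UNIV (\<lambda>r. g (fst r) * h' (snd r))"
    by (intro continuous_intros continuous_on_compose2[OF assms(7)] continuous_on_compose2[OF assms(8)]
      continuous_on_compose2[OF c(1)] continuous_on_compose2[OF c(2)]; simp)+
  have B0: "0 \<le> B" using b(1)[of 0] by linarith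
  have "\<bar>g' (fst r) * h (snd r)\<bar> \<le> B * B" "\<bar>g (fst r) * h' (snd r)\<bar> \<le> B * B" for r
    unfolding abs_mult using b B0 by (auto intro!: mult_mono)
  then show "bounded (range (\<lambda>r. g' (fst r) * h (snd r)))" "bounded (range (\<lambda>r. g (fst r) * h' (snd r)))"
    by (blast intro: boundedI_range_real)+
qed (use assms in auto)

lemma test_potential_affine:
  assumes u: "test_potential u u1 u2"
  shows "test_potential (\<lambda>r. u (s *\<^sub>R r - t)) (\<lambda>r. s * u1 (s *\<^sub>R r - t)) (\<lambda>r. s * u2 (s *\<^sub>R r - t))"
  unfolding test_potential_def
proof (intro conjI allI)
  fix r
  have "((\<lambda>r. s *\<^sub>R r - t) has_derivative (\<lambda>h. s *\<^sub>R h)) (at r)"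
    by (auto intro!: derivative_eq_intros)
  moreover have "(u has_derivative (\<lambda>h. u1 (s *\<^sub>R r - t) * fst h + u2 (s *\<^sub>R r - t) * snd h)) (at (s *\<^sub>R r - t))"
    using u unfolding test_potential_def by blast
  ultimately show "((\<lambda>r. u (s *\<^sub>R r - t)) has_derivative
      (\<lambda>h. s * u1 (s *\<^sub>R r - t) * fst h + s * u2 (s *\<^sub>R r - t) * snd h)) (at r)"
    by (rule has_derivative_eq_rhs[OF has_derivative_compose]) (auto simp: algebra_simps)
next
  have c: "continuous_on UNIV u1" "continuous_on UNIV u2" "bounded (range u1)" "bounded (range u2)"
    using u by (auto simp: test_potential_def)
  show "continuous_on UNIV (\<lambda>r. s * u1 (s *\<^sub>R r - t))" "continuous_on UNIV (\<lambda>r. s * u2 (s *\<^sub>R r - t))"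
    by (intro continuous_intros continuous_on_compose2[OF c(1)] continuous_on_compose2[OF c(2)]; simp)+
  have "bounded (range (\<lambda>r. s * v (s *\<^sub>R r - t)))" if v: "bounded (range v)" for v :: "real \<times> real \<Rightarrow> real"
  proof -
    obtain K where "\<And>r. \<bar>v r\<bar> \<le> K" using bounded_range_real[OF v] by blast
    then have "\<bar>s * v (s *\<^sub>R r - t)\<bar> \<le> \<bar>s\<bar> * K" for r
      unfolding abs_mult by (intro mult_left_mono) auto
    then show ?thesis by (rule boundedI_range_real)
  qed
  with c show "bounded (range (\<lambda>r. s * u1 (s *\<^sub>R r - t)))" "bounded (range (\<lambda>r. s * u2 (s *\<^sub>R r - t)))" by auto
qed

lemma abs_arctan_le: "\<bar>arctan t\<bar> \<le> pi / 2"
  using arctan_bounded[of t] by auto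

text \<open>A smoothed jump in the first coordinate times a smoothed delta function in the second.
  Convolved with a flux density, it compares the flux through the two halves of a horizontal line on
  either side of a point. \<open>kern1\<close> and \<open>kern2\<close> are its partial derivatives;
  \<open>kern1\<close> is positive and imitates a planar delta function up to a factor.\<close>

definition "kern r = arctan (fst r) * cauchy_kernel (snd r)"
definition "kern1 r = cauchy_kernel (fst r) * cauchy_kernel (snd r)"
definition "kern2 r = arctan (fst r) * cauchy_kernel' (snd r)"

text \<open>\<open>kern\<close> is odd in the first variable and even in the second. Each derivative
  flips one parity, leaving even-even and odd-odd, both invariant under reflection in the
  origin.\<close>

lemma kern_minus: "kern1 (- r) = kern1 r" "kern2 (- r) = kern2 r"
  by (simp_all add: kern1_def kern2_def cauchy_kernel_def cauchy_kernel'_def arctan_minus)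

lemma kern_has_derivative: "(kern has_derivative (\<lambda>h. kern1 r * fst h + kern2 r * snd h)) (at r)"
  unfolding kern_def[abs_def] kern1_def kern2_def
  by (rule has_derivative_tensor[OF arctan_deriv cauchy_kernel_deriv])

lemma kern_lipschitz:
  shows "32-lipschitz_on UNIV kern1" "bounded (range kern1)" "32-lipschitz_on UNIV kern2"
    "bounded (range kern2)" "bounded (range kern)"
proof -
  \<comment> \<open>A common bound B = 2, by pi < 4, and a common Lipschitz constant L = 8 give 2 *
    B * L = 32 in \<open>lipschitz_tensor\<close>.\<close>
  have pi: "\<bar>arctan t\<bar> \<le> 2" "\<bar>cauchy_kernel t\<bar> \<le> 2" "\<bar>cauchy_kernel' t\<bar> \<le> 2" for t
    using abs_arctan_le[of t] cauchy_kernel_bounds[of t] abs_cauchy_kernel'_le[of t] pi_less_4 by linarith+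
  have l: "8-lipschitz_on UNIV arctan" "8-lipschitz_on UNIV cauchy_kernel"
    using lipschitz_arctan lipschitz_cauchy_kernel by (auto intro: lipschitz_on_le)
  show "32-lipschitz_on UNIV kern1" "bounded (range kern1)"
    using lipschitz_tensor[OF l(2) pi(2) l(2) pi(2)] unfolding kern1_def[abs_def] by simp_all
  show "32-lipschitz_on UNIV kern2" "bounded (range kern2)"
    using lipschitz_tensor[OF l(1) pi(1) lipschitz_cauchy_kernel' pi(3)] unfolding kern2_def[abs_def] by simp_all
  show "bounded (range kern)"
    using lipschitz_tensor[OF l(1) pi(1) l(2) pi(2)] unfolding kern_def[abs_def] by simp_all
qed

lemma kern_continuous: "continuous_on UNIV kern" "continuous_on UNIV kern1" "continuous_on UNIV kern2"
  using kern_lipschitz(1,3)[THEN lipschitz_on_continuous_on]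
    has_derivative_continuous[OF kern_has_derivative] by (auto intro: continuous_at_imp_continuous_on)

text \<open>
  The image under \<open>Y\<close> of the planar vector measure \<open>(f, g) N\<close> has a distributional divergence of
  total mass at most \<open>T\<close>.
\<close>

definition divergence_bound ::
    "'a measure \<Rightarrow> ('a \<Rightarrow> real \<times> real) \<Rightarrow> real \<Rightarrow> ('a \<Rightarrow> real) \<Rightarrow> ('a \<Rightarrow> real) \<Rightarrow> bool" where
  "divergence_bound N Y T f g \<longleftrightarrow> (\<forall>u u1 u2 K. test_potential u u1 u2 \<and> 0 < K \<and> (\<forall>r. \<bar>u r\<bar> \<le> K) \<longrightarrow>
     \<bar>LINT \<omega>|N. f \<omega> * u1 (Y \<omega>) + g \<omega> * u2 (Y \<omega>)\<bar> \<le> K * T)"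

context finite_measure
begin

lemma integrable_mult_continuous:
  assumes [measurable]: "Y \<in> borel_measurable M" "w \<in> borel_measurable M" and w: "\<And>\<omega>. \<bar>w \<omega>\<bar> \<le> (B::real)"
    and v: "continuous_on UNIV (v :: real \<times> real \<Rightarrow> real)" "bounded (range v)"
  shows "integrable M (\<lambda>\<omega>. w \<omega> * v (Y \<omega>))"
proof -
  obtain K where K: "\<And>r. \<bar>v r\<bar> \<le> K" using bounded_range_real[OF v(2)] by blast
  have [measurable]: "v \<in> borel_measurable borel" using v(1) by (rule borel_measurable_continuous_onI)
  show ?thesis
  proof (rule integrable_const_bound[where B="B * K"])
    have "0 \<le> B" using w[of undefined] by linarith
    then show "AE \<omega> in M. norm (w \<omega> * v (Y \<omega>)) \<le> B * K"
      unfolding real_norm_def abs_mult using K w by (intro AE_I2 mult_mono) auto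
  qed measurable
qed

text \<open>Row a is tested with \<open>kern\<close> convolved with Mbb, row b with
  \<open>kern\<close> convolved with Mab. The \<open>kern1\<close> parts are the two integrals
  sought; the \<open>kern2\<close> parts agree by evenness and cancel in the difference. The suprema
  of the two potentials, pi^2/4 T and pi^2/2 T, add up to the constant.\<close>

lemma bilinear_kernel_estimate:
  assumes Y: "Y \<in> borel_measurable M"
    and m: "Maa \<in> borel_measurable M" "Mab \<in> borel_measurable M" "Mba \<in> borel_measurable M" "Mbb \<in> borel_measurable M"
    and b: "\<And>\<omega>. \<bar>Maa \<omega>\<bar> \<le> B" "\<And>\<omega>. \<bar>Mab \<omega>\<bar> \<le> B" "\<And>\<omega>. \<bar>Mba \<omega>\<bar> \<le> B" "\<And>\<omega>. \<bar>Mbb \<omega>\<bar> \<le> B"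
    and nn: "\<And>\<omega>. 0 \<le> Maa \<omega>" "\<And>\<omega>. 0 \<le> Mbb \<omega>"
    and H: "divergence_bound M Y T Maa Mab" "divergence_bound M Y T Mba Mbb" and T: "0 < T"
  shows "(LINT \<omega>|M. Maa \<omega> * convol kern1 M Y Mbb (Y \<omega>)) - (LINT \<omega>|M. Mba \<omega> * convol kern1 M Y Mab (Y \<omega>))
    \<le> 3 * pi\<^sup>2 / 4 * T\<^sup>2"
proof -
  note H1 = H(1)[unfolded divergence_bound_def, rule_format, OF conjI, OF _ conjI]
  note H2 = H(2)[unfolded divergence_bound_def, rule_format, OF conjI, OF _ conjI]
  have ck: "continuous_on UNIV cauchy_kernel" "continuous_on UNIV cauchy_kernel'" "continuous_on UNIV arctan"
    using lipschitz_cauchy_kernel lipschitz_cauchy_kernel' lipschitz_arctan lipschitz_on_continuous_on by blast+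
  have pi: "\<bar>arctan t\<bar> \<le> 2" "\<bar>cauchy_kernel t\<bar> \<le> 2" "\<bar>cauchy_kernel' t\<bar> \<le> 2" for t
    using abs_arctan_le[of t] cauchy_kernel_bounds[of t] abs_cauchy_kernel'_le[of t] pi_less_4 by linarith+
  note int = integrable_mult_continuous[OF Y]
  have tp1: "test_potential (\<lambda>r. arctan (fst r)) (\<lambda>r. cauchy_kernel (fst r)) (\<lambda>r. 0)"
    using test_potential_tensor[where h="\<lambda>_. 1" and h'="\<lambda>_. 0", OF arctan_deriv _ pi(1,2) _ _ ck(1)] by simp
  have tp2: "test_potential (\<lambda>r. arctan (snd r)) (\<lambda>r. 0) (\<lambda>r. cauchy_kernel (snd r))"
    using test_potential_tensor[where g="\<lambda>_. 1" and g'="\<lambda>_. 0", OF _ arctan_deriv _ _ pi(1,2) _ ck(1)] by simp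
  have tp12: "test_potential (\<lambda>r. arctan (fst r) * arctan (snd r)) (\<lambda>r. cauchy_kernel (fst r) * arctan (snd r))
      (\<lambda>r. arctan (fst r) * cauchy_kernel (snd r))"
    by (rule test_potential_tensor[OF arctan_deriv arctan_deriv pi(1,2) pi(1,2) ck(1) ck(1)])
  have cc: "continuous_on UNIV (\<lambda>r. f (fst (r - t)) * g (snd (r - t)))" 
    "bounded (range (\<lambda>r. f (fst (r - t)) * g (snd (r - t))))"
    if "continuous_on UNIV f" "continuous_on UNIV g" "\<And>t. \<bar>f t\<bar> \<le> 2" "\<And>t. \<bar>g t\<bar> \<le> 2" for f g :: "real \<Rightarrow> real" and t :: "real \<times> real"
  proof -
    show "continuous_on UNIV (\<lambda>r. f (fst (r - t)) * g (snd (r - t)))"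
      by (intro continuous_intros continuous_on_compose2[OF that(1)] continuous_on_compose2[OF that(2)]; simp)
    have "\<bar>f (fst (r - t)) * g (snd (r - t))\<bar> \<le> 2 * 2" for r
      unfolding abs_mult by (intro mult_mono that) auto
    then show "bounded (range (\<lambda>r. f (fst (r - t)) * g (snd (r - t))))" by (rule boundedI_range_real)
  qed
  \<comment> \<open>Smoothed flux through a full line, obtained by testing with the arctangent of
    one coordinate.\<close>
  have line1: "(LINT \<omega>|M. Maa \<omega> * cauchy_kernel (fst (Y \<omega> - t))) \<le> pi / 2 * T" for t
    using H1[OF test_potential_affine[OF tp1, of 1 t], of "pi / 2"] abs_arctan_le by simp
  have line2: "(LINT \<omega>|M. Mbb \<omega> * cauchy_kernel (snd (Y \<omega> - t))) \<le> pi / 2 * T" for t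
    using H2[OF test_potential_affine[OF tp2, of 1 t], of "pi / 2"] abs_arctan_le by simp
  have ck_even: "cauchy_kernel (- t) = cauchy_kernel t" for t by (simp add: cauchy_kernel_def)
  \<comment> \<open>Mbb is nonnegative, so estimating arctan by pi/2 leaves the flux through a full
    line, already controlled.\<close>
  have conv22: "\<bar>convol kern M Y Mbb x\<bar> \<le> pi\<^sup>2 / 4 * T" for x
  proof -
    have "\<bar>convol kern M Y Mbb x\<bar> \<le> (LINT \<omega>|M. \<bar>kern (x - Y \<omega>) * Mbb \<omega>\<bar>)"
      unfolding convol_def by (rule integral_abs_bound)
    also have "\<dots> \<le> (LINT \<omega>|M. pi / 2 * (Mbb \<omega> * cauchy_kernel (snd (Y \<omega> - x))))"
    proof (rule integral_mono)
      show "integrable M (\<lambda>\<omega>. \<bar>kern (x - Y \<omega>) * Mbb \<omega>\<bar>)"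
        by (intro integrable_abs integrable_convol[OF kern_continuous(1) kern_lipschitz(5) Y m(4) b(4)])
      show "integrable M (\<lambda>\<omega>. pi / 2 * (Mbb \<omega> * cauchy_kernel (snd (Y \<omega> - x))))"
        using int[OF m(4) b(4) cc[of "\<lambda>_. 1" cauchy_kernel x]] ck pi by simp
      fix \<omega>
      have "\<bar>kern (x - Y \<omega>)\<bar> \<le> pi / 2 * cauchy_kernel (snd (Y \<omega> - x))"
        unfolding kern_def abs_mult using abs_arctan_le cauchy_kernel_bounds ck_even[of "snd (Y \<omega> - x)"]
        by (intro mult_mono) auto
      from mult_right_mono[OF this nn(2)[of \<omega>]]
      show "\<bar>kern (x - Y \<omega>) * Mbb \<omega>\<bar> \<le> pi / 2 * (Mbb \<omega> * cauchy_kernel (snd (Y \<omega> - x)))"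
        using nn(2)[of \<omega>] by (simp add: abs_mult mult_ac)
    qed
    also have "\<dots> \<le> pi / 2 * (pi / 2 * T)"
      using line2[of x] by (simp add: mult_left_mono)
    finally show ?thesis by (simp add: power2_eq_square)
  qed
  \<comment> \<open>Mab has no sign, so absolute values are useless here. The product of two
    arctangents, a smoothed quadrant, has a gradient that pairs Mab with the half-line kernel and
    Maa with the kernel of the other direction; for Maa the sign is available and
    \<open>line1\<close> applies.\<close>
  have conv12: "\<bar>convol kern M Y Mab x\<bar> \<le> pi\<^sup>2 / 2 * T" for x
  proof -
    let ?f = "\<lambda>\<omega>. Maa \<omega> * (cauchy_kernel (fst (Y \<omega> - x)) * arctan (snd (Y \<omega> - x)))"
    let ?g = "\<lambda>\<omega>. Mab \<omega> * (arctan (fst (Y \<omega> - x)) * cauchy_kernel (snd (Y \<omega> - x)))"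
    have i: "integrable M ?f" "integrable M ?g"
      using int[OF m(1) b(1) cc[of cauchy_kernel arctan x]] int[OF m(2) b(2) cc[of arctan cauchy_kernel x]] ck pi by simp_all
    have bd: "\<bar>arctan (fst (r - x)) * arctan (snd (r - x))\<bar> \<le> pi\<^sup>2 / 4" for r
    proof -
      have "\<bar>arctan (fst (r - x)) * arctan (snd (r - x))\<bar> \<le> (pi / 2) * (pi / 2)"
        unfolding abs_mult by (intro mult_mono abs_arctan_le) auto
      then show ?thesis by (simp add: power2_eq_square)
    qed
    have "\<bar>LINT \<omega>|M. ?f \<omega> + ?g \<omega>\<bar> \<le> pi\<^sup>2 / 4 * T"
      using H1[OF test_potential_affine[OF tp12, of 1 x], of "pi\<^sup>2 / 4"] bd by (simp del: split_paired_All)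
    moreover have "\<bar>LINT \<omega>|M. ?f \<omega>\<bar> \<le> pi\<^sup>2 / 4 * T"
    proof -
      have "\<bar>LINT \<omega>|M. ?f \<omega>\<bar> \<le> (LINT \<omega>|M. \<bar>?f \<omega>\<bar>)" by (rule integral_abs_bound)
      also have "\<dots> \<le> (LINT \<omega>|M. pi / 2 * (Maa \<omega> * cauchy_kernel (fst (Y \<omega> - x))))"
      proof (rule integral_mono)
        show "integrable M (\<lambda>\<omega>. \<bar>?f \<omega>\<bar>)" using i(1) by (rule integrable_abs)
        show "integrable M (\<lambda>\<omega>. pi / 2 * (Maa \<omega> * cauchy_kernel (fst (Y \<omega> - x))))"
          using int[OF m(1) b(1) cc[of cauchy_kernel "\<lambda>_. 1" x]] ck pi by simp
        fix \<omega>
        have "0 \<le> Maa \<omega> * cauchy_kernel (fst (Y \<omega> - x))" using nn(1) cauchy_kernel_bounds by simp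
        from mult_right_mono[OF abs_arctan_le[of "snd (Y \<omega> - x)"] this]
        show "\<bar>?f \<omega>\<bar> \<le> pi / 2 * (Maa \<omega> * cauchy_kernel (fst (Y \<omega> - x)))"
          using nn(1)[of \<omega>] cauchy_kernel_bounds(1) by (simp add: abs_mult mult_ac)
      qed
      also have "\<dots> \<le> pi / 2 * (pi / 2 * T)"
        using line1[of x] by (simp add: mult_left_mono)
      finally show ?thesis by (simp add: power2_eq_square)
    qed
    \<comment> \<open>Oddness of arctan turns Y \<omega> - x into x - Y \<omega> at the cost of a
      sign.\<close>
    moreover have "(LINT \<omega>|M. ?g \<omega>) = - convol kern M Y Mab x"
    proof -
      have "?g \<omega> = - (kern (x - Y \<omega>) * Mab \<omega>)" for \<omega>
        using ck_even[of "snd (Y \<omega> - x)"] arctan_minus[of "fst (Y \<omega> - x)"] by (simp add: kern_def)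
      then show ?thesis by (simp add: convol_def)
    qed
    moreover have "(LINT \<omega>|M. ?f \<omega> + ?g \<omega>) = (LINT \<omega>|M. ?f \<omega>) + (LINT \<omega>|M. ?g \<omega>)"
      using i by (rule Bochner_Integration.integral_add)
    ultimately have "\<bar>convol kern M Y Mab x\<bar> \<le> pi\<^sup>2 / 4 * T + pi\<^sup>2 / 4 * T" by linarith
    then show ?thesis by (simp add: mult.commute)
  qed
  have tc: "test_potential (convol kern M Y w) (convol kern1 M Y w) (convol kern2 M Y w)"
    if "w \<in> borel_measurable M" "\<And>\<omega>. \<bar>w \<omega>\<bar> \<le> B" for w
    by (rule test_potential_convol[OF kern_has_derivative kern_lipschitz(5,1,2,3,4) Y that])
  \<comment> \<open>\<open>divergence_bound\<close> asks for a strictly positive bound on the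
    potential.\<close>
  have p0: "0 < pi\<^sup>2 / 4 * T" "0 < pi\<^sup>2 / 2 * T" using T by simp_all
  let ?I = "\<lambda>f k g. LINT \<omega>|M. f \<omega> * convol k M Y g (Y \<omega>)"
  have i2: "integrable M (\<lambda>\<omega>. f \<omega> * convol kern1 M Y g (Y \<omega>))" "integrable M (\<lambda>\<omega>. f \<omega> * convol kern2 M Y g (Y \<omega>))"
    if "f \<in> borel_measurable M" "\<And>\<omega>. \<bar>f \<omega>\<bar> \<le> B" "g \<in> borel_measurable M" "\<And>\<omega>. \<bar>g \<omega>\<bar> \<le> B" for f g
    using int[OF that(1,2)] tc[OF that(3,4)] by (auto simp: test_potential_def)
  have "\<bar>?I Maa kern1 Mbb + ?I Mab kern2 Mbb\<bar> \<le> (pi\<^sup>2 / 4 * T) * T"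
    using H1[OF tc[OF m(4) b(4)] p0(1)] conv22 i2[OF m(1) b(1) m(4) b(4)] i2[OF m(2) b(2) m(4) b(4)] by simp
  moreover have "\<bar>?I Mba kern1 Mab + ?I Mbb kern2 Mab\<bar> \<le> (pi\<^sup>2 / 2 * T) * T"
    using H2[OF tc[OF m(2) b(2)] p0(2)] conv12 i2[OF m(3) b(3) m(2) b(2)] i2[OF m(4) b(4) m(2) b(2)] by simp
  moreover have "?I Mab kern2 Mbb = ?I Mbb kern2 Mab"
    by (rule integral_convol_commute[OF kern_continuous(3) kern_lipschitz(4) kern_minus(2) Y m(2,4) b(2,4)])
  ultimately have "?I Maa kern1 Mbb - ?I Mba kern1 Mab \<le> (pi\<^sup>2 / 4 * T) * T + (pi\<^sup>2 / 2 * T) * T"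
    by linarith
  then show ?thesis by (simp add: power2_eq_square mult_ac)
qed

text \<open>\<open>disc\<close> holds for every pair of points and can be integrated in both
  variables against the nonnegative \<open>kern1\<close>. Evenness of \<open>kern1\<close> makes the
  four terms on the right coincide in pairs, which cancels the factor 2.\<close>

lemma quadratic_kernel_estimate:
  assumes Y: "Y \<in> borel_measurable M"
    and m: "Maa \<in> borel_measurable M" "Mab \<in> borel_measurable M" "Mba \<in> borel_measurable M" "Mbb \<in> borel_measurable M"
    and b: "\<And>\<omega>. \<bar>Maa \<omega>\<bar> \<le> B" "\<And>\<omega>. \<bar>Mab \<omega>\<bar> \<le> B" "\<And>\<omega>. \<bar>Mba \<omega>\<bar> \<le> B" "\<And>\<omega>. \<bar>Mbb \<omega>\<bar> \<le> B"
    and nn: "\<And>\<omega>. 0 \<le> Maa \<omega>" "\<And>\<omega>. 0 \<le> Mbb \<omega>"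
    and H: "divergence_bound M Y T Maa Mab" "divergence_bound M Y T Mba Mbb" and T: "0 < T"
    and c: "c \<in> borel_measurable M" "\<And>\<omega>. \<bar>c \<omega>\<bar> \<le> B"
    and disc: "\<And>\<omega> \<omega>'. 2 * (c \<omega> * c \<omega>') \<le> Maa \<omega> * Mbb \<omega>' + Mbb \<omega> * Maa \<omega>' - Mab \<omega> * Mba \<omega>' - Mba \<omega> * Mab \<omega>'"
  shows "(LINT \<omega>|M. c \<omega> * convol kern1 M Y c (Y \<omega>)) \<le> 3 * pi\<^sup>2 / 4 * T\<^sup>2"
proof -
  let ?I = "\<lambda>f g. LINT \<omega>|M. f \<omega> * convol kern1 M Y g (Y \<omega>)"
  have k: "integrable M (\<lambda>\<omega>. kern1 (x - Y \<omega>) * w \<omega>)" if "w \<in> borel_measurable M" "\<And>\<omega>. \<bar>w \<omega>\<bar> \<le> B" for w x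
    by (rule integrable_convol[OF kern_continuous(2) kern_lipschitz(2) Y that])
  have i: "integrable M (\<lambda>\<omega>. f \<omega> * convol kern1 M Y g (Y \<omega>))"
    if "f \<in> borel_measurable M" "\<And>\<omega>. \<bar>f \<omega>\<bar> \<le> B" "g \<in> borel_measurable M" "\<And>\<omega>. \<bar>g \<omega>\<bar> \<le> B" for f g
    by (rule integrable_mult_continuous[OF Y that(1,2) convol_lipschitz_continuous[OF kern_lipschitz(1,2) Y that(3,4)]])
  note ii = i[OF m(1) b(1) m(4) b(4)] i[OF m(4) b(4) m(1) b(1)] i[OF m(2) b(2) m(3) b(3)] i[OF m(3) b(3) m(2) b(2)]
  have "2 * ?I c c = (LINT \<omega>|M. 2 * (c \<omega> * convol kern1 M Y c (Y \<omega>)))" by simp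
  also have "\<dots> \<le> (LINT \<omega>|M. Maa \<omega> * convol kern1 M Y Mbb (Y \<omega>) + Mbb \<omega> * convol kern1 M Y Maa (Y \<omega>)
     - Mab \<omega> * convol kern1 M Y Mba (Y \<omega>) - Mba \<omega> * convol kern1 M Y Mab (Y \<omega>))"
  proof (rule integral_mono)
    show "integrable M (\<lambda>\<omega>. 2 * (c \<omega> * convol kern1 M Y c (Y \<omega>)))" using i[OF c c] by simp
    show "integrable M (\<lambda>\<omega>. Maa \<omega> * convol kern1 M Y Mbb (Y \<omega>) + Mbb \<omega> * convol kern1 M Y Maa (Y \<omega>)
     - Mab \<omega> * convol kern1 M Y Mba (Y \<omega>) - Mba \<omega> * convol kern1 M Y Mab (Y \<omega>))" using ii by simp
    fix \<omega>
    let ?k = "\<lambda>\<omega>'. kern1 (Y \<omega> - Y \<omega>')"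
    have "2 * (c \<omega> * convol kern1 M Y c (Y \<omega>)) = (LINT \<omega>'|M. 2 * c \<omega> * (?k \<omega>' * c \<omega>'))"
      unfolding convol_def by simp
    also have "\<dots> \<le> (LINT \<omega>'|M. Maa \<omega> * (?k \<omega>' * Mbb \<omega>') + Mbb \<omega> * (?k \<omega>' * Maa \<omega>')
       - Mab \<omega> * (?k \<omega>' * Mba \<omega>') - Mba \<omega> * (?k \<omega>' * Mab \<omega>'))"
    proof (rule integral_mono)
      fix \<omega>'
      have "0 \<le> ?k \<omega>'" using cauchy_kernel_bounds by (simp add: kern1_def)
      from mult_left_mono[OF disc this]
      show "2 * c \<omega> * (?k \<omega>' * c \<omega>') \<le> Maa \<omega> * (?k \<omega>' * Mbb \<omega>') + Mbb \<omega> * (?k \<omega>' * Maa \<omega>')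
       - Mab \<omega> * (?k \<omega>' * Mba \<omega>') - Mba \<omega> * (?k \<omega>' * Mab \<omega>')" by (simp add: algebra_simps)
    qed (use k[OF c] k[OF m(1) b(1)] k[OF m(2) b(2)] k[OF m(3) b(3)] k[OF m(4) b(4)] in simp_all)
    also have "\<dots> = Maa \<omega> * convol kern1 M Y Mbb (Y \<omega>) + Mbb \<omega> * convol kern1 M Y Maa (Y \<omega>)
     - Mab \<omega> * convol kern1 M Y Mba (Y \<omega>) - Mba \<omega> * convol kern1 M Y Mab (Y \<omega>)"
      unfolding convol_def using k[OF m(1) b(1)] k[OF m(2) b(2)] k[OF m(3) b(3)] k[OF m(4) b(4)] by simp
    finally show "2 * (c \<omega> * convol kern1 M Y c (Y \<omega>)) \<le> Maa \<omega> * convol kern1 M Y Mbb (Y \<omega>) + Mbb \<omega> * convol kern1 M Y Maa (Y \<omega>)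
     - Mab \<omega> * convol kern1 M Y Mba (Y \<omega>) - Mba \<omega> * convol kern1 M Y Mab (Y \<omega>)" .
  qed
  also have "\<dots> = ?I Maa Mbb + ?I Mbb Maa - ?I Mab Mba - ?I Mba Mab" using ii by simp
  also have "\<dots> = 2 * (?I Maa Mbb - ?I Mba Mab)"
    using integral_convol_commute[OF kern_continuous(2) kern_lipschitz(2) kern_minus(1) Y m(1,4) b(1,4)]
      integral_convol_commute[OF kern_continuous(2) kern_lipschitz(2) kern_minus(1) Y m(2,3) b(2,3)] by simp
  also have "?I Maa Mbb - ?I Mba Mab \<le> 3 * pi\<^sup>2 / 4 * T\<^sup>2"
    by (rule bilinear_kernel_estimate[OF Y m b nn H T])
  finally show ?thesis by linarith
qed

end

section \<open>From correlations at small scales to a square integrable density\<close>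

definition small_box :: "real \<Rightarrow> (real \<times> real) set" where
  "small_box e = {r. \<bar>fst r\<bar> \<le> e \<and> \<bar>snd r\<bar> \<le> e}"

lemma small_box_eq_Times: "small_box e = {-e..e} \<times> {-e..e}"
  by (auto simp: small_box_def)

lemma small_box_measurable [measurable]: "small_box e \<in> sets borel"
  unfolding small_box_eq_Times by (intro borel_closed closed_Times) auto

lemma emeasure_small_box:
  assumes "0 \<le> e"
  shows "emeasure lborel {y. z - y \<in> small_box e} = ennreal (4 * e\<^sup>2)"
proof -
  have "emeasure lborel {y. z - y \<in> small_box e}
      = emeasure (lborel \<Otimes>\<^sub>M lborel) ({fst z - e..fst z + e} \<times> {snd z - e..snd z + e})"
    unfolding lborel_prod by (rule arg_cong[where f="emeasure lborel"]) (auto simp: small_box_def)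
  also have "\<dots> = emeasure lborel {fst z - e..fst z + e} * emeasure lborel {snd z - e..snd z + e}"
    by (intro lborel.emeasure_pair_measure_Times) auto
  also have "\<dots> = ennreal (4 * e\<^sup>2)"
    using assms by (simp add: ennreal_mult[symmetric] power2_eq_square)
  finally show ?thesis .
qed

text \<open>
  A finite measure on the plane whose correlation integral at scale \<open>e\<close> is \<open>O(e\<^sup>2)\<close> has a square
  integrable density; the conclusion is the resulting Cauchy-Schwarz bound.
\<close>

lemma correlation_bound_emeasure_open:
  fixes \<mu> :: "(real \<times> real) measure"
  assumes fin: "finite_measure \<mu>" and sets_mu [measurable_cong, simp]: "sets \<mu> = sets borel"
    and K0: "0 \<le> K"
    and K: "\<And>e. 0 < e \<Longrightarrow> (\<integral>\<^sup>+x. \<integral>\<^sup>+y. indicator (small_box e) (x - y) \<partial>\<mu> \<partial>\<mu>) \<le> ennreal (K * e\<^sup>2)"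
    and U: "open U"
  shows "(emeasure \<mu> U)\<^sup>2 \<le> ennreal K * emeasure lborel U"
proof -
  interpret finite_measure \<mu> by fact
  interpret P: pair_sigma_finite lborel \<mu> ..
  interpret Q: pair_sigma_finite \<mu> \<mu> ..
  have Um [measurable]: "U \<in> sets borel" using U by simp
  define b :: "real \<Rightarrow> (real \<times> real) \<Rightarrow> ennreal" where "b e r = indicator (small_box e) r" for e r
  have b_m [measurable]: "b e \<in> borel_measurable borel" for e unfolding b_def by measurable
  have b_sq: "b e r * b e r = b e r" for e r by (auto simp: b_def indicator_def)
  have bint: "(\<integral>\<^sup>+y. b e (z - y) \<partial>lborel) = ennreal (4 * e\<^sup>2)" if "0 \<le> e" for e z
  proof -
    have "(\<integral>\<^sup>+y. b e (z - y) \<partial>lborel) = (\<integral>\<^sup>+y. indicator {y. z - y \<in> small_box e} y \<partial>lborel)"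
      by (intro nn_integral_cong) (simp add: b_def indicator_def)
    also have "\<dots> = emeasure lborel {y. z - y \<in> small_box e}"
    proof (rule nn_integral_indicator)
      have "{y \<in> space borel. z - y \<in> small_box e} \<in> sets borel" by measurable
      then show "{y. z - y \<in> small_box e} \<in> sets lborel" by simp
    qed
    finally show ?thesis using emeasure_small_box[OF that] by simp
  qed
  \<comment> \<open>Unnormalised box averages of the indicator of U.\<close>
  define g where "g e z = (\<integral>\<^sup>+y. indicator U y * b e (z - y) \<partial>lborel)" for e z
  have g_m [measurable]: "g e \<in> borel_measurable \<mu>" for e unfolding g_def by measurable
  have main: "(\<integral>\<^sup>+z. g e z \<partial>\<mu>)\<^sup>2 \<le> ennreal (16 * e ^ 4) * (ennreal K * emeasure lborel U)" if e: "0 < e" for e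
  proof -
    \<comment> \<open>Up to the factor 4 e^2, a mollified density of \<mu>. Fubini moves the
      mollification from U to \<mu>, and the L^2 norm of m expands into a correlation
      integral.\<close>
    define m where "m y = (\<integral>\<^sup>+z. b e (z - y) \<partial>\<mu>)" for y
    have m_m [measurable]: "m \<in> borel_measurable lborel" unfolding m_def by measurable
    have "(\<integral>\<^sup>+z. g e z \<partial>\<mu>) = (\<integral>\<^sup>+y. (\<integral>\<^sup>+z. indicator U y * b e (z - y) \<partial>\<mu>) \<partial>lborel)"
      unfolding g_def by (rule P.Fubini') measurable
    also have "\<dots> = (\<integral>\<^sup>+y. indicator U y * m y \<partial>lborel)"
      unfolding m_def by (intro nn_integral_cong nn_integral_cmult) measurable
    finally have "(\<integral>\<^sup>+z. g e z \<partial>\<mu>)\<^sup>2 \<le> (\<integral>\<^sup>+y. (indicator U y)\<^sup>2 \<partial>lborel) * (\<integral>\<^sup>+y. (m y)\<^sup>2 \<partial>lborel)"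
      using Cauchy_Schwarz_nn_integral[of "indicator U" lborel m] by simp
    also have "(\<integral>\<^sup>+y. (indicator U y)\<^sup>2 \<partial>lborel) = (\<integral>\<^sup>+y. indicator U y \<partial>lborel)"
      by (intro nn_integral_cong) (simp add: indicator_def)
    also have "\<dots> = emeasure lborel U" by simp
    finally have sq: "(\<integral>\<^sup>+z. g e z \<partial>\<mu>)\<^sup>2 \<le> emeasure lborel U * (\<integral>\<^sup>+y. (m y)\<^sup>2 \<partial>lborel)" .
    have "(\<integral>\<^sup>+y. (m y)\<^sup>2 \<partial>lborel) = (\<integral>\<^sup>+y. \<integral>\<^sup>+z. \<integral>\<^sup>+z'. b e (z - y) * b e (z' - y) \<partial>\<mu> \<partial>\<mu> \<partial>lborel)"
    proof (rule nn_integral_cong)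
      fix y
      have "(m y)\<^sup>2 = (\<integral>\<^sup>+z. b e (z - y) * m y \<partial>\<mu>)"
        unfolding m_def power2_eq_square by (rule nn_integral_multc[symmetric]) measurable
      also have "\<dots> = (\<integral>\<^sup>+z. \<integral>\<^sup>+z'. b e (z - y) * b e (z' - y) \<partial>\<mu> \<partial>\<mu>)"
        unfolding m_def by (intro nn_integral_cong nn_integral_cmult[symmetric]) measurable
      finally show "(m y)\<^sup>2 = (\<integral>\<^sup>+z. \<integral>\<^sup>+z'. b e (z - y) * b e (z' - y) \<partial>\<mu> \<partial>\<mu>)" .
    qed
    also have "\<dots> = (\<integral>\<^sup>+z. \<integral>\<^sup>+y. \<integral>\<^sup>+z'. b e (z - y) * b e (z' - y) \<partial>\<mu> \<partial>lborel \<partial>\<mu>)"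
      by (rule P.Fubini'[symmetric]) measurable
    also have "\<dots> = (\<integral>\<^sup>+z. \<integral>\<^sup>+z'. \<integral>\<^sup>+y. b e (z - y) * b e (z' - y) \<partial>lborel \<partial>\<mu> \<partial>\<mu>)"
      by (intro nn_integral_cong P.Fubini'[symmetric]) measurable
    \<comment> \<open>Two boxes of half-width e meet only if their centres differ by at most 2 e in
      each coordinate, and the overlap has at most the area 4 e^2 of one box.\<close>
    also have "\<dots> \<le> (\<integral>\<^sup>+z. \<integral>\<^sup>+z'. ennreal (4 * e\<^sup>2) * b (2 * e) (z - z') \<partial>\<mu> \<partial>\<mu>)"
    proof (intro nn_integral_mono)
      fix z z'
      have "(\<integral>\<^sup>+y. b e (z - y) * b e (z' - y) \<partial>lborel) \<le> (\<integral>\<^sup>+y. b (2 * e) (z - z') * b e (z - y) \<partial>lborel)"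
      proof (rule nn_integral_mono)
        fix y
        have "z - z' \<in> small_box (2 * e)" if "z - y \<in> small_box e" "z' - y \<in> small_box e"
          using that by (auto simp: small_box_def)
        then show "b e (z - y) * b e (z' - y) \<le> b (2 * e) (z - z') * b e (z - y)"
          by (auto simp: b_def indicator_def)
      qed
      also have "\<dots> = b (2 * e) (z - z') * ennreal (4 * e\<^sup>2)"
        using bint[of e z] e by (subst nn_integral_cmult) auto
      finally show "(\<integral>\<^sup>+y. b e (z - y) * b e (z' - y) \<partial>lborel) \<le> ennreal (4 * e\<^sup>2) * b (2 * e) (z - z')"
        by (simp add: mult.commute)
    qed
    also have "\<dots> = ennreal (4 * e\<^sup>2) * (\<integral>\<^sup>+z. \<integral>\<^sup>+z'. b (2 * e) (z - z') \<partial>\<mu> \<partial>\<mu>)"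
      by (simp add: nn_integral_cmult)
    also have "\<dots> \<le> ennreal (4 * e\<^sup>2) * ennreal (K * (2 * e)\<^sup>2)"
      using K[of "2 * e"] e unfolding b_def by (intro mult_left_mono) auto
    also have "\<dots> = ennreal (16 * e ^ 4) * ennreal K"
      using K0 e by (simp add: ennreal_mult'[symmetric] power_mult_distrib power2_eq_square power4_eq_xxxx mult_ac)
    finally have "(\<integral>\<^sup>+y. (m y)\<^sup>2 \<partial>lborel) \<le> ennreal (16 * e ^ 4) * ennreal K" .
    note order_trans[OF sq mult_left_mono[OF this zero_le]]
    then show ?thesis by (simp only: mult_ac)
  qed
  \<comment> \<open>Division by the box area gives genuine averages; the square of this factor
    cancels 16 e^4, so the bound on the integrals does not depend on n.\<close>
  define h where "h n z = g (1 / Suc n) z * ennreal (1 / (4 * (1 / Suc n)\<^sup>2))" for n :: nat and z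
  have h_m [measurable]: "h n \<in> borel_measurable \<mu>" for n unfolding h_def by measurable
  have h_bound: "(\<integral>\<^sup>+z. h n z \<partial>\<mu>)\<^sup>2 \<le> ennreal K * emeasure lborel U" for n
  proof -
    define e where "e = 1 / real (Suc n)"
    have e: "0 < e" by (simp add: e_def)
    have "(\<integral>\<^sup>+z. h n z \<partial>\<mu>) = (\<integral>\<^sup>+z. g e z \<partial>\<mu>) * ennreal (1 / (4 * e\<^sup>2))"
      unfolding h_def e_def by (rule nn_integral_multc) measurable
    then have "(\<integral>\<^sup>+z. h n z \<partial>\<mu>)\<^sup>2 = (\<integral>\<^sup>+z. g e z \<partial>\<mu>)\<^sup>2 * (ennreal (1 / (4 * e\<^sup>2)))\<^sup>2"
      by (simp add: power_mult_distrib)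
    also have "\<dots> \<le> (ennreal (16 * e ^ 4) * (ennreal K * emeasure lborel U)) * ennreal (1 / (16 * e ^ 4))"
    proof (rule mult_mono[OF main[OF e]])
      have "(1 / (4 * e\<^sup>2))\<^sup>2 = 1 / (16 * e ^ 4)"
        by (simp add: power2_eq_square power4_eq_xxxx)
      then show "(ennreal (1 / (4 * e\<^sup>2)))\<^sup>2 \<le> ennreal (1 / (16 * e ^ 4))"
        by (simp add: ennreal_power)
    qed auto
    also have "\<dots> = (ennreal (16 * e ^ 4) * ennreal (1 / (16 * e ^ 4))) * (ennreal K * emeasure lborel U)"
      by (simp only: mult_ac)
    also have "ennreal (16 * e ^ 4) * ennreal (1 / (16 * e ^ 4)) = 1"
      using e by (subst ennreal_mult[symmetric]) auto
    finally show ?thesis by simp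
  qed
  \<comment> \<open>Near a point of the open set U all small boxes lie inside U, so the averages are
    eventually 1; elsewhere nonnegativity suffices. Fatou's lemma then passes to the limit.\<close>
  have "indicator U z \<le> liminf (\<lambda>n. h n z)" for z
  proof (cases "z \<in> U")
    case True
    obtain d where d: "0 < d" "ball z d \<subseteq> U" using U True openE by blast
    have "\<forall>\<^sub>F n in sequentially. 1 \<le> h n z"
    proof -
      obtain N where N: "2 / d < real (Suc N)" using reals_Archimedean2 less_trans of_nat_less_iff lessI by metis
      show ?thesis unfolding eventually_sequentially
      proof (intro exI[of _ N] allI impI)
        fix n assume n: "N \<le> n"
        define e where "e = 1 / real (Suc n)"
        have e: "0 < e" by (simp add: e_def)
        have ed: "2 * e < d" 
        proof -
          have "2 / d < real (Suc n)" using N n by (meson less_le_trans of_nat_le_iff Suc_le_mono)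
          then show ?thesis using d by (simp add: e_def divide_simps mult.commute)
        qed
        have "y \<in> U" if "z - y \<in> small_box e" for y
        proof -
          have "dist z y \<le> dist (fst z) (fst y) + dist (snd z) (snd y)"
            by (simp add: dist_prod_def sqrt_sum_squares_le_sum)
          also have "\<dots> \<le> e + e" using that by (intro add_mono) (auto simp: small_box_def dist_real_def)
          finally show ?thesis using ed d by (auto simp: subset_eq)
        qed
        then have "g e z = (\<integral>\<^sup>+y. b e (z - y) \<partial>lborel)"
          unfolding g_def by (intro nn_integral_cong) (auto simp: b_def indicator_def)
        then have "h n z = ennreal (4 * e\<^sup>2) * ennreal (1 / (4 * e\<^sup>2))"
          using bint[of e z] e by (simp add: h_def e_def)
        also have "\<dots> = 1" using e by (subst ennreal_mult[symmetric]) auto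
        finally show "1 \<le> h n z" by simp
      qed
    qed
    then show ?thesis using True by (simp add: Liminf_bounded)
  qed simp
  then have "(\<integral>\<^sup>+z. indicator U z \<partial>\<mu>) \<le> (\<integral>\<^sup>+z. liminf (\<lambda>n. h n z) \<partial>\<mu>)"
    by (rule nn_integral_mono)
  also have "\<dots> \<le> liminf (\<lambda>n. \<integral>\<^sup>+z. h n z \<partial>\<mu>)"
    by (rule nn_integral_liminf) measurable
  finally have le: "emeasure \<mu> U \<le> liminf (\<lambda>n. \<integral>\<^sup>+z. h n z \<partial>\<mu>)" by simp
  show ?thesis
  proof (cases "ennreal K * emeasure lborel U" rule: ennreal_cases)
    case (real r)
    have "(\<integral>\<^sup>+z. h n z \<partial>\<mu>) \<le> ennreal (sqrt r)" for n
    proof (cases "\<integral>\<^sup>+z. h n z \<partial>\<mu>" rule: ennreal_cases)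
      case (real t)
      then show ?thesis
        using h_bound[of n] \<open>0 \<le> r\<close> \<open>ennreal K * emeasure lborel U = ennreal r\<close>
        by (simp add: ennreal_power ennreal_le_iff real_le_rsqrt)
    next
      case top
      then show ?thesis
        using h_bound[of n] \<open>ennreal K * emeasure lborel U = ennreal r\<close> by (simp add: top_unique power2_eq_square)
    qed
    then have "liminf (\<lambda>n. \<integral>\<^sup>+z. h n z \<partial>\<mu>) \<le> ennreal (sqrt r)"
      by (intro Liminf_le always_eventually allI sequentially_bot)
    with le have "emeasure \<mu> U \<le> ennreal (sqrt r)" by (rule order_trans)
    then have "(emeasure \<mu> U)\<^sup>2 \<le> (ennreal (sqrt r))\<^sup>2" by (intro power_mono) auto
    then show ?thesis using real by (simp add: ennreal_power)
  qed simp
qed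

context finite_measure
begin

text \<open>Dilating the plane by 1/e turns the estimate for the fixed kernel \<open>kern1\<close>
  into a correlation bound at scale e.\<close>

lemma planar_square_bound:
  assumes Y [measurable]: "Y \<in> borel_measurable M"
    and m: "Maa \<in> borel_measurable M" "Mab \<in> borel_measurable M" "Mba \<in> borel_measurable M" "Mbb \<in> borel_measurable M"
    and b: "\<And>\<omega>. \<bar>Maa \<omega>\<bar> \<le> B" "\<And>\<omega>. \<bar>Mab \<omega>\<bar> \<le> B" "\<And>\<omega>. \<bar>Mba \<omega>\<bar> \<le> B" "\<And>\<omega>. \<bar>Mbb \<omega>\<bar> \<le> B"
    and nn: "\<And>\<omega>. 0 \<le> Maa \<omega>" "\<And>\<omega>. 0 \<le> Mbb \<omega>"
    and H: "divergence_bound M Y T Maa Mab" "divergence_bound M Y T Mba Mbb" and T: "0 < T"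
    and c [measurable]: "c \<in> borel_measurable M" and cb: "\<And>\<omega>. \<bar>c \<omega>\<bar> \<le> B" "\<And>\<omega>. 0 \<le> c \<omega>"
    and disc: "\<And>\<omega> \<omega>'. 2 * (c \<omega> * c \<omega>') \<le> Maa \<omega> * Mbb \<omega>' + Mbb \<omega> * Maa \<omega>' - Mab \<omega> * Mba \<omega>' - Mba \<omega> * Mab \<omega>'"
    and U: "open U"
  shows "(emeasure (distr (density M c) borel Y) U)\<^sup>2 \<le> ennreal (3 * pi\<^sup>2 * T\<^sup>2) * emeasure lborel U"
proof (rule correlation_bound_emeasure_open[OF _ _ _ _ U])
  let ?\<mu> = "distr (density M c) borel Y"
  have Yd [measurable]: "Y \<in> measurable (density M c) borel" by simp
  have "emeasure (density M c) (space M) = (\<integral>\<^sup>+\<omega>. ennreal (c \<omega>) \<partial>M)"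
    by (simp add: emeasure_density cong: nn_integral_cong)
  also have "\<dots> \<le> (\<integral>\<^sup>+\<omega>. ennreal B \<partial>M)"
    using cb by (intro nn_integral_mono ennreal_leI) (metis abs_of_nonneg)
  also have "\<dots> < \<infinity>" by (simp add: ennreal_mult_eq_top_iff less_top[symmetric])
  finally interpret D: finite_measure "density M c" by (intro finite_measureI) simp
  show "finite_measure ?\<mu>" by (rule D.finite_measure_distr) simp
  show "sets ?\<mu> = sets borel" "0 \<le> 3 * pi\<^sup>2 * T\<^sup>2" by simp_all
  fix e :: real assume e: "0 < e"
  define s where "s = 1 / e"
  have s: "0 < s" using e by (simp add: s_def)
  \<comment> \<open>The chain rule produces a factor s while the supremum of the potential is
    unchanged.\<close>
  have sc: "divergence_bound M (\<lambda>\<omega>. s *\<^sub>R Y \<omega>) (T / s) f g" if "divergence_bound M Y T f g" for f g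
    unfolding divergence_bound_def
  proof (intro allI impI)
    fix u u1 u2 :: "real \<times> real \<Rightarrow> real" and K :: real
    assume u: "test_potential u u1 u2 \<and> 0 < K \<and> (\<forall>r. \<bar>u r\<bar> \<le> K)"
    have eq: "(LINT \<omega>|M. f \<omega> * (s * u1 (s *\<^sub>R Y \<omega>)) + g \<omega> * (s * u2 (s *\<^sub>R Y \<omega>)))
      = (LINT \<omega>|M. s * (f \<omega> * u1 (s *\<^sub>R Y \<omega>) + g \<omega> * u2 (s *\<^sub>R Y \<omega>)))"
      by (simp add: algebra_simps)
    have "\<bar>LINT \<omega>|M. f \<omega> * (s * u1 (s *\<^sub>R Y \<omega>)) + g \<omega> * (s * u2 (s *\<^sub>R Y \<omega>))\<bar> \<le> K * T"
    proof -
      have "test_potential (\<lambda>r. u (s *\<^sub>R r)) (\<lambda>r. s * u1 (s *\<^sub>R r)) (\<lambda>r. s * u2 (s *\<^sub>R r))"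
        using test_potential_affine[of u u1 u2 s 0] u by simp
      then show ?thesis using that[unfolded divergence_bound_def] u by blast
    qed
    then show "\<bar>LINT \<omega>|M. f \<omega> * u1 (s *\<^sub>R Y \<omega>) + g \<omega> * u2 (s *\<^sub>R Y \<omega>)\<bar> \<le> K * (T / s)"
      unfolding eq using s by (simp add: abs_mult pos_le_divide_eq mult.commute)
  qed
  let ?Y = "\<lambda>\<omega>. s *\<^sub>R Y \<omega>"
  have Ym: "?Y \<in> borel_measurable M" by measurable
  have est: "(LINT \<omega>|M. c \<omega> * convol kern1 M ?Y c (?Y \<omega>)) \<le> 3 * pi\<^sup>2 / 4 * (T / s)\<^sup>2"
    by (rule quadratic_kernel_estimate[OF Ym m b nn sc[OF H(1)] sc[OF H(2)] _ c cb(1) disc]) (use T s in simp)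
  have k1: "0 \<le> kern1 r" for r using cauchy_kernel_bounds by (simp add: kern1_def)
  have kint: "integrable M (\<lambda>\<omega>'. kern1 (x - ?Y \<omega>') * c \<omega>')" for x
    by (rule integrable_convol[OF kern_continuous(2) kern_lipschitz(2) Ym c cb(1)])
  \<comment> \<open>Each Cauchy factor is at least 1/2 on [-1, 1]. The resulting 4 turns 3 pi^2 / 4
    into the constant 3 pi^2 of the conclusion.\<close>
  have box: "indicator (small_box e) (Y \<omega> - Y \<omega>') \<le> ennreal (4 * kern1 (?Y \<omega> - ?Y \<omega>'))" for \<omega> \<omega>'
  proof (cases "Y \<omega> - Y \<omega>' \<in> small_box e")
    case True
    have half: "1 / 2 \<le> cauchy_kernel (s * t)" if "\<bar>t\<bar> \<le> e" for t
    proof -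
      have "\<bar>s * t\<bar> \<le> 1" using that e by (simp add: s_def abs_mult field_simps)
      then have "(s * t)\<^sup>2 \<le> 1" using abs_square_le_1 by blast
      then show ?thesis using one_plus_square_pos[of "s * t"] by (simp add: cauchy_kernel_def field_simps)
    qed
    have "1 / 2 * (1 / 2) \<le> kern1 (s *\<^sub>R (Y \<omega> - Y \<omega>'))"
      unfolding kern1_def using True half
      by (intro mult_mono) (auto simp: small_box_def cauchy_kernel_bounds simp flip: right_diff_distrib)
    then have "1 \<le> 4 * kern1 (?Y \<omega> - ?Y \<omega>')" by (simp add: scaleR_diff_right)
    then show ?thesis using True by (simp add: ennreal_1[symmetric] del: ennreal_1)
  qed simp
  have "(\<integral>\<^sup>+x. \<integral>\<^sup>+y. indicator (small_box e) (x - y) \<partial>?\<mu> \<partial>?\<mu>)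
     = (\<integral>\<^sup>+\<omega>. ennreal (c \<omega>) * (\<integral>\<^sup>+\<omega>'. ennreal (c \<omega>') * indicator (small_box e) (Y \<omega> - Y \<omega>') \<partial>M) \<partial>M)"
  proof -
    have "(\<integral>\<^sup>+y. indicator (small_box e) (x - y) \<partial>?\<mu>)
      = (\<integral>\<^sup>+\<omega>'. ennreal (c \<omega>') * indicator (small_box e) (x - Y \<omega>') \<partial>M)" for x
    proof -
      have [measurable]: "(\<lambda>y. indicator (small_box e) (x - y) :: ennreal) \<in> borel_measurable borel" by measurable
      show ?thesis by (simp add: nn_integral_distr nn_integral_density)
    qed
    moreover have "(\<lambda>x. \<integral>\<^sup>+\<omega>'. ennreal (c \<omega>') * indicator (small_box e) (x - Y \<omega>') \<partial>M) \<in> borel_measurable borel"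
      by measurable
    ultimately show ?thesis by (simp add: nn_integral_distr nn_integral_density)
  qed
  also have "\<dots> \<le> (\<integral>\<^sup>+\<omega>. ennreal (c \<omega>) * ennreal (4 * convol kern1 M ?Y c (?Y \<omega>)) \<partial>M)"
  proof (intro nn_integral_mono mult_left_mono)
    fix \<omega>
    have "(\<integral>\<^sup>+\<omega>'. ennreal (c \<omega>') * indicator (small_box e) (Y \<omega> - Y \<omega>') \<partial>M)
      \<le> (\<integral>\<^sup>+\<omega>'. ennreal (4 * (kern1 (?Y \<omega> - ?Y \<omega>') * c \<omega>')) \<partial>M)"
    proof (rule nn_integral_mono)
      fix \<omega>'
      have "ennreal (c \<omega>') * indicator (small_box e) (Y \<omega> - Y \<omega>') \<le> ennreal (c \<omega>') * ennreal (4 * kern1 (?Y \<omega> - ?Y \<omega>'))"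
        by (intro mult_left_mono box) simp
      also have "\<dots> = ennreal (4 * (kern1 (?Y \<omega> - ?Y \<omega>') * c \<omega>'))"
        using cb k1 by (simp add: ennreal_mult[symmetric] mult_ac)
      finally show "ennreal (c \<omega>') * indicator (small_box e) (Y \<omega> - Y \<omega>') \<le> ennreal (4 * (kern1 (?Y \<omega> - ?Y \<omega>') * c \<omega>'))" .
    qed
    also have "\<dots> = ennreal (LINT \<omega>'|M. 4 * (kern1 (?Y \<omega> - ?Y \<omega>') * c \<omega>'))"
      using kint cb k1 by (intro nn_integral_eq_integral) auto
    finally show "(\<integral>\<^sup>+\<omega>'. ennreal (c \<omega>') * indicator (small_box e) (Y \<omega> - Y \<omega>') \<partial>M)
       \<le> ennreal (4 * convol kern1 M ?Y c (?Y \<omega>))" by (simp add: convol_def)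
  qed simp
  also have "\<dots> = (\<integral>\<^sup>+\<omega>. ennreal (4 * (c \<omega> * convol kern1 M ?Y c (?Y \<omega>))) \<partial>M)"
    using cb by (intro nn_integral_cong) (simp add: ennreal_mult'[symmetric] mult_ac)
  also have "\<dots> = ennreal (LINT \<omega>|M. 4 * (c \<omega> * convol kern1 M ?Y c (?Y \<omega>)))"
  proof (rule nn_integral_eq_integral)
    show "integrable M (\<lambda>\<omega>. 4 * (c \<omega> * convol kern1 M ?Y c (?Y \<omega>)))"
      using integrable_mult_continuous[OF Ym c cb(1) convol_lipschitz_continuous[OF kern_lipschitz(1,2) Ym c cb(1)]] by simp
    have "0 \<le> convol kern1 M ?Y c x" for x
      unfolding convol_def using k1 cb by (intro Bochner_Integration.integral_nonneg mult_nonneg_nonneg) auto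
    then show "AE \<omega> in M. 0 \<le> 4 * (c \<omega> * convol kern1 M ?Y c (?Y \<omega>))" using cb by auto
  qed
  also have "\<dots> \<le> ennreal (3 * pi\<^sup>2 * T\<^sup>2 * e\<^sup>2)"
    using est e by (intro ennreal_leI) (simp add: s_def power_mult_distrib)
  finally show "(\<integral>\<^sup>+x. \<integral>\<^sup>+y. indicator (small_box e) (x - y) \<partial>?\<mu> \<partial>?\<mu>) \<le> ennreal (3 * pi\<^sup>2 * T\<^sup>2 * e\<^sup>2)" .
qed

end

section \<open>Testing the first variation with unbounded supports\<close>

lemma same_hyperplane_unit_normals:
  fixes a b :: "'a::real_inner"
  assumes "norm a = 1" "norm b = 1" "{x. a \<bullet> x = 0} = {x. b \<bullet> x = 0}"
  shows "b = a \<or> b = - a"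
proof -
  define c where "c = a \<bullet> b"
  have aa: "a \<bullet> a = 1" "b \<bullet> b = 1" using assms by (simp_all add: dot_square_norm)
  \<comment> \<open>The component of b orthogonal to a must be orthogonal to b as well, which forces
    equality in the Cauchy-Schwarz inequality.\<close>
  have "a \<bullet> (b - c *\<^sub>R a) = 0" using aa by (simp add: c_def inner_diff_right)
  then have "b \<bullet> (b - c *\<^sub>R a) = 0" using assms(3) by blast
  then have c2: "c * c = 1" using aa by (simp add: c_def inner_diff_right inner_commute)
  have "(b - c *\<^sub>R a) \<bullet> (b - c *\<^sub>R a) = 1 - c * c"
    using aa by (simp add: c_def inner_diff_right inner_diff_left inner_commute algebra_simps)
  then have "b = c *\<^sub>R a" using c2 by simp
  moreover have "c = 1 \<or> c = -1" using c2 by (simp add: square_eq_1_iff)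
  ultimately show ?thesis by auto
qed

lemma plane_normal_perp:
  assumes "\<nu> \<in> sphere 0 1"
  shows "plane_normal (plane_perp \<nu>) = \<nu> \<or> plane_normal (plane_perp \<nu>) = - \<nu>"
proof (rule same_hyperplane_unit_normals)
  show "norm \<nu> = 1" "norm (plane_normal (plane_perp \<nu>)) = 1"
    using assms norm_plane_normal by auto
  have "\<nu> \<noteq> 0" using assms by auto
  then show "{x. \<nu> \<bullet> x = 0} = {x. plane_normal (plane_perp \<nu>) \<bullet> x = 0}"
    using Rep_plane_perp Rep_plane_eq by metis
qed

lemma plane_perp_normal: "plane_perp (plane_normal P) = P"
proof -
  have "plane_normal P \<noteq> 0" using norm_plane_normal[of P] by auto
  then show ?thesis using Rep_plane_perp Rep_plane_eq by (metis Rep_plane_inject)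
qed

lemma plane_normal_in_sphere: "plane_normal P \<in> sphere 0 1"
  using norm_plane_normal by simp

text \<open>\<open>plane_normal\<close> is an arbitrary choice, and no choice of normals is
  continuous on all planes. An even function does not see the sign, so it descends to the quotient
  of the sphere.\<close>

lemma continuous_on_plane_normal:
  fixes f :: "real^3 \<Rightarrow> 'b::topological_space"
  assumes c: "continuous_on (sphere 0 1) f" and even: "\<And>\<nu>. \<nu> \<in> sphere 0 1 \<Longrightarrow> f (- \<nu>) = f \<nu>"
  shows "continuous_on UNIV (\<lambda>P. f (plane_normal P))"
  unfolding continuous_on_open_vimage[OF open_UNIV]
proof (intro allI impI)
  fix B :: "'b set" assume B: "open B"
  have "f (plane_normal (plane_perp \<nu>)) = f \<nu>" if "\<nu> \<in> sphere 0 1" for \<nu>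
    using plane_normal_perp[OF that] even[OF that] by auto
  then have "{\<nu> \<in> sphere 0 1. plane_perp \<nu> \<in> (\<lambda>P. f (plane_normal P)) -` B \<inter> UNIV} = sphere 0 1 \<inter> f -` B"
    by auto
  then show "open ((\<lambda>P. f (plane_normal P)) -` B \<inter> UNIV)"
    unfolding open_plane_def using continuous_openin_preimage_gen[OF c B] by simp
qed

lemma compact_UNIV_plane: "compact (UNIV :: plane set)"
proof -
  have "continuous_on (sphere 0 1) plane_perp"
    unfolding continuous_on_open_invariant
  proof (intro allI impI)
    fix B :: "plane set" assume "open B"
    then obtain A where "open A" "{\<nu> \<in> sphere 0 1. plane_perp \<nu> \<in> B} = sphere 0 1 \<inter> A"
      unfolding open_plane_def openin_open by blast
    then show "\<exists>A. open A \<and> A \<inter> sphere 0 1 = plane_perp -` B \<inter> sphere 0 1"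
      by (intro exI[of _ A]) blast
  qed
  then have "compact (plane_perp ` sphere 0 1)" by (intro compact_continuous_image) auto
  moreover have "plane_perp ` sphere 0 1 = UNIV"
    using plane_perp_normal plane_normal_in_sphere by (metis UNIV_eq_I image_eqI)
  ultimately show ?thesis by simp
qed

lemma B_matrix_minus:
  assumes "integrand F" "\<nu> \<noteq> 0"
  shows "B_matrix F (- \<nu>) = B_matrix F \<nu>"
  using assms gradient_minus[OF assms] by (simp add: B_matrix_def vec_eq_iff integrand_def)

lemma continuous_on_sphere_integrand:
  assumes "integrand F"
  shows "continuous_on (sphere 0 1) F" "continuous_on (sphere 0 1) (gradient F)" "continuous_on (sphere 0 1) (B_matrix F)"
proof -
  have "sphere 0 1 \<subseteq> - {0 :: real^3}" by auto
  then show 1: "continuous_on (sphere 0 1) (gradient F)"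
    using assms unfolding integrand_def
    by (auto intro: continuous_on_subset)
  show c: "continuous_on (sphere 0 1) F"
  proof (intro continuous_at_imp_continuous_on ballI differentiable_imp_continuous_within)
    fix x :: "real^3" assume "x \<in> sphere 0 1"
    then have "x \<noteq> 0" by auto
    then show "F differentiable at x" using assms unfolding integrand_def by blast
  qed
  have "continuous_on (sphere 0 1) (\<lambda>\<nu>. \<chi> i j. (if i = j then F \<nu> else 0) - \<nu> $ i * gradient F \<nu> $ j)"
  proof (intro continuous_on_vec_lambda)
    fix i j :: 3
    show "continuous_on (sphere 0 1) (\<lambda>\<nu>. (if i = j then F \<nu> else 0) - \<nu> $ i * gradient F \<nu> $ j)"
      using c 1 by (cases "i = j") (auto intro!: continuous_intros)
  qed
  then show "continuous_on (sphere 0 1) (B_matrix F)" by (simp add: B_matrix_def[abs_def])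
qed

lemma bounded_plane_normal:
  fixes f :: "real^3 \<Rightarrow> 'b::real_normed_vector"
  assumes "continuous_on (sphere 0 1) f"
  shows "\<exists>b. \<forall>P. norm (f (plane_normal P)) \<le> b"
proof -
  have "bounded (f ` sphere 0 1)" using assms by (intro compact_imp_bounded compact_continuous_image) auto
  then show ?thesis unfolding bounded_iff using plane_normal_in_sphere by blast
qed

lemma continuous_on_B_plane: 
  assumes "integrand F" shows "continuous_on UNIV (\<lambda>P. B_matrix F (plane_normal P))"
  by (rule continuous_on_plane_normal[OF continuous_on_sphere_integrand(3)[OF assms] B_matrix_minus[OF assms]]) auto

section \<open>Cut-offs and test fields along a coordinate axis\<close>

lemma max_0_square_deriv: "((\<lambda>t::real. (max 0 t)\<^sup>2) has_real_derivative 2 * max 0 t) (at t)"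
proof -
  consider "t < 0" | "t = 0" | "0 < t" by linarith
  then show ?thesis
  proof cases
    case 1
    have "((\<lambda>t::real. 0) has_real_derivative 2 * max 0 t) (at t)" using 1 by simp
    then show ?thesis
      by (rule has_field_derivative_transform_within_open[where S="{..<0}"]) (use 1 in auto)
  next
    case 2
    have "((\<lambda>h::real. ((max 0 h)\<^sup>2) / h) \<longlongrightarrow> 0) (at 0)"
    proof (rule Lim_null_comparison)
      show "\<forall>\<^sub>F h in at 0. norm ((max 0 h)\<^sup>2 / h) \<le> \<bar>h :: real\<bar>"
        by (intro always_eventually allI) (auto simp: max_def power2_eq_square)
      show "((\<lambda>h. \<bar>h :: real\<bar>) \<longlongrightarrow> 0) (at 0)" by (intro tendsto_eq_intros) auto
    qed
    then show ?thesis using 2 by (simp add: DERIV_def)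
  next
    case 3
    have "((\<lambda>t::real. t\<^sup>2) has_real_derivative 2 * max 0 t) (at t)"
      using 3 by (auto intro!: derivative_eq_intros)
    then show ?thesis
      by (rule has_field_derivative_transform_within_open[where S="{0<..}"]) (use 3 in auto)
  qed
qed

lemma jacobian_axis_field:
  fixes v :: "real^3 \<Rightarrow> real"
  assumes "(v has_derivative (\<lambda>h. d \<bullet> h)) (at x)"
  shows "jacobian (\<lambda>x. v x *\<^sub>R axis i 1 :: real^3) (at x) = (\<chi> a b. if a = i then d $ b else 0)"
proof -
  have "((\<lambda>x. v x *\<^sub>R axis i 1 :: real^3) has_derivative (\<lambda>h. (d \<bullet> h) *\<^sub>R axis i 1)) (at x)"
    using assms by (auto intro!: derivative_eq_intros)
  then have "frechet_derivative (\<lambda>x. v x *\<^sub>R axis i 1 :: real^3) (at x) = (\<lambda>h. (d \<bullet> h) *\<^sub>R axis i 1)"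
    by (rule frechet_derivative_at[symmetric])
  then show ?thesis
    by (simp add: jacobian_def matrix_def vec_eq_iff inner_axis) (simp add: axis_def)
qed

text \<open>A field along axis i has a Jacobian whose only possibly nonzero row is the i-th, so the
  first variation reads off a single row of \<open>B_matrix\<close>.\<close>

lemma first_variation_axis_field:
  fixes v :: "real^3 \<Rightarrow> real"
  assumes "\<And>x. (v has_derivative (\<lambda>h. d x \<bullet> h)) (at x)"
  shows "first_variation F V (\<lambda>x. v x *\<^sub>R axis i 1) = (LINT z|V. B_matrix F (plane_normal (snd z)) $ i \<bullet> d (fst z))"
proof -
  have "B \<bullet> (\<chi> a b. if a = i then d x $ b else 0) = B $ i \<bullet> d x" for B :: "real^3^3" and x
  proof -
    have "B \<bullet> (\<chi> a b. if a = i then d x $ b else 0) = (\<Sum>a\<in>UNIV. if a = i then B $ a \<bullet> d x else 0)"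
      unfolding inner_vec_def[of B] by (intro sum.cong) (auto simp: inner_vec_def)
    then show ?thesis by simp
  qed
  then show ?thesis
    unfolding first_variation_def jacobian_axis_field[OF assms] by (simp add: split_beta')
qed

lemma C1_compact_axis_field:
  fixes v :: "real^3 \<Rightarrow> real"
  assumes v: "\<And>x. (v has_derivative (\<lambda>h. d x \<bullet> h)) (at x)" and d: "continuous_on UNIV d"
    and R: "\<And>x. R \<le> norm x \<Longrightarrow> v x = 0"
  shows "C1_compact_field (\<lambda>x. v x *\<^sub>R axis i 1)"
  unfolding C1_compact_field_def
proof (intro conjI allI)
  show "(\<lambda>x. v x *\<^sub>R axis i 1 :: real^3) differentiable at x" for x
    using v[of x] by (auto intro!: derivative_intros simp: differentiable_def)
  show "continuous_on UNIV (\<lambda>x. jacobian (\<lambda>x. v x *\<^sub>R axis i 1 :: real^3) (at x))"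
    unfolding jacobian_axis_field[OF v]
  proof (intro continuous_on_vec_lambda)
    fix a b show "continuous_on UNIV (\<lambda>x. if a = i then d x $ b else 0)"
      using d by (cases "a = i") (auto intro!: continuous_intros)
  qed
  have "{x. v x *\<^sub>R axis i 1 \<noteq> (0 :: real^3)} \<subseteq> cball 0 R"
    using R by (force simp: not_le)
  then show "compactly_supported (\<lambda>x. v x *\<^sub>R axis i 1 :: real^3)"
    unfolding compactly_supported_def by (meson bounded_cball bounded_subset compact_closure)
qed

text \<open>The function u is truncated by squares of Lipschitz cut-offs, the squares being C^1,
  whose supports exhaust space. The terms with a derivative on the cut-off vanish uniformly, and
  since V is finite and \<open>B_matrix\<close> is bounded on unit normals, dominated convergence
  removes the truncation.\<close>

lemma first_variation_bounded_test_le: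
  fixes u :: "real^3 \<Rightarrow> real"
  assumes F: "integrand F" and V: "finite_measure V" "sets V = sets borel"
    and T: "total_first_variation F V \<le> ennreal T" "0 \<le> T"
    and u: "\<And>x. (u has_derivative (\<lambda>h. d x \<bullet> h)) (at x)" and d: "continuous_on UNIV d"
    and K: "0 < K" "\<And>x. \<bar>u x\<bar> \<le> K" and L: "\<And>x. norm (d x) \<le> L"
  shows "(LINT z|V. B_matrix F (plane_normal (snd z)) $ i \<bullet> d (fst z)) \<le> K * T"
proof -
  interpret finite_measure V by fact
  \<comment> \<open>Chosen so that the cut-off vanishes from radius n + 1 on.\<close>
  define q where "q n = 1 / (real (Suc n))\<^sup>2" for n
  define c where "c n x = max 0 (1 - q n * (norm x)\<^sup>2)" for n and x :: "real^3"
  define v where "v n x = (1 / K) * ((c n x)\<^sup>2 * u x)" for n x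
  define e where "e n x = ((c n x)\<^sup>2 / K) *\<^sub>R d x - (4 * c n x * u x * q n / K) *\<^sub>R x" for n x
  have q0: "0 \<le> q n" for n by (simp add: q_def)
  have c01: "0 \<le> c n x" "c n x \<le> 1" for n x using q0 by (auto simp: c_def)
  have c0: "c n x = 0" if "real (Suc n) \<le> norm x" for n x
  proof -
    have "(real (Suc n))\<^sup>2 \<le> (norm x)\<^sup>2" using that by (intro power_mono) auto
    then have "1 \<le> q n * (norm x)\<^sup>2" by (simp add: q_def del: of_nat_Suc)
    then show ?thesis by (simp add: c_def)
  qed
  have csq: "(c n x)\<^sup>2 \<le> 1" for n x using c01[of n x] by (simp add: power_le_one)
  have v_der: "(v n has_derivative (\<lambda>h. e n x \<bullet> h)) (at x)" for n x
  proof -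
    have "((\<lambda>x. 1 - q n * (norm x)\<^sup>2) has_derivative (\<lambda>h. - (q n * (2 * (x \<bullet> h))))) (at x)"
      unfolding power2_norm_eq_inner by (auto intro!: derivative_eq_intros simp: inner_commute)
    from has_derivative_compose[OF this max_0_square_deriv[unfolded has_field_derivative_def]]
    have "((\<lambda>x. (c n x)\<^sup>2) has_derivative (\<lambda>h. 2 * c n x * - (q n * (2 * (x \<bullet> h))))) (at x)"
      by (simp add: c_def)
    from has_derivative_mult_right[OF has_derivative_mult[OF this u], of "1 / K"]
    show ?thesis
      unfolding v_def e_def
      by (rule has_derivative_eq_rhs) (simp add: fun_eq_iff inner_diff_left diff_divide_distrib field_simps)
  qed
  have c_cont: "continuous_on UNIV (c n)" for n unfolding c_def[abs_def] by (intro continuous_intros)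
  have u_cont: "continuous_on UNIV u"
    using u has_derivative_continuous by (blast intro: continuous_at_imp_continuous_on)
  have e_cont: "continuous_on UNIV (e n)" for n
    unfolding e_def[abs_def] using K c_cont u_cont d by (intro continuous_intros) auto
  have first: "(LINT z|V. B_matrix F (plane_normal (snd z)) $ i \<bullet> e n (fst z)) \<le> T" for n
  proof -
    let ?X = "\<lambda>x. v n x *\<^sub>R axis i 1 :: real^3"
    have "C1_compact_field ?X"
      by (rule C1_compact_axis_field[OF v_der e_cont, where R="real (Suc n)"]) (simp add: v_def c0)
    moreover have "norm (?X x) \<le> 1" for x
    proof -
      have "\<bar>(c n x)\<^sup>2 * u x\<bar> \<le> 1 * K"
        unfolding abs_mult using csq K(2) by (intro mult_mono) auto
      then show ?thesis using K(1) by (simp add: v_def)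
    qed
    ultimately have "?X \<in> {X. C1_compact_field X \<and> (\<forall>x. norm (X x) \<le> 1)}" by blast
    then have "ennreal (first_variation F V ?X) \<le> total_first_variation F V"
      unfolding total_first_variation_def by (rule SUP_upper)
    then have "ennreal (first_variation F V ?X) \<le> ennreal T" using T(1) by (rule order_trans)
    then have "first_variation F V ?X \<le> T" using T(2) ennreal_le_iff by blast
    then show ?thesis unfolding first_variation_axis_field[OF v_der] .
  qed
  obtain b where b: "\<And>P. norm (B_matrix F (plane_normal P)) \<le> b"
    using bounded_plane_normal[OF continuous_on_sphere_integrand(3)[OF F]] by blast
  have Bi: "norm (B_matrix F (plane_normal P) $ i) \<le> b" for P
    by (rule order_trans[OF Finite_Cartesian_Product.norm_nth_le b])
  have b0: "0 \<le> b" using order_trans[OF norm_ge_zero b] .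
  have L0: "0 \<le> L" using order_trans[OF norm_ge_zero L] .
  have Bm: "(\<lambda>z. B_matrix F (plane_normal (snd z)) $ i \<bullet> g (fst z)) \<in> borel_measurable V"
    if "continuous_on UNIV g" for g :: "real^3 \<Rightarrow> real^3"
  proof -
    have "continuous_on UNIV (\<lambda>z :: (real^3) \<times> plane. B_matrix F (plane_normal (snd z)) $ i \<bullet> g (fst z))"
      by (intro continuous_intros continuous_on_compose2[OF continuous_on_B_plane[OF F]]
          continuous_on_compose2[OF that] continuous_on_component) auto
    then show ?thesis using V(2) by (simp add: borel_measurable_continuous_onI cong: measurable_cong_sets)
  qed
  \<comment> \<open>Where the cut-off is nonzero, \<open>norm x\<close> is below n + 1, while q n =
    1/(n+1)^2; one power of n + 1 remains in the denominator.\<close>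
  have tail: "norm ((4 * c n x * u x * q n / K) *\<^sub>R x) \<le> 4 / real (Suc n)" for n x
  proof (cases "real (Suc n) \<le> norm x")
    case False
    have "\<bar>c n x * u x\<bar> * norm x \<le> (1 * K) * real (Suc n)"
      unfolding abs_mult using c01[of n x] K False by (intro mult_mono) auto
    then have "(\<bar>c n x * u x\<bar> * norm x) * (4 * q n / K) \<le> ((1 * K) * real (Suc n)) * (4 * q n / K)"
      using K q0 by (intro mult_right_mono) auto
    also have "\<dots> = 4 / real (Suc n)" using K by (simp add: q_def power2_eq_square del: of_nat_Suc)
    finally show ?thesis using K q0[of n] by (simp add: abs_mult mult_ac del: of_nat_Suc)
  qed (simp add: c0)
  have "(\<lambda>n. LINT z|V. B_matrix F (plane_normal (snd z)) $ i \<bullet> e n (fst z))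
    \<longlonglongrightarrow> (LINT z|V. B_matrix F (plane_normal (snd z)) $ i \<bullet> (d (fst z) /\<^sub>R K))"
  proof (rule integral_dominated_convergence[where w="\<lambda>_. b * (L / K + 4)"])
    show "(\<lambda>z. B_matrix F (plane_normal (snd z)) $ i \<bullet> (d (fst z) /\<^sub>R K)) \<in> borel_measurable V"
      by (rule Bm[of "\<lambda>x. d x /\<^sub>R K"]) (intro continuous_intros d)
    show "(\<lambda>z. B_matrix F (plane_normal (snd z)) $ i \<bullet> e n (fst z)) \<in> borel_measurable V" for n
      by (rule Bm[OF e_cont])
    show "AE z in V. norm (B_matrix F (plane_normal (snd z)) $ i \<bullet> e n (fst z)) \<le> b * (L / K + 4)" for n
    proof (rule AE_I2)
      fix z :: "(real^3) \<times> plane"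
      have "norm (e n (fst z)) \<le> norm (((c n (fst z))\<^sup>2 / K) *\<^sub>R d (fst z)) + 4 / real (Suc n)"
        unfolding e_def by (rule order_trans[OF norm_triangle_ineq4 add_left_mono[OF tail]])
      also have "norm (((c n (fst z))\<^sup>2 / K) *\<^sub>R d (fst z)) \<le> (1 / K) * L"
        using csq[of n "fst z"] K L[of "fst z"] unfolding norm_scaleR
        by (intro mult_mono) (auto simp: divide_right_mono)
      also have "4 / real (Suc n) \<le> 4" by (simp add: divide_le_eq)
      finally have "norm (e n (fst z)) \<le> L / K + 4" by simp
      then have "norm (B_matrix F (plane_normal (snd z)) $ i) * norm (e n (fst z)) \<le> b * (L / K + 4)"
        using Bi b0 by (intro mult_mono) auto
      then show "norm (B_matrix F (plane_normal (snd z)) $ i \<bullet> e n (fst z)) \<le> b * (L / K + 4)"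
        unfolding real_norm_def by (rule order_trans[OF Cauchy_Schwarz_ineq2])
    qed
    show "AE z in V. (\<lambda>n. B_matrix F (plane_normal (snd z)) $ i \<bullet> e n (fst z))
       \<longlonglongrightarrow> B_matrix F (plane_normal (snd z)) $ i \<bullet> (d (fst z) /\<^sub>R K)"
    proof (rule AE_I2)
      fix z :: "(real^3) \<times> plane"
      let ?x = "fst z"
      have inv: "(\<lambda>n. 1 / real (Suc n)) \<longlonglongrightarrow> 0"
        by (rule LIMSEQ_Suc[OF lim_1_over_n])
      have "(\<lambda>n. max 0 (1 - (1 / real (Suc n))\<^sup>2 * (norm ?x)\<^sup>2)) \<longlonglongrightarrow> max 0 (1 - 0\<^sup>2 * (norm ?x)\<^sup>2)"
        by (intro tendsto_intros inv)
      then have c1: "(\<lambda>n. c n ?x) \<longlonglongrightarrow> 1" by (simp add: c_def q_def power_divide)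
      have "(\<lambda>n. (4 * c n ?x * u ?x * q n / K) *\<^sub>R ?x) \<longlonglongrightarrow> 0"
      proof (rule Lim_null_comparison)
        show "\<forall>\<^sub>F n in sequentially. norm ((4 * c n ?x * u ?x * q n / K) *\<^sub>R ?x) \<le> 4 * (1 / real (Suc n))"
          using tail[of _ ?x] by (intro always_eventually) simp
        show "(\<lambda>n. 4 * (1 / real (Suc n))) \<longlonglongrightarrow> 0" using tendsto_mult_left[OF inv, of 4] by simp
      qed
      then have "(\<lambda>n. e n ?x) \<longlonglongrightarrow> ((1\<^sup>2 / K) *\<^sub>R d ?x) - 0"
        unfolding e_def using K by (intro tendsto_intros c1) auto
      then show "(\<lambda>n. B_matrix F (plane_normal (snd z)) $ i \<bullet> e n ?x)
       \<longlonglongrightarrow> B_matrix F (plane_normal (snd z)) $ i \<bullet> (d ?x /\<^sub>R K)"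
        by (intro tendsto_intros) (simp add: divide_inverse)
    qed
  qed simp
  then have "(LINT z|V. B_matrix F (plane_normal (snd z)) $ i \<bullet> (d (fst z) /\<^sub>R K)) \<le> T"
    by (rule LIMSEQ_le_const2) (use first in auto)
  then show ?thesis using K(1) by (simp add: inverse_eq_divide divide_le_eq mult.commute)
qed

lemma first_variation_bounded_test:
  fixes u :: "real^3 \<Rightarrow> real"
  assumes F: "integrand F" and V: "finite_measure V" "sets V = sets borel"
    and T: "total_first_variation F V \<le> ennreal T" "0 \<le> T"
    and u: "\<And>x. (u has_derivative (\<lambda>h. d x \<bullet> h)) (at x)" and d: "continuous_on UNIV d"
    and K: "0 < K" "\<And>x. \<bar>u x\<bar> \<le> K" and L: "\<And>x. norm (d x) \<le> L"
  shows "\<bar>LINT z|V. B_matrix F (plane_normal (snd z)) $ i \<bullet> d (fst z)\<bar> \<le> K * T"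
proof -
  have "(LINT z|V. B_matrix F (plane_normal (snd z)) $ i \<bullet> (- d (fst z))) \<le> K * T"
  proof (rule first_variation_bounded_test_le[OF F V T, where u="\<lambda>x. - u x" and d="\<lambda>x. - d x" and L=L])
    show "((\<lambda>x. - u x) has_derivative (\<lambda>h. - d x \<bullet> h)) (at x)" for x
      using has_derivative_minus[OF u] by simp
    show "continuous_on UNIV (\<lambda>x. - d x)" using d by (rule continuous_on_minus)
  qed (use K L in simp_all)
  moreover have "(LINT z|V. B_matrix F (plane_normal (snd z)) $ i \<bullet> d (fst z)) \<le> K * T"
    by (rule first_variation_bounded_test_le[OF F V T u d K L])
  ultimately show ?thesis by (simp add: abs_le_iff)
qed

text \<open>The potential is pulled back by the projection to coordinates i and j. Its gradient has
  no component along the other axis, so only two entries of row n survive; being constant along that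
  axis, it needs the bound for tests without compact support.\<close>

lemma divergence_bound_B_matrix:
  assumes F: "integrand F" and V: "finite_measure V" "sets V = sets borel"
    and T: "total_first_variation F V \<le> ennreal T" "0 \<le> T"
  shows "divergence_bound V (\<lambda>z. (fst z $ i, fst z $ j)) T
    (\<lambda>z. B_matrix F (plane_normal (snd z)) $ n $ i) (\<lambda>z. B_matrix F (plane_normal (snd z)) $ n $ j)"
  unfolding divergence_bound_def
proof (intro allI impI)
  fix u u1 u2 :: "real \<times> real \<Rightarrow> real" and K :: real
  assume a: "test_potential u u1 u2 \<and> 0 < K \<and> (\<forall>r. \<bar>u r\<bar> \<le> K)"
  define p where "p x = (x $ i, x $ j)" for x :: "real^3"
  define d where "d x = (u1 (p x) *\<^sub>R axis i 1 + u2 (p x) *\<^sub>R axis j 1 :: real^3)" for x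
  have tp: "\<And>r. (u has_derivative (\<lambda>h. u1 r * fst h + u2 r * snd h)) (at r)" "continuous_on UNIV u1"
    "continuous_on UNIV u2" "bounded (range u1)" "bounded (range u2)"
    using a unfolding test_potential_def by blast+
  have "(p has_derivative (\<lambda>h. (h $ i, h $ j))) (at x)" for x
    unfolding p_def[abs_def] by (intro has_derivative_Pair bounded_linear_imp_has_derivative bounded_linear_vec_nth)
  from has_derivative_compose[OF this tp(1)]
  have der: "((\<lambda>x. u (p x)) has_derivative (\<lambda>h. d x \<bullet> h)) (at x)" for x
    by (rule has_derivative_eq_rhs) (simp add: d_def inner_add_left inner_axis')
  have pc: "continuous_on UNIV p" unfolding p_def[abs_def] by (intro continuous_intros)
  have dc: "continuous_on UNIV d" unfolding d_def[abs_def]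
    by (intro continuous_intros continuous_on_compose2[OF tp(2) pc] continuous_on_compose2[OF tp(3) pc]) auto
  obtain L1 L2 where L: "\<And>r. \<bar>u1 r\<bar> \<le> L1" "\<And>r. \<bar>u2 r\<bar> \<le> L2"
    using bounded_range_real[OF tp(4)] bounded_range_real[OF tp(5)] by blast
  have "norm (d x) \<le> L1 + L2" for x
    unfolding d_def by (rule order_trans[OF norm_triangle_ineq]) (use L[of "p x"] in \<open>auto intro!: add_mono\<close>)
  then have "\<bar>LINT z|V. B_matrix F (plane_normal (snd z)) $ n \<bullet> d (fst z)\<bar> \<le> K * T"
    using a by (intro first_variation_bounded_test[OF F V T der dc]) blast+
  moreover have "B \<bullet> d x = B $ i * u1 (x $ i, x $ j) + B $ j * u2 (x $ i, x $ j)" for B x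
    by (simp add: d_def p_def inner_add_right inner_axis)
  ultimately show "\<bar>LINT z|V. B_matrix F (plane_normal (snd z)) $ n $ i * u1 (fst z $ i, fst z $ j) +
     B_matrix F (plane_normal (snd z)) $ n $ j * u2 (fst z $ i, fst z $ j)\<bar> \<le> K * T"
    by (simp only:)
qed

section \<open>Concentration of the weight\<close>

text \<open>A set of diameter d projects into a square of half-width slightly above d. Comparing 8
  d^2 with pi (d/2)^2 costs the factor 11, as 32 <= 11 pi. Openness of U matches the form of the
  density bound.\<close>

lemma hausdorff2_projection_subset_open:
  fixes A :: "'a::metric_space set" and p :: "'a \<Rightarrow> real \<times> real"
  assumes h: "hausdorff2 A \<le> ennreal h" "0 \<le> h" and e: "0 < e"
    and p: "\<And>x y. \<bar>fst (p x) - fst (p y)\<bar> \<le> dist x y" "\<And>x y. \<bar>snd (p x) - snd (p y)\<bar> \<le> dist x y"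
  shows "\<exists>U. open U \<and> p ` A \<subseteq> U \<and> emeasure lborel U \<le> ennreal (11 * h + 19 * e)"
proof -
  have "hausdorff2_pre 1 A \<le> ennreal h" using h hausdorff2_pre_le[of 1 A] by (meson order_trans zero_less_one)
  also have "\<dots> < ennreal (h + e)" using h e by (intro ennreal_lessI) auto
  finally obtain C where C: "A \<subseteq> (\<Union>i. C i)" "\<And>i. bounded (C i)"
    and sum: "(\<Sum>i. ennreal (pi * (diameter (C i) / 2)\<^sup>2)) < ennreal (h + e)"
    unfolding hausdorff2_pre_def INF_less_iff by auto
  \<comment> \<open>If C i is empty this is an arbitrary point, and its small square is
    harmless.\<close>
  define x0 where "x0 i = (SOME x. x \<in> C i)" for i
  define d where "d i = diameter (C i)" for i
  have d0: "0 \<le> d i" for i unfolding d_def using C(2) by (rule diameter_ge_0)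
  \<comment> \<open>The enlargements let open squares cover the sets, and their squares sum to e.
    They cost 8 e, and the excess of the nearly optimal cover costs 11 e, whence the 19.\<close>
  define t where "t i = sqrt (e * (1/2) ^ Suc i)" for i :: nat
  have t: "0 < t i" "(t i)\<^sup>2 = e * (1/2) ^ Suc i" for i using e by (auto simp: t_def)
  define r where "r i = d i + t i" for i
  define U where "U i = {fst (p (x0 i)) - r i<..<fst (p (x0 i)) + r i} \<times> {snd (p (x0 i)) - r i<..<snd (p (x0 i)) + r i}" for i
  have Uo: "open (U i)" for i unfolding U_def by (intro open_Times) auto
  have "p x \<in> (\<Union>i. U i)" if xA: "x \<in> A" for x
  proof -
    obtain i where i: "x \<in> C i" using xA C(1) by blast
    then have "x0 i \<in> C i" unfolding x0_def by (rule someI)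
    then have "dist x (x0 i) \<le> d i" unfolding d_def using i C(2) diameter_bounded_bound by blast
    then have "dist x (x0 i) < r i" using t(1)[of i] by (simp add: r_def)
    then have "p x \<in> U i" using p(1)[of x "x0 i"] p(2)[of x "x0 i"] unfolding U_def mem_Times_iff by auto
    then show ?thesis by blast
  qed
  moreover have "emeasure lborel (\<Union>i. U i) \<le> ennreal (11 * h + 19 * e)"
  proof -
    have Ui: "emeasure lborel (U i) \<le> 11 * ennreal (pi * (d i / 2)\<^sup>2) + ennreal (8 * e * (1/2) ^ Suc i)" for i
    proof -
      have r0: "0 \<le> r i" using d0[of i] t(1)[of i] by (simp add: r_def)
      have "emeasure lborel (U i) = emeasure (lborel \<Otimes>\<^sub>M lborel) (U i)" by (simp add: lborel_prod)
      also have "\<dots> = ennreal (4 * (r i)\<^sup>2)"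
        unfolding U_def using r0 by (subst lborel.emeasure_pair_measure_Times)
          (auto simp: ennreal_mult[symmetric] power2_eq_square)
      also have "\<dots> \<le> ennreal (11 * (pi * (d i / 2)\<^sup>2) + 8 * e * (1/2) ^ Suc i)"
      proof (rule ennreal_leI)
        have "4 * (r i)\<^sup>2 \<le> 8 * (d i)\<^sup>2 + 8 * (t i)\<^sup>2"
          using zero_le_power2[of "d i - t i"] by (simp add: r_def power2_eq_square algebra_simps)
        moreover have "8 * (d i)\<^sup>2 \<le> 11 * (pi * (d i / 2)\<^sup>2)"
          using mult_right_mono[of "32" "11 * pi" "(d i)\<^sup>2"] pi_gt3 by (simp add: power_divide)
        ultimately show "4 * (r i)\<^sup>2 \<le> 11 * (pi * (d i / 2)\<^sup>2) + 8 * e * (1/2) ^ Suc i" using t(2) by simp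
      qed
      also have "\<dots> = 11 * ennreal (pi * (d i / 2)\<^sup>2) + ennreal (8 * e * (1/2) ^ Suc i)"
        using e by (simp add: ennreal_plus ennreal_mult')
      finally show ?thesis .
    qed
    have "emeasure lborel (\<Union>i. U i) \<le> (\<Sum>i. emeasure lborel (U i))"
      using Uo by (intro emeasure_subadditive_countably) auto
    also have "\<dots> \<le> (\<Sum>i. 11 * ennreal (pi * (d i / 2)\<^sup>2) + ennreal (8 * e * (1/2) ^ Suc i))"
      using Ui by (intro suminf_le) auto
    also have "\<dots> = (\<Sum>i. 11 * ennreal (pi * (d i / 2)\<^sup>2)) + (\<Sum>i. ennreal (8 * e * (1/2) ^ Suc i))"
      by (rule suminf_add[symmetric]) auto
    also have "(\<Sum>i. ennreal (8 * e * (1/2) ^ Suc i)) = ennreal (8 * e)"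
      using e sums_mult[OF power_half_series, of "8 * e"] by (intro suminf_ennreal_eq) auto
    also have "(\<Sum>i. 11 * ennreal (pi * (d i / 2)\<^sup>2)) = 11 * (\<Sum>i. ennreal (pi * (d i / 2)\<^sup>2))"
      by (rule ennreal_suminf_cmult)
    also have "\<dots> \<le> 11 * ennreal (h + e)"
      using sum unfolding d_def by (intro mult_left_mono) auto
    also have "11 * ennreal (h + e) + ennreal (8 * e) = ennreal (11 * h + 19 * e)"
    proof -
      have "11 * ennreal (h + e) = ennreal (11 * (h + e))" using h e by (simp add: ennreal_mult')
      then show ?thesis using h e by (simp add: ennreal_plus[symmetric] algebra_simps del: ennreal_plus)
    qed
    finally show ?thesis by (simp add: add_right_mono)
  qed
  ultimately show ?thesis using Uo by (intro exI[of _ "\<Union>i. U i"]) auto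
qed

section \<open>Area of discs in a plane\<close>

lemma plane_orthonormal_basis:
  obtains a b where "norm a = 1" "norm b = 1" "a \<bullet> b = 0" "Rep_plane P = {s *\<^sub>R a + t *\<^sub>R b | s t. True}"
proof -
  have P: "subspace (Rep_plane P)" "dim (Rep_plane P) = 2" using Rep_plane[of P] by auto
  obtain B where B: "pairwise orthogonal B" "\<And>x. x \<in> B \<Longrightarrow> norm x = 1" "card B = 2" "span B = Rep_plane P"
    using orthonormal_basis_subspace[OF P(1)] P(2) by metis
  obtain a b where ab: "B = {a, b}" "a \<noteq> b" using B(3) by (auto simp: card_2_iff)
  have "x \<in> span {a, b} \<longleftrightarrow> (\<exists>s t. x = s *\<^sub>R a + t *\<^sub>R b)" for x
    unfolding span_insert span_singleton by (auto simp: algebra_simps)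
  then have "Rep_plane P = {s *\<^sub>R a + t *\<^sub>R b | s t. True}" using B(4) ab by auto
  then show ?thesis using that[of a b] B ab by (auto simp: pairwise_def orthogonal_def)
qed

lemma closed_Rep_plane: "closed (Rep_plane P)"
  unfolding Rep_plane_eq by (rule closed_hyperplane)

text \<open>A grid in orthonormal coordinates: (n+1)^2 squares of diameter at most 4/n have total
  size at most 16 pi, for every n > 0.\<close>

lemma hausdorff2_plane_disc_finite: "hausdorff2 (Rep_plane P \<inter> cball 0 1) < \<infinity>"
proof -
  obtain a b where ab: "norm a = 1" "norm b = 1" "a \<bullet> b = 0" "Rep_plane P = {s *\<^sub>R a + t *\<^sub>R b | s t. True}"
    by (rule plane_orthonormal_basis)
  have "hausdorff2_pre \<delta> (Rep_plane P \<inter> cball 0 1) \<le> ennreal (16 * pi)" if "0 < \<delta>" for \<delta>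
  proof -
    obtain n where n: "4 / \<delta> < real n" using reals_Archimedean2 by blast
    have n0: "0 < n" 
    proof -
      have "0 < 4 / \<delta>" using that by simp
      then show ?thesis using n by linarith
    qed
    have n4: "4 / real n \<le> \<delta>" using n n0 that by (simp add: field_simps)
    define l where "l q = -1 + 2 * real q / real n" for q :: nat
    define J where "J q = {l q..l q + 2 / real n}" for q
    \<comment> \<open>Grid indices run up to n inclusive, because the coordinate 1 falls into the
      interval that starts there. Quotient and remainder of m encode the pair of indices.\<close>
    define C where "C m = (if m < (n + 1) * (n + 1) then {s *\<^sub>R a + t *\<^sub>R b | s t. s \<in> J (m div (n + 1)) \<and> t \<in> J (m mod (n + 1))} else {})" for m
    have dist: "norm (x - y) \<le> 4 / real n" if xy: "x \<in> C m" "y \<in> C m" for x y m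
    proof -
      obtain s t s' t' where st: "x = s *\<^sub>R a + t *\<^sub>R b" "y = s' *\<^sub>R a + t' *\<^sub>R b" "s \<in> J (m div (n + 1))" "s' \<in> J (m div (n + 1))"
         "t \<in> J (m mod (n + 1))" "t' \<in> J (m mod (n + 1))"
        using xy unfolding C_def by (auto split: if_splits)
      have "x - y = (s - s') *\<^sub>R a + (t - t') *\<^sub>R b" using st by (simp add: algebra_simps)
      then have "norm (x - y) \<le> \<bar>s - s'\<bar> + \<bar>t - t'\<bar>"
        using norm_triangle_ineq[of "(s - s') *\<^sub>R a" "(t - t') *\<^sub>R b"] ab by simp
      also have "\<dots> \<le> 2 / real n + 2 / real n" using st unfolding J_def by (intro add_mono) auto
      finally show ?thesis by simp
    qed
    have diam: "diameter (C m) \<le> 4 / real n" for m using dist by (intro diameter_le) auto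
    have bdd: "bounded (C m)" for m
    proof (cases "C m = {}")
      case False
      then obtain x where "x \<in> C m" by blast
      then have "C m \<subseteq> cball x (4 / real n)" using dist by (auto simp: dist_norm)
      then show ?thesis using bounded_cball bounded_subset by blast
    qed simp
    have find: "\<exists>q\<le>n. s \<in> J q" if "\<bar>s\<bar> \<le> 1" for s :: real
    proof -
      define q where "q = nat \<lfloor>(s + 1) * real n / 2\<rfloor>"
      have z: "0 \<le> (s + 1) * real n / 2" "(s + 1) * real n / 2 \<le> real n"
        using that mult_right_mono[of "s + 1" 2 "real n"] by (auto simp: abs_le_iff)
      have q: "real q \<le> (s + 1) * real n / 2" "(s + 1) * real n / 2 < real q + 1"
        using z(1) unfolding q_def by linarith+
      have "real q \<le> real n" using q z by linarith
      moreover have "s \<in> J q" using q n0 unfolding J_def l_def by (auto simp: field_simps)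
      ultimately show ?thesis by auto
    qed
    have cover: "Rep_plane P \<inter> cball 0 1 \<subseteq> (\<Union>m. C m)"
    proof
      fix x assume x: "x \<in> Rep_plane P \<inter> cball 0 1"
      then obtain s t where st: "x = s *\<^sub>R a + t *\<^sub>R b" using ab(4) by auto
      have "x \<bullet> a = s" "x \<bullet> b = t"
        using ab(1-3) unfolding st by (simp_all add: inner_add_left inner_commute[of b a] dot_square_norm)
      then have "\<bar>s\<bar> \<le> 1" "\<bar>t\<bar> \<le> 1"
        using x Cauchy_Schwarz_ineq2[of x a] Cauchy_Schwarz_ineq2[of x b] ab by auto
      then obtain q r where qr: "q \<le> n" "s \<in> J q" "r \<le> n" "t \<in> J r" using find by metis
      define m where "m = q * (n + 1) + r"
      have "m = r + (n + 1) * q" "r < n + 1" using qr by (simp_all add: m_def)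
      then have "m div (n + 1) = q" "m mod (n + 1) = r" by (simp_all del: add_Suc_right mult_Suc)
      moreover have "m < (n + 1) * (n + 1)"
      proof -
        have "m < q * (n + 1) + (n + 1)" using qr by (simp add: m_def)
        also have "\<dots> = (q + 1) * (n + 1)" by simp
        also have "\<dots> \<le> (n + 1) * (n + 1)" using qr by (intro mult_right_mono) auto
        finally show ?thesis .
      qed
      ultimately have "x \<in> C m" using qr st unfolding C_def by auto
      then show "x \<in> (\<Union>m. C m)" by blast
    qed
    have "hausdorff2_pre \<delta> (Rep_plane P \<inter> cball 0 1) \<le> (\<Sum>m. ennreal (pi * (diameter (C m) / 2)\<^sup>2))"
      using cover bdd order_trans[OF diam n4] by (rule hausdorff2_pre_leI)
    also have "\<dots> = (\<Sum>m\<in>{..<(n + 1) * (n + 1)}. ennreal (pi * (diameter (C m) / 2)\<^sup>2))"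
      by (rule suminf_finite) (auto simp: C_def)
    also have "\<dots> \<le> (\<Sum>m\<in>{..<(n + 1) * (n + 1)}. ennreal (pi * (2 / real n)\<^sup>2))"
    proof (intro sum_mono ennreal_leI mult_left_mono power_mono)
      show "diameter (C m) / 2 \<le> 2 / real n" for m using diam[of m] by simp
      show "0 \<le> diameter (C m) / 2" for m using diameter_ge_0[OF bdd] by simp
    qed auto
    also have "\<dots> = ennreal (real ((n + 1) * (n + 1)) * (pi * (2 / real n)\<^sup>2))"
      by (simp only: sum_constant card_lessThan ennreal_of_nat_eq_real_of_nat ennreal_mult' of_nat_0_le_iff)
    also have "\<dots> \<le> ennreal (16 * pi)"
    proof (rule ennreal_leI)
      have "(real n + 1) * (real n + 1) \<le> (2 * real n) * (2 * real n)" using n0 by (intro mult_mono) auto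
      then have "pi * ((real n + 1) * (real n + 1)) \<le> pi * ((2 * real n) * (2 * real n))" by (intro mult_left_mono) auto
      then show "real ((n + 1) * (n + 1)) * (pi * (2 / real n)\<^sup>2) \<le> 16 * pi"
        using n0 by (simp add: power2_eq_square field_simps)
    qed
    finally show ?thesis .
  qed
  then have "hausdorff2 (Rep_plane P \<inter> cball 0 1) \<le> ennreal (16 * pi)"
    unfolding hausdorff2_def by (intro SUP_least) auto
  then show ?thesis by (simp add: le_less_trans)
qed

text \<open>Orthonormal coordinates of the disc fill a square of area 1/16, while those of a null
  set fit into an open set of area at most 19/1000.\<close>

lemma hausdorff2_plane_disc_pos: "0 < hausdorff2 (Rep_plane P \<inter> ball 0 (1/2))"
proof (rule ccontr)
  assume "\<not> ?thesis"
  then have z: "hausdorff2 (Rep_plane P \<inter> ball 0 (1/2)) \<le> ennreal 0" by (simp add: zero_less_iff_neq_zero)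
  obtain a b where ab: "norm a = 1" "norm b = 1" "a \<bullet> b = 0" "Rep_plane P = {s *\<^sub>R a + t *\<^sub>R b | s t. True}"
    by (rule plane_orthonormal_basis)
  define p where "p x = (x \<bullet> a, x \<bullet> b)" for x
  have lip: "\<bar>x \<bullet> c - y \<bullet> c\<bar> \<le> dist x y" if "norm c = 1" for x y c :: "real^3"
    using Cauchy_Schwarz_ineq2[of "x - y" c] that by (simp add: inner_diff_left dist_norm)
  obtain U where U: "open U" "p ` (Rep_plane P \<inter> ball 0 (1/2)) \<subseteq> U" "emeasure lborel U \<le> ennreal (11 * 0 + 19 * (1 / 1000))"
    using hausdorff2_projection_subset_open[OF z order_refl, of "1 / 1000" p] lip ab by (auto simp: p_def)
  have "{-1/8..1/8} \<times> {-1/8..1/8} \<subseteq> U"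
  proof
    fix r :: "real \<times> real" assume r: "r \<in> {-1/8..1/8} \<times> {-1/8..1/8}"
    define x where "x = fst r *\<^sub>R a + snd r *\<^sub>R b"
    have "norm x \<le> \<bar>fst r\<bar> + \<bar>snd r\<bar>"
      unfolding x_def using norm_triangle_ineq[of "fst r *\<^sub>R a" "snd r *\<^sub>R b"] ab by simp
    also have "\<dots> \<le> 1/8 + 1/8" using r by (intro add_mono) (auto simp: mem_Times_iff abs_le_iff)
    finally have "x \<in> Rep_plane P \<inter> ball 0 (1/2)" using ab(4) by (auto simp: x_def)
    moreover have "p x = r" using ab(1-3) unfolding p_def x_def by (simp add: inner_add_left inner_commute[of b a] dot_square_norm)
    ultimately show "r \<in> U" using U(2) by blast
  qed
  then have "emeasure lborel ({-1/8..1/8::real} \<times> {-1/8..1/8::real}) \<le> emeasure lborel U"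
    using U(1) by (intro emeasure_mono) auto
  moreover have "emeasure lborel ({-1/8..1/8::real} \<times> {-1/8..1/8::real}) = ennreal (1/16)"
    unfolding lborel_prod[symmetric] by (subst lborel.emeasure_pair_measure_Times) (auto simp: ennreal_mult[symmetric])
  ultimately have "ennreal (1/16) \<le> ennreal (11 * 0 + 19 * (1 / 1000))"
    using U(3) by (metis order_trans)
  then show False by (subst (asm) ennreal_le_iff) auto
qed

section \<open>Positive lower density and the concentration set\<close>

definition bump :: "'a::real_normed_vector \<Rightarrow> real" where
  "bump y = max 0 (1 - norm y)"

lemma bump_bounds: "0 \<le> bump y" "bump y \<le> 1"
  by (auto simp: bump_def)

lemma continuous_on_bump: "continuous_on S bump"
  unfolding bump_def[abs_def] by (intro continuous_intros)

lemma compactly_supportedI: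
  fixes f :: "real^3 \<Rightarrow> 'b::zero"
  assumes "\<And>y. f y \<noteq> 0 \<Longrightarrow> y \<in> K" "bounded K" shows "compactly_supported f"
  unfolding compactly_supported_def using assms by (meson bounded_subset compact_closure mem_Collect_eq subsetI)

text \<open>The lower bound comes from the smaller disc, where \<open>bump\<close> is at least 1/2.
  Finite area of the unit disc is equally essential, as the integral of a function that is not
  integrable is 0 by default.\<close>

lemma bump_plane_integral_pos: "0 < (LINT y:Rep_plane P|hausdorff2_measure. bump y)"
proof -
  let ?H = "hausdorff2_measure :: (real^3) measure"
  have sH [measurable_cong, simp]: "sets ?H = sets borel" by (rule sets_hausdorff2_measure)
  have [measurable]: "Rep_plane P \<in> sets borel" using closed_Rep_plane by (rule borel_closed)
  have em: "emeasure ?H (Rep_plane P \<inter> B) = hausdorff2 (Rep_plane P \<inter> B)" if "B \<in> sets borel" for B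
    by (intro emeasure_hausdorff2_measure sets.Int borel_closed closed_Rep_plane that)
  have [measurable]: "(bump :: real^3 \<Rightarrow> real) \<in> borel_measurable borel"
    by (rule borel_measurable_continuous_onI[OF continuous_on_bump])
  have iH: "integrable ?H (indicat_real (Rep_plane P \<inter> cball 0 1))"
    using em[of "cball 0 1"] hausdorff2_plane_disc_finite[of P] by (intro integrable_real_indicator) auto
  have i: "integrable ?H (\<lambda>y. indicat_real (Rep_plane P) y *\<^sub>R bump y)"
  proof (rule Bochner_Integration.integrable_bound[OF iH])
    show "(\<lambda>y. indicat_real (Rep_plane P) y *\<^sub>R bump y) \<in> borel_measurable ?H" by measurable
    show "AE y in ?H. norm (indicat_real (Rep_plane P) y *\<^sub>R bump y) \<le> norm (indicat_real (Rep_plane P \<inter> cball 0 1) y)"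
      by (intro AE_I2) (auto simp: indicator_def bump_def)
  qed
  have iB: "emeasure ?H (Rep_plane P \<inter> ball 0 (1/2)) < \<infinity>"
    using em[of "ball 0 (1/2)"] hausdorff2_plane_disc_finite[of P]
      hausdorff2_mono[of "Rep_plane P \<inter> ball 0 (1/2)" "Rep_plane P \<inter> cball 0 1"]
    by (auto simp: subset_eq intro: le_less_trans)
  have "0 < measure ?H (Rep_plane P \<inter> ball 0 (1/2))"
    using iB em[of "ball 0 (1/2)"] hausdorff2_plane_disc_pos[of P] by (simp add: measure_def enn2real_positive_iff)
  moreover have "(1/2) * measure ?H (Rep_plane P \<inter> ball 0 (1/2)) \<le> (LINT y|?H. indicat_real (Rep_plane P) y *\<^sub>R bump y)"
  proof -
    have "(1/2) * measure ?H (Rep_plane P \<inter> ball 0 (1/2)) = (LINT y|?H. (1/2) * indicat_real (Rep_plane P \<inter> ball 0 (1/2)) y)"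
      by (simp add: sets_eq_imp_space_eq[OF sH])
    also have "\<dots> \<le> (LINT y|?H. indicat_real (Rep_plane P) y *\<^sub>R bump y)"
    proof (rule integral_mono[OF _ i])
      show "integrable ?H (\<lambda>y. (1/2) * indicat_real (Rep_plane P \<inter> ball 0 (1/2)) y)"
        using iB by (intro integrable_mult_right integrable_real_indicator) auto
      show "1 / 2 * indicat_real (Rep_plane P \<inter> ball 0 (1/2)) y \<le> indicat_real (Rep_plane P) y *\<^sub>R bump y" for y
        by (auto simp: indicator_def bump_def)
    qed
    finally show ?thesis .
  qed
  ultimately show ?thesis unfolding set_lebesgue_integral_def by linarith
qed

lemma weight_measure:
  assumes V: "sets V = sets borel" 
  shows "fst \<in> V \<rightarrow>\<^sub>M (borel :: (real^3) measure)" "sets (weight V) = sets borel"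
    and "A \<in> sets borel \<Longrightarrow> emeasure (weight V) A = emeasure V (fst -` A)"
proof -
  have sp: "space V = UNIV" using sets_eq_imp_space_eq[OF V] by simp
  have "(fst :: (real^3) \<times> plane \<Rightarrow> real^3) \<in> borel_measurable borel"
    by (rule borel_measurable_continuous_onI) (rule continuous_on_fst[OF continuous_on_id])
  then show f: "fst \<in> V \<rightarrow>\<^sub>M (borel :: (real^3) measure)" using V by (simp cong: measurable_cong_sets)
  show "sets (weight V) = sets borel" by (simp add: weight_def)
  show "A \<in> sets borel \<Longrightarrow> emeasure (weight V) A = emeasure V (fst -` A)"
    unfolding weight_def using f sp by (simp add: emeasure_distr)
qed

text \<open>Since the Grassmannian is compact, a compactly supported function of the position alone
  is an admissible test function on the product.\<close>

lemma weight_integral: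
  assumes V: "sets V = sets borel"
    and eq: "\<forall>\<phi>. continuous_on UNIV \<phi> \<and> compactly_supported \<phi> \<longrightarrow>
           (LINT z|V. \<phi> z) = (LINT x:S|hausdorff2_measure. \<phi> (x, T x) * m x)"
    and \<psi>: "continuous_on UNIV \<psi>" "compactly_supported \<psi>"
  shows "(LINT x|weight V. \<psi> x) = (LINT x:S|hausdorff2_measure. \<psi> x * (m x :: real))"
proof -
  let ?K = "closure {x. \<psi> x \<noteq> 0}"
  have "closure {z. \<psi> (fst z) \<noteq> 0} \<subseteq> ?K \<times> (UNIV :: plane set)"
    by (rule closure_minimal) (auto intro: closure_subset[THEN subsetD] closed_Times)
  then have "closure {z :: (real^3) \<times> plane. \<psi> (fst z) \<noteq> 0} = (?K \<times> UNIV) \<inter> closure {z. \<psi> (fst z) \<noteq> 0}" by blast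
  moreover have "compact ((?K \<times> UNIV) \<inter> closure {z :: (real^3) \<times> plane. \<psi> (fst z) \<noteq> 0})"
    using \<psi>(2) compact_UNIV_plane unfolding compactly_supported_def by (intro compact_Int_closed compact_Times) auto
  ultimately have cs: "compactly_supported (\<lambda>z :: (real^3) \<times> plane. \<psi> (fst z))"
    unfolding compactly_supported_def by simp
  have "continuous_on UNIV (\<lambda>z :: (real^3) \<times> plane. \<psi> (fst z))"
    by (intro continuous_on_compose2[OF \<psi>(1)] continuous_intros) auto
  with cs eq have "(LINT z|V. \<psi> (fst z)) = (LINT x:S|hausdorff2_measure. \<psi> x * m x)" by fastforce
  moreover have "(LINT x|weight V. \<psi> x) = (LINT z|V. \<psi> (fst z))"
    unfolding weight_def using weight_measure(1)[OF V] \<psi>(1)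
    by (intro integral_distr borel_measurable_continuous_onI) auto
  ultimately show ?thesis by simp
qed

text \<open>A rescaled bump lies below the indicator of the ball, so the mass ratios dominate the
  blow-up integrals, whose limit is m x times the positive integral of \<open>bump\<close> over P.
  Half of this limit serves as a lower bound at small radii.\<close>

lemma lower_density_pos:
  assumes fin: "finite_measure (weight V)" and V: "sets V = sets borel"
    and eq: "\<forall>\<phi>. continuous_on UNIV \<phi> \<and> compactly_supported \<phi> \<longrightarrow>
           (LINT z|V. \<phi> z) = (LINT x:S|hausdorff2_measure. \<phi> (x, T x) * m x)"
    and tan: "approx_tangent_plane S m x P" and m: "0 < m x"
  shows "0 < lower_density V x"
proof -
  interpret W: finite_measure "weight V" by fact
  define c where "c = m x * (LINT y:Rep_plane P|hausdorff2_measure. bump y)"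
  have c: "0 < c" using m bump_plane_integral_pos[of P] by (simp add: c_def)
  let ?g = "\<lambda>r. (LINT y:S|hausdorff2_measure. bump ((1 / r) *\<^sub>R (y - x)) * m y) / r\<^sup>2"
  have "compactly_supported (bump :: real^3 \<Rightarrow> real)"
    by (rule compactly_supportedI[where K="cball 0 1"]) (auto simp: bump_def split: if_splits)
  then have "(?g \<longlongrightarrow> c) (at_right 0)"
    using tan continuous_on_bump unfolding approx_tangent_plane_def c_def by blast
  then have ev: "\<forall>\<^sub>F r in at_right 0. c / 2 < ?g r"
    using c by (intro order_tendstoD(1)) auto
  have "\<forall>\<^sub>F r in at_right 0. ennreal (c / (2 * pi)) \<le> emeasure (weight V) (ball x r) / ennreal (pi * r\<^sup>2)"
    using ev eventually_at_right_less[of "0 :: real"]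
  proof eventually_elim
    case (elim r)
    let ?b = "\<lambda>y. bump ((1 / r) *\<^sub>R (y - x))"
    have bc: "continuous_on UNIV ?b" by (intro continuous_on_compose2[OF continuous_on_bump] continuous_intros) auto
    have out: "?b y = 0" if "y \<notin> ball x r" for y
    proof -
      have "r \<le> norm (y - x)" using that by (simp add: dist_norm norm_minus_commute)
      then show ?thesis using elim by (simp add: bump_def divide_simps)
    qed
    have "compactly_supported ?b"
      by (rule compactly_supportedI[where K="ball x r"]) (use out in auto)
    then have "(LINT y:S|hausdorff2_measure. ?b y * m y) = (LINT y|weight V. ?b y)"
      using weight_integral[OF V eq bc] by simp
    also have "\<dots> \<le> (LINT y|weight V. indicat_real (ball x r) y)"
    proof (rule integral_mono)
      show "integrable (weight V) ?b"
      proof (rule W.integrable_const_bound[where B=1])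
        show "AE y in weight V. norm (?b y) \<le> 1" by (simp add: bump_bounds)
        show "?b \<in> borel_measurable (weight V)"
          using borel_measurable_continuous_onI[OF bc] weight_measure(2)[OF V] by (simp cong: measurable_cong_sets)
      qed
      show "integrable (weight V) (indicat_real (ball x r))"
        using weight_measure(2)[OF V] by (intro integrable_real_indicator) (auto simp: less_top[symmetric])
      show "?b y \<le> indicat_real (ball x r) y" for y
        using out[of y] bump_bounds[of "(1 / r) *\<^sub>R (y - x)"] by (auto simp: indicator_def)
    qed
    also have "\<dots> = measure (weight V) (ball x r)"
      by (simp add: sets_eq_imp_space_eq[OF weight_measure(2)[OF V]])
    finally have "c / 2 < measure (weight V) (ball x r) / r\<^sup>2"
      using elim by (smt (verit) divide_right_mono zero_le_power2)
    then have "c / (2 * pi) \<le> measure (weight V) (ball x r) / (pi * r\<^sup>2)"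
      using elim by (simp add: field_simps)
    then have "ennreal (c / (2 * pi)) \<le> ennreal (measure (weight V) (ball x r) / (pi * r\<^sup>2))" by (rule ennreal_leI)
    also have "\<dots> = emeasure (weight V) (ball x r) / ennreal (pi * r\<^sup>2)"
      using elim by (simp add: W.emeasure_eq_measure divide_ennreal)
    finally show ?case .
  qed
  then have "ennreal (c / (2 * pi)) \<le> lower_density V x"
    unfolding lower_density_def by (rule Liminf_bounded)
  moreover have "0 < ennreal (c / (2 * pi))" using c by simp
  ultimately show ?thesis by (rule less_le_trans[rotated])
qed

text \<open>A Borel set E inside the set of positive lower density makes the complement measurable:
  E consists of the points of S outside a Borel null set that contains all points without a tangent
  plane. Inner regularity reduces the claim to compact sets, where continuous functions compare the
  weight with the Hausdorff integral.\<close>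

lemma rectifiable_varifold_concentrated:
  assumes rect: "rectifiable_varifold V" and fin: "emeasure (weight V) UNIV < \<infinity>"
  shows "\<exists>E\<in>sets borel. E \<subseteq> {x. 0 < lower_density V x} \<and> emeasure (weight V) (- E) = 0"
proof -
  let ?H = "hausdorff2_measure :: (real^3) measure"
  have V: "sets V = sets borel" using rect by (simp add: rectifiable_varifold_def varifold_def)
  obtain S m T where "S \<in> sets borel \<and> countably_2_rectifiable S \<and>
        set_borel_measurable borel S m \<and> (\<forall>x\<in>S. 0 < m x) \<and>
        (\<forall>K. compact K \<longrightarrow> set_integrable ?H (K \<inter> S) m) \<and> T \<in> borel \<rightarrow>\<^sub>M borel \<and>
        (AE x in ?H. x \<in> S \<longrightarrow> approx_tangent_plane S m x (T x)) \<and>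
        (\<forall>\<phi>. continuous_on UNIV \<phi> \<and> compactly_supported \<phi> \<longrightarrow>
           (LINT z|V. \<phi> z) = (LINT x:S|?H. \<phi> (x, T x) * m x))"
    using rect[unfolded rectifiable_varifold_def, THEN conjunct2] by (elim exE) (rule that)
  then have S [measurable]: "S \<in> sets borel"
    and mm: "set_borel_measurable borel S m" and mpos: "\<forall>x\<in>S. 0 < m x"
    and mint: "\<forall>K. compact K \<longrightarrow> set_integrable ?H (K \<inter> S) m"
    and tan: "AE x in ?H. x \<in> S \<longrightarrow> approx_tangent_plane S m x (T x)"
    and eq: "\<forall>\<phi>. continuous_on UNIV \<phi> \<and> compactly_supported \<phi> \<longrightarrow>
           (LINT z|V. \<phi> z) = (LINT x:S|?H. \<phi> (x, T x) * m x)"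
    by blast+
  have sH [measurable_cong, simp]: "sets ?H = sets borel" by (rule sets_hausdorff2_measure)
  have spH: "space ?H = UNIV" using sets_eq_imp_space_eq[OF sH] by simp
  have sW [simp]: "sets (weight V) = sets borel" by (rule weight_measure(2)[OF V])
  have spW: "space (weight V) = UNIV" using sets_eq_imp_space_eq[OF sW] by simp
  have finW: "finite_measure (weight V)" using fin by (intro finite_measureI) (simp add: spW)
  interpret W: finite_measure "weight V" by fact
  obtain N where N: "{x \<in> space ?H. \<not> (x \<in> S \<longrightarrow> approx_tangent_plane S m x (T x))} \<subseteq> N" "emeasure ?H N = 0" "N \<in> sets ?H"
    using tan by (rule AE_E)
  define E where "E = S - N"
  have E [measurable]: "E \<in> sets borel" using N(3) by (simp add: E_def)
  have "E \<subseteq> {x. 0 < lower_density V x}"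
  proof
    fix x assume "x \<in> E"
    then have "x \<in> S" "approx_tangent_plane S m x (T x)" using N(1) by (auto simp: E_def spH)
    then show "x \<in> {x. 0 < lower_density V x}"
      using lower_density_pos[OF finW V eq] mpos by blast
  qed
  moreover have "emeasure (weight V) K = 0" if K: "compact K" "K \<subseteq> - E" for K
  proof (cases "K = {}")
    case False
    \<comment> \<open>Continuous functions decreasing to the indicator of K. Index 0 is the constant
      1, so compact support starts at the successors.\<close>
    define \<psi> where "\<psi> n x = max 0 (1 - real n * infdist x K)" for n and x :: "real^3"
    have \<psi>c: "continuous_on UNIV (\<psi> n)" for n unfolding \<psi>_def[abs_def] by (intro continuous_intros)
    have \<psi>b: "0 \<le> \<psi> n x" "\<psi> n x \<le> 1" for n x using infdist_nonneg[of x K] by (auto simp: \<psi>_def)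
    define K1 where "K1 = {x. infdist x K \<le> 1}"
    have K1: "compact K1" unfolding K1_def by (rule compact_infdist_le[OF False K(1)]) simp
    have \<psi>0: "\<psi> (Suc n) x = 0" if "x \<notin> K1" for n x
    proof -
      have "1 \<le> infdist x K" using that by (simp add: K1_def)
      then have "1 * 1 \<le> real (Suc n) * infdist x K" by (intro mult_mono) auto
      then show ?thesis by (simp add: \<psi>_def)
    qed
    have \<psi>s: "compactly_supported (\<psi> (Suc n))" for n
      by (rule compactly_supportedI[where K=K1]) (use \<psi>0 K1 compact_imp_bounded in auto)
    have Km [measurable]: "K \<in> sets borel" using K(1) by (simp add: borel_compact)
    have K1m [measurable]: "K1 \<in> sets borel" using K1 by (simp add: borel_compact)
    have \<psi>m [measurable]: "\<psi> n \<in> borel_measurable borel" for n by (rule borel_measurable_continuous_onI[OF \<psi>c])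
    have wm [measurable]: "(\<lambda>x. indicat_real S x * m x) \<in> borel_measurable borel"
      using mm by (simp add: set_borel_measurable_def)
    have le: "measure (weight V) K \<le> (LINT x|?H. \<psi> (Suc n) x * (indicat_real S x * m x))" for n
    proof -
      have "measure (weight V) K = (LINT x|weight V. indicat_real K x)" by (simp add: spW)
      also have "\<dots> \<le> (LINT x|weight V. \<psi> (Suc n) x)"
      proof (rule integral_mono)
        show "integrable (weight V) (indicat_real K)" by (intro integrable_real_indicator) (auto simp: less_top[symmetric])
        show "integrable (weight V) (\<psi> (Suc n))"
        proof (rule W.integrable_const_bound[where B=1])
          show "AE x in weight V. norm (\<psi> (Suc n) x) \<le> 1" using \<psi>b by (intro AE_I2) auto
        qed (simp cong: measurable_cong_sets)
        show "indicat_real K x \<le> \<psi> (Suc n) x" for x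
          using \<psi>b[of "Suc n" x] by (auto simp: indicator_def \<psi>_def)
      qed
      also have "\<dots> = (LINT x|?H. \<psi> (Suc n) x * (indicat_real S x * m x))"
        using weight_integral[OF V eq \<psi>c \<psi>s] by (simp add: set_lebesgue_integral_def mult_ac)
      finally show ?thesis .
    qed
    have lim: "(\<lambda>n. LINT x|?H. \<psi> (Suc n) x * (indicat_real S x * m x)) \<longlonglongrightarrow> (LINT x|?H. indicat_real K x * (indicat_real S x * m x))"
    \<comment> \<open>Local integrability of m, applied to the compact neighbourhood K1, supplies
      the dominating function.\<close>
    proof (rule integral_dominated_convergence[where w="\<lambda>x. indicat_real (K1 \<inter> S) x * m x"])
      show "integrable ?H (\<lambda>x. indicat_real (K1 \<inter> S) x * m x)"
        using mint K1 by (simp add: set_integrable_def)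
      show "AE x in ?H. (\<lambda>n. \<psi> (Suc n) x * (indicat_real S x * m x)) \<longlonglongrightarrow> indicat_real K x * (indicat_real S x * m x)"
      proof (intro AE_I2 tendsto_mult_right)
        fix x
        show "(\<lambda>n. \<psi> (Suc n) x) \<longlonglongrightarrow> indicat_real K x"
        proof (cases "x \<in> K")
          case True
          then have "\<psi> (Suc n) x = 1" for n by (simp add: \<psi>_def)
          then show ?thesis using True by simp
        next
          case False
          then have i: "0 < infdist x K"
            using in_closed_iff_infdist_zero[OF compact_imp_closed[OF K(1)] \<open>K \<noteq> {}\<close>, of x] infdist_nonneg[of x K] by auto
          obtain n0 where n0: "1 / infdist x K < real n0" using reals_Archimedean2 by blast
          have "\<psi> (Suc n) x = 0" if "n0 \<le> n" for n
          proof -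
            have "1 / infdist x K \<le> real (Suc n)" using n0 that by linarith
            then have "1 \<le> real (Suc n) * infdist x K" using i by (simp add: divide_le_eq)
            then show ?thesis by (simp add: \<psi>_def)
          qed
          then have "\<forall>\<^sub>F n in sequentially. \<psi> (Suc n) x = 0" by (auto simp: eventually_sequentially)
          then show ?thesis using False by (simp add: tendsto_eventually)
        qed
      qed
      show "AE x in ?H. norm (\<psi> (Suc n) x * (indicat_real S x * m x)) \<le> indicat_real (K1 \<inter> S) x * m x" for n
      proof (rule AE_I2)
        fix x
        show "norm (\<psi> (Suc n) x * (indicat_real S x * m x)) \<le> indicat_real (K1 \<inter> S) x * m x"
          using \<psi>b[of "Suc n" x] \<psi>0[of x n] mpos
          by (cases "x \<in> S"; cases "x \<in> K1") (auto simp: abs_mult mult_left_le_one_le)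
      qed
    qed measurable
    \<comment> \<open>K avoids E, so it meets S only inside the null set N.\<close>
    have "(LINT x|?H. indicat_real K x * (indicat_real S x * m x)) = (LINT x|?H. 0)"
    proof (rule integral_cong_AE)
      have "AE x in ?H. x \<notin> N" using N(2,3) by (intro AE_not_in) auto
      then show "AE x in ?H. indicat_real K x * (indicat_real S x * m x) = 0"
      proof eventually_elim
        case (elim x)
        then show ?case using K(2) by (auto simp: E_def indicator_def)
      qed
    qed measurable
    then have "measure (weight V) K \<le> 0"
      using LIMSEQ_le_const[OF lim] le by simp
    then show ?thesis by (simp add: W.emeasure_eq_measure measure_le_0_iff)
  qed simp
  then have "(SUP K\<in>{K. K \<subseteq> - E \<and> compact K}. emeasure (weight V) K) \<le> 0"
    by (intro SUP_least) auto
  then have "emeasure (weight V) (- E) = 0"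
    using inner_regular[of "weight V" "- E"] E fin by (simp add: spW)
  ultimately show ?thesis using E by blast
qed

section \<open>The projected measures\<close>

text \<open>One term of Euler's sum for F. The gradient is odd, so the sign of the chosen normal
  does not matter.\<close>

definition axis_energy :: "(real^3 \<Rightarrow> real) \<Rightarrow> 3 \<Rightarrow> (real^3) \<times> plane \<Rightarrow> real" where
  "axis_energy F k z = plane_normal (snd z) $ k * gradient F (plane_normal (snd z)) $ k"

locale projected_integrand =
  fixes F :: "real^3 \<Rightarrow> real"
  assumes F: "integrand F" and cv: "convex_on UNIV F"
    and even: "\<And>i \<nu>. F (\<chi> j. if j = i then - \<nu> $ j else \<nu> $ j) = F \<nu>"
    and dir: "\<And>k. \<exists>g. \<forall>\<nu>\<in>sphere 0 1. coord_proj k \<nu> \<noteq> 0 \<longrightarrow>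
      coord_proj k (gradient F \<nu>) /\<^sub>R norm (coord_proj k (gradient F \<nu>)) =
      g (coord_proj k \<nu> /\<^sub>R norm (coord_proj k \<nu>))"
begin

lemma normal_nonzero: "plane_normal P \<noteq> 0"
  using norm_plane_normal[of P] by auto

lemma axis_energy_nonneg: "0 \<le> axis_energy F k z"
  unfolding axis_energy_def using F cv normal_nonzero even by (rule component_gradient_nonneg)

lemma axis_energy_sum: "(\<Sum>k\<in>UNIV. axis_energy F k z) = F (plane_normal (snd z))"
proof -
  have "(\<Sum>k\<in>UNIV. axis_energy F k z) = plane_normal (snd z) \<bullet> gradient F (plane_normal (snd z))"
    by (simp add: axis_energy_def inner_vec_def)
  also have "\<dots> = F (plane_normal (snd z))"
    using integrand_euler[OF F normal_nonzero] by (subst inner_commute)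
  finally show ?thesis .
qed

lemma borel_measurable_plane_function:
  assumes V: "sets V = sets borel" and f: "continuous_on (sphere 0 1) f" "\<And>\<nu>. \<nu> \<in> sphere 0 1 \<Longrightarrow> f (- \<nu>) = f \<nu>"
  shows "(\<lambda>z :: (real^3) \<times> plane. f (plane_normal (snd z)) :: real) \<in> borel_measurable V"
proof -
  have "continuous_on UNIV (\<lambda>z :: (real^3) \<times> plane. f (plane_normal (snd z)))"
    by (rule continuous_on_compose2[OF continuous_on_plane_normal[OF f] continuous_on_snd[OF continuous_on_id]]) auto
  then show ?thesis using V by (simp add: borel_measurable_continuous_onI cong: measurable_cong_sets)
qed

lemma axis_energy_measurable: "sets V = sets borel \<Longrightarrow> axis_energy F k \<in> borel_measurable V"
  unfolding axis_energy_def[abs_def]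
proof (rule borel_measurable_plane_function)
  show "continuous_on (sphere 0 1) (\<lambda>\<nu>. \<nu> $ k * gradient F \<nu> $ k)"
    by (intro continuous_intros continuous_on_sphere_integrand(2)[OF F])
  fix \<nu> :: "real^3" assume "\<nu> \<in> sphere 0 1"
  then have "\<nu> \<noteq> 0" by auto
  then show "(- \<nu>) $ k * gradient F (- \<nu>) $ k = \<nu> $ k * gradient F \<nu> $ k"
    by (simp add: gradient_minus[OF F])
qed

lemma B_matrix_measurable:
  assumes "sets V = sets borel"
  shows "(\<lambda>z :: (real^3) \<times> plane. B_matrix F (plane_normal (snd z)) $ i $ j) \<in> borel_measurable V"
proof (rule borel_measurable_plane_function[OF assms])
  show "continuous_on (sphere 0 1) (\<lambda>\<nu>. B_matrix F \<nu> $ i $ j)"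
    by (intro continuous_on_component continuous_on_sphere_integrand(3)[OF F])
  fix \<nu> :: "real^3" assume "\<nu> \<in> sphere 0 1"
  then have "\<nu> \<noteq> 0" by auto
  then show "B_matrix F (- \<nu>) $ i $ j = B_matrix F \<nu> $ i $ j" by (simp add: B_matrix_minus[OF F])
qed

lemma axis_energy_open_bound:
  assumes V: "finite_measure V" "sets V = sets borel"
    and T: "total_first_variation F V \<le> ennreal T" "0 < T"
    and ijk: "i \<noteq> j" "k \<noteq> i" "k \<noteq> j" and U: "open U"
  shows "(emeasure (distr (density V (axis_energy F k)) borel (\<lambda>z. (fst z $ i, fst z $ j))) U)\<^sup>2
    \<le> ennreal (3 * pi\<^sup>2 * T\<^sup>2) * emeasure lborel U"
proof -
  interpret finite_measure V by fact
  let ?M = "\<lambda>z :: (real^3) \<times> plane. B_matrix F (plane_normal (snd z))"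
  obtain b where b: "\<And>P. norm (B_matrix F (plane_normal P)) \<le> b"
    using bounded_plane_normal[OF continuous_on_sphere_integrand(3)[OF F]] by blast
  obtain g where g: "\<And>P. norm (gradient F (plane_normal P)) \<le> g"
    using bounded_plane_normal[OF continuous_on_sphere_integrand(2)[OF F]] by blast
  define B where "B = max b g"
  have MB: "\<bar>?M z $ n $ l\<bar> \<le> B" for z n l
  proof -
    have "\<bar>?M z $ n $ l\<bar> \<le> norm (?M z $ n)" by (rule component_le_norm_cart)
    also have "\<dots> \<le> norm (?M z)" by (rule Finite_Cartesian_Product.norm_nth_le)
    also have "\<dots> \<le> B" using b[of "snd z"] by (simp add: B_def)
    finally show ?thesis .
  qed
  have cB: "\<bar>axis_energy F k z\<bar> \<le> B" for z
  proof -
    have "\<bar>axis_energy F k z\<bar> \<le> norm (plane_normal (snd z)) * norm (gradient F (plane_normal (snd z)))"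
      unfolding axis_energy_def abs_mult by (intro mult_mono component_le_norm_cart) auto
    then show ?thesis using g[of "snd z"] by (simp add: norm_plane_normal B_def)
  qed
  \<comment> \<open>By Euler's identity a diagonal entry is the sum of the axis energies of the
    other two axes.\<close>
  have diag: "0 \<le> ?M z $ n $ n" for z n
  proof -
    have "axis_energy F n z \<le> (\<Sum>l\<in>UNIV. axis_energy F l z)"
      using axis_energy_nonneg by (intro member_le_sum) auto
    then show ?thesis unfolding axis_energy_sum by (simp add: B_matrix_def axis_energy_def)
  qed
  obtain d where d: "\<forall>\<nu>\<in>sphere 0 1. coord_proj k \<nu> \<noteq> 0 \<longrightarrow>
      coord_proj k (gradient F \<nu>) /\<^sub>R norm (coord_proj k (gradient F \<nu>)) =
      d (coord_proj k \<nu> /\<^sub>R norm (coord_proj k \<nu>))" using dir[of k] by (elim exE) (rule that)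
  have Ym: "(\<lambda>z. (fst z $ i, fst z $ j)) \<in> borel_measurable V"
  proof -
    have "continuous_on UNIV (\<lambda>z :: (real^3) \<times> plane. (fst z $ i, fst z $ j))" by (intro continuous_intros)
    then show ?thesis using V(2) by (simp add: borel_measurable_continuous_onI cong: measurable_cong_sets)
  qed
  show ?thesis
  proof (rule planar_square_bound[where B=B and T=T and Maa="\<lambda>z. ?M z $ i $ i" and Mab="\<lambda>z. ?M z $ i $ j"
        and Mba="\<lambda>z. ?M z $ j $ i" and Mbb="\<lambda>z. ?M z $ j $ j"])
    show "divergence_bound V (\<lambda>z. (fst z $ i, fst z $ j)) T (\<lambda>z. ?M z $ i $ i) (\<lambda>z. ?M z $ i $ j)"
      "divergence_bound V (\<lambda>z. (fst z $ i, fst z $ j)) T (\<lambda>z. ?M z $ j $ i) (\<lambda>z. ?M z $ j $ j)"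
      by (rule divergence_bound_B_matrix[OF F V T(1) less_imp_le[OF T(2)]])+
    show "2 * (axis_energy F k z * axis_energy F k z') \<le> ?M z $ i $ i * ?M z' $ j $ j + ?M z $ j $ j * ?M z' $ i $ i
      - ?M z $ i $ j * ?M z' $ j $ i - ?M z $ j $ i * ?M z' $ i $ j" for z z'
      unfolding axis_energy_def
      by (rule B_matrix_mixed_discriminant[OF F cv even d[rule_format] ijk plane_normal_in_sphere plane_normal_in_sphere])
  qed (rule Ym MB cB diag T(2) U axis_energy_nonneg B_matrix_measurable[OF V(2)] axis_energy_measurable[OF V(2)])+
qed

end

lemma two_other_indices:
  fixes k :: 3
  obtains i j where "i \<noteq> j" "k \<noteq> i" "k \<noteq> j"
proof -
  have "card (UNIV - {k}) = 2" by (simp add: card_Diff_singleton)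
  then obtain i j where "UNIV - {k} = {i, j}" "i \<noteq> j" unfolding card_2_iff by blast
  then have "i \<noteq> j" "k \<noteq> i" "k \<noteq> j" by auto
  then show ?thesis by (rule that)
qed

context projected_integrand
begin

lemma emeasure_axis_energy_distr:
  assumes V: "sets V = sets borel" and A: "A \<in> sets borel"
  shows "emeasure (distr (density V (axis_energy F k)) borel (\<lambda>z. (fst z $ i, fst z $ j))) A
    = (\<integral>\<^sup>+z. ennreal (axis_energy F k z) * indicator ((\<lambda>z. (fst z $ i, fst z $ j)) -` A) z \<partial>V)"
proof -
  have sp: "space V = UNIV" using sets_eq_imp_space_eq[OF V] by simp
  have "continuous_on UNIV (\<lambda>z :: (real^3) \<times> plane. (fst z $ i, fst z $ j))" by (intro continuous_intros)
  then have Y: "(\<lambda>z. (fst z $ i, fst z $ j)) \<in> borel_measurable V"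
    using V by (simp add: borel_measurable_continuous_onI cong: measurable_cong_sets)
  then have "(\<lambda>z. (fst z $ i, fst z $ j)) -` A \<in> sets V"
    using measurable_sets[OF Y A] sp by simp
  then show ?thesis
    using Y A sp axis_energy_measurable[OF V, of k] by (simp add: emeasure_distr emeasure_density)
qed

text \<open>Almost all of V lies over E, so every open set containing the projection of E carries
  the whole projected mass. Such sets exist with area arbitrarily close to 11 h, and 33 = 3 *
  11.\<close>

lemma axis_energy_integral_bound:
  assumes V: "finite_measure V" "sets V = sets borel"
    and T: "total_first_variation F V \<le> ennreal T" "0 < T"
    and E: "E \<in> sets borel" "emeasure (weight V) (- E) = 0" and h: "hausdorff2 E \<le> ennreal h" "0 \<le> h"
  shows "(\<integral>\<^sup>+z. ennreal (axis_energy F k z) \<partial>V)\<^sup>2 \<le> ennreal (33 * pi\<^sup>2 * T\<^sup>2 * h)"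
proof -
  obtain i j where ijk: "i \<noteq> j" "k \<noteq> i" "k \<noteq> j" by (rule two_other_indices)
  let ?Y = "\<lambda>z :: (real^3) \<times> plane. (fst z $ i, fst z $ j)"
  let ?\<mu> = "distr (density V (axis_energy F k)) borel ?Y"
  let ?I = "\<integral>\<^sup>+z. ennreal (axis_energy F k z) \<partial>V"
  have aeE: "AE z in V. fst z \<in> E"
  proof (rule AE_I')
    show "fst -` (- E) \<in> null_sets V"
      using E weight_measure[OF V(2)] measurable_sets[OF weight_measure(1)[OF V(2)], of "- E"] sets_eq_imp_space_eq[OF V(2)]
      by (auto simp: null_sets_def)
  qed auto
  have "?I\<^sup>2 \<le> ennreal (33 * pi\<^sup>2 * T\<^sup>2 * h) + ennreal e" if e: "0 < e" for e
  proof -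
    \<comment> \<open>The excess area 19 d is multiplied by 3 pi^2 T^2; as 57 = 3 * 19, the error is
      exactly e.\<close>
    define d where "d = e / (57 * pi\<^sup>2 * T\<^sup>2)"
    have d: "0 < d" using e T by (simp add: d_def)
    have "\<bar>x $ l - y $ l\<bar> \<le> dist x y" for x y :: "real^3" and l
      using component_le_norm_cart[of "x - y" l] by (simp add: dist_norm)
    then obtain U where U: "open U" "(\<lambda>x. (x $ i, x $ j)) ` E \<subseteq> U" "emeasure lborel U \<le> ennreal (11 * h + 19 * d)"
      using hausdorff2_projection_subset_open[OF h d, of "\<lambda>x. (x $ i, x $ j)"] by auto
    have "?I = (\<integral>\<^sup>+z. ennreal (axis_energy F k z) * indicator (?Y -` U) z \<partial>V)"
    proof (rule nn_integral_cong_AE)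
      show "AE z in V. ennreal (axis_energy F k z) = ennreal (axis_energy F k z) * indicator (?Y -` U) z"
        using aeE
      proof eventually_elim
        case (elim z)
        then have "?Y z \<in> U" using U(2) by blast
        then show ?case by simp
      qed
    qed
    also have "\<dots> = emeasure ?\<mu> U"
      using U(1) by (intro emeasure_axis_energy_distr[OF V(2), symmetric]) simp
    finally have "?I\<^sup>2 \<le> ennreal (3 * pi\<^sup>2 * T\<^sup>2) * emeasure lborel U"
      using axis_energy_open_bound[OF V T ijk U(1)] by simp
    also have "\<dots> \<le> ennreal (3 * pi\<^sup>2 * T\<^sup>2) * ennreal (11 * h + 19 * d)"
      using U(3) by (rule mult_left_mono) simp
    also have "\<dots> = ennreal (33 * pi\<^sup>2 * T\<^sup>2 * h + e)"
    proof -
      have "3 * pi\<^sup>2 * T\<^sup>2 * (11 * h + 19 * d) = 33 * pi\<^sup>2 * T\<^sup>2 * h + e"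
        using T by (simp add: d_def field_simps)
      then show ?thesis by (simp add: ennreal_mult'[symmetric])
    qed
    also have "\<dots> = ennreal (33 * pi\<^sup>2 * T\<^sup>2 * h) + ennreal e"
      using e h by (intro ennreal_plus) auto
    finally show ?thesis .
  qed
  then show ?thesis by (rule ennreal_le_epsilon)
qed

text \<open>With vanishing first variation the final bound reads 0 even if the area is infinite,
  since 0 times infinity is 0. Every T > 0 is then an admissible bound, and letting it tend to 0 on
  balls, whose area is finite, annihilates the projected measure.\<close>

lemma axis_energy_integral_zero:
  assumes V: "finite_measure V" "sets V = sets borel" and T: "total_first_variation F V = 0"
  shows "(\<integral>\<^sup>+z. ennreal (axis_energy F k z) \<partial>V) = 0"
proof -
  obtain i j where ijk: "i \<noteq> j" "k \<noteq> i" "k \<noteq> j" by (rule two_other_indices)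
  let ?Y = "\<lambda>z :: (real^3) \<times> plane. (fst z $ i, fst z $ j)"
  let ?\<mu> = "distr (density V (axis_energy F k)) borel ?Y"
  have "emeasure ?\<mu> (ball 0 (real n)) = 0" for n
  proof -
    have fin: "emeasure lborel (ball (0 :: real \<times> real) (real n)) < \<infinity>"
      by (rule emeasure_lborel_ball_finite)
    define b where "b = enn2real (emeasure lborel (ball (0 :: real \<times> real) (real n)))"
    have b: "emeasure lborel (ball (0 :: real \<times> real) (real n)) = ennreal b" "0 \<le> b"
      using fin by (auto simp: b_def)
    have "(emeasure ?\<mu> (ball 0 (real n)))\<^sup>2 \<le> 0 + ennreal e" if e: "0 < e" for e
    proof -
      \<comment> \<open>The summand 1 keeps the denominator positive for n = 0, where the ball is
        empty.\<close>
      define T where "T = sqrt (e / (3 * pi\<^sup>2 * (b + 1)))"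
      have T0: "0 < T" "T\<^sup>2 = e / (3 * pi\<^sup>2 * (b + 1))" using e b by (auto simp: T_def)
      have "(emeasure ?\<mu> (ball 0 (real n)))\<^sup>2 \<le> ennreal (3 * pi\<^sup>2 * T\<^sup>2) * ennreal b"
        using axis_energy_open_bound[OF V _ T0(1) ijk, of "ball 0 (real n)"] T b by simp
      also have "\<dots> = ennreal (3 * pi\<^sup>2 * T\<^sup>2 * b)" by (simp add: ennreal_mult'[symmetric])
      also have "\<dots> \<le> ennreal e"
      proof (rule ennreal_leI)
        have "3 * pi\<^sup>2 * T\<^sup>2 * b = e * (b / (b + 1))" unfolding T0(2) using b by simp
        also have "\<dots> \<le> e * 1" using e b by (intro mult_left_mono) (auto simp: divide_le_eq)
        finally show "3 * pi\<^sup>2 * T\<^sup>2 * b \<le> e" by simp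
      qed
      finally show ?thesis by simp
    qed
    then have "(emeasure ?\<mu> (ball 0 (real n)))\<^sup>2 \<le> 0" by (rule ennreal_le_epsilon)
    then show ?thesis by (simp add: power2_eq_square)
  qed
  then have "emeasure ?\<mu> (\<Union>n. ball 0 (real n)) = 0" by (intro emeasure_UN_eq_0) auto
  moreover have "(\<Union>n. ball 0 (real n)) = (UNIV :: (real \<times> real) set)"
    using reals_Archimedean2 by auto
  ultimately have "emeasure ?\<mu> UNIV = 0" by simp
  then show ?thesis using emeasure_axis_energy_distr[OF V(2), of UNIV k i j] by simp
qed

text \<open>The axis energies sum to F, which is at least l on unit normals, and each of the three
  integrals is at most R. The degenerate values 0 of the first variation and infinity of the area
  are treated apart.\<close>

lemma weight_le_first_variation:
  assumes "0 < l" and l: "\<And>\<nu>. \<nu> \<in> sphere 0 1 \<Longrightarrow> l \<le> F \<nu>"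
    and rect: "rectifiable_varifold V" and W: "emeasure (weight V) UNIV < \<infinity>" and T: "total_first_variation F V < \<infinity>"
  shows "emeasure (weight V) UNIV \<le> ennreal (3 * sqrt 33 * pi / l) *
    ennreal_sqrt (hausdorff2 {x. 0 < lower_density V x}) * total_first_variation F V"
proof -
  have V: "sets V = sets borel" using rect by (simp add: rectifiable_varifold_def varifold_def)
  have WV: "emeasure (weight V) UNIV = emeasure V (space V)"
    using weight_measure(3)[OF V, of UNIV] sets_eq_imp_space_eq[OF V] by simp
  have finV: "finite_measure V" using W WV by (intro finite_measureI) auto
  interpret finite_measure V by fact
  let ?I = "\<lambda>k. \<integral>\<^sup>+z. ennreal (axis_energy F k z) \<partial>V"
  have sum: "ennreal l * emeasure (weight V) UNIV \<le> (\<Sum>k\<in>UNIV. ?I k)"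
  proof -
    have "ennreal l * emeasure (weight V) UNIV = (\<integral>\<^sup>+z. ennreal l \<partial>V)" by (simp add: WV)
    also have "\<dots> \<le> (\<integral>\<^sup>+z. (\<Sum>k\<in>UNIV. ennreal (axis_energy F k z)) \<partial>V)"
    proof (rule nn_integral_mono)
      fix z
      have "l \<le> (\<Sum>k\<in>UNIV. axis_energy F k z)"
        unfolding axis_energy_sum using l plane_normal_in_sphere by blast
      then show "ennreal l \<le> (\<Sum>k\<in>UNIV. ennreal (axis_energy F k z))"
        using axis_energy_nonneg by (simp add: sum_ennreal ennreal_leI)
    qed
    also have "\<dots> = (\<Sum>k\<in>UNIV. ?I k)"
      using axis_energy_measurable[OF V] by (intro nn_integral_sum) measurable
    finally show ?thesis .
  qed
  let ?H = "hausdorff2 {x. 0 < lower_density V x}"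
  let ?t = "total_first_variation F V"
  show ?thesis
  proof (cases "?t = 0")
    case True
    then have "ennreal l * emeasure (weight V) UNIV = 0"
      using sum axis_energy_integral_zero[OF finV V] by simp
    then show ?thesis using \<open>0 < l\<close> by (simp add: ennreal_eq_0_iff)
  next
    case t0: False
    define t where "t = enn2real ?t"
    have t: "?t = ennreal t" "0 < t"
      using T t0 by (auto simp: t_def enn2real_positive_iff zero_less_iff_neq_zero)
    show ?thesis
    proof (cases "?H = \<infinity>")
      case top: True
      have "0 < 3 * sqrt 33 * pi / l" using \<open>0 < l\<close> by simp
      then show ?thesis
        using t top by (simp add: ennreal_sqrt_def ennreal_mult_top ennreal_top_mult ennreal_eq_0_iff)
    next
      case False
      define h where "h = enn2real ?H"
      have h: "?H = ennreal h" "0 \<le> h" using False by (auto simp: h_def less_top)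
      obtain E where E: "E \<in> sets borel" "E \<subseteq> {x. 0 < lower_density V x}" "emeasure (weight V) (- E) = 0"
        using rectifiable_varifold_concentrated[OF rect W] by blast
      have hE: "hausdorff2 E \<le> ennreal h" using hausdorff2_mono[OF E(2)] h by simp
      define R where "R = sqrt 33 * pi * t * sqrt h"
      have R: "0 \<le> R" "R\<^sup>2 = 33 * pi\<^sup>2 * t\<^sup>2 * h" using t h by (auto simp: R_def power_mult_distrib)
      have "?I k \<le> ennreal R" for k
      proof (cases "?I k" rule: ennreal_cases)
        case (real r)
        have "(?I k)\<^sup>2 \<le> ennreal (R\<^sup>2)"
          using axis_energy_integral_bound[OF finV V _ t(2) E(1,3) hE h(2), of k] t(1) R(2) by simp
        then have "r\<^sup>2 \<le> R\<^sup>2" using real by (simp add: ennreal_power ennreal_le_iff)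
        then have "r \<le> R" using R(1) by (rule power2_le_imp_le)
        then show ?thesis using real by (simp add: ennreal_leI)
      next
        case top
        have "(?I k)\<^sup>2 \<le> ennreal (R\<^sup>2)"
          using axis_energy_integral_bound[OF finV V _ t(2) E(1,3) hE h(2), of k] t(1) R(2) by simp
        then show ?thesis using top by (simp add: power2_eq_square top_unique)
      qed
      then have "(\<Sum>k\<in>UNIV. ?I k) \<le> (\<Sum>k\<in>(UNIV :: 3 set). ennreal R)" by (intro sum_mono)
      also have "\<dots> = ennreal (3 * R)" using R(1) by (simp add: ennreal_mult')
      finally have "ennreal l * emeasure (weight V) UNIV \<le> ennreal (3 * R)" using sum by (rule order_trans[rotated])
      moreover obtain w where w: "emeasure (weight V) UNIV = ennreal w" "0 \<le> w"
        using W by (cases "emeasure (weight V) UNIV" rule: ennreal_cases) auto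
      ultimately have "l * w \<le> 3 * R" using \<open>0 < l\<close> R(1) by (simp add: ennreal_mult'[symmetric] ennreal_le_iff)
      then have "w \<le> (3 * sqrt 33 * pi / l) * sqrt h * t" using \<open>0 < l\<close> by (simp add: R_def field_simps)
      then have "ennreal w \<le> ennreal ((3 * sqrt 33 * pi / l) * sqrt h * t)" by (rule ennreal_leI)
      also have "\<dots> = ennreal (3 * sqrt 33 * pi / l) * ennreal (sqrt h) * ennreal t"
        using \<open>0 < l\<close> h(2) t(2) by (intro trans[OF ennreal_mult] arg_cong2[where f="(*)"] ennreal_mult refl) auto
      finally show ?thesis using w h t by (simp add: ennreal_sqrt_def)
    qed
  qed
qed

end

theorem theorem1p5:
  fixes F :: "real^3 \<Rightarrow> real"
  assumes "integrand F" and "strictly_convex_integrand F"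
    and even_components: "\<forall>i \<nu>. F (\<chi> j. if j = i then - \<nu> $ j else \<nu> $ j) = F \<nu>"
    and proj_direction: "\<forall>k. \<exists>g. \<forall>\<nu>\<in>sphere 0 1. coord_proj k \<nu> \<noteq> 0 \<longrightarrow>
      coord_proj k (gradient F \<nu>) /\<^sub>R norm (coord_proj k (gradient F \<nu>)) =
      g (coord_proj k \<nu> /\<^sub>R norm (coord_proj k \<nu>))"
  shows "\<exists>C::real. 0 < C \<and>
    (\<forall>V. rectifiable_varifold V \<and> emeasure (weight V) UNIV < \<infinity> \<and> total_first_variation F V < \<infinity> \<longrightarrow>
      emeasure (weight V) UNIV \<le>
        ennreal C * ennreal_sqrt (hausdorff2 {x. 0 < lower_density V x}) * total_first_variation F V)"
proof -
  interpret projected_integrand F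
  proof
    show "convex_on UNIV F" using assms(2) by (simp add: strictly_convex_integrand_def)
    show "F (\<chi> j. if j = i then - \<nu> $ j else \<nu> $ j) = F \<nu>" for i \<nu>
      using even_components by (elim allE)
    show "\<exists>g. \<forall>\<nu>\<in>sphere 0 1. coord_proj k \<nu> \<noteq> 0 \<longrightarrow>
      coord_proj k (gradient F \<nu>) /\<^sub>R norm (coord_proj k (gradient F \<nu>)) =
      g (coord_proj k \<nu> /\<^sub>R norm (coord_proj k \<nu>))" for k
      using proj_direction by (elim allE)
  qed fact
  \<comment> \<open>A continuous function attains its minimum on a nonempty compact set; the minimum
    of F on the sphere is the constant l, positive because F is.\<close>
  have "axis 1 1 \<in> sphere (0 :: real^3) 1" by simp
  then have "sphere (0 :: real^3) 1 \<noteq> {}" by blast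
  then obtain \<nu>0 where \<nu>0: "\<nu>0 \<in> sphere 0 1" "\<And>\<nu>. \<nu> \<in> sphere 0 1 \<Longrightarrow> F \<nu>0 \<le> F \<nu>"
    using continuous_attains_inf[OF compact_sphere _ continuous_on_sphere_integrand(1)[OF F]] by metis
  then have "0 < F \<nu>0" using F by (simp add: integrand_def)
  then show ?thesis
    using weight_le_first_variation[OF _ \<nu>0(2)] by (intro exI[of _ "3 * sqrt 33 * pi / F \<nu>0"]) auto
qed

end
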